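(* Let $k$ be a positive integer and let $X$ be a nontrivial real or complex Banach space with the Radon-Nikodým property. The following are equivalent: (1) $n^{(k)}(X)=1$. (2) $|x^*(x)|=1$ for each $x\in \tilde\rho\,\mathcal{P}({}^k X)$ and each $x^*\in \mathrm{ext}(B_{X^*})$. In addition, when $X$ is separable, $n^{(k)}(X)=1$ if and only if $|x^*(x)|=1$ for each $x\in \tilde\rho\,\mathcal{P}({}^k X)$ and each $x^*\in w^*\mathrm{exp}(B_{X^*})$.
   Context: Let $\mathbb{K}$ be the scalar field ($\mathbb{R}$ or $\mathbb{C}$) of $X$, $X^*$ the dual of $X$, and $B_X$, $B_{X^*}$ the closed unit balls. For Banach spaces $X,Y$ over $\mathbb{K}$, $C_b(B_X:Y)$ is the Banach space of bounded continuous functions $f:B_X\to Y$ with $\|f\|=\sup_{x\in B_X}\|f(x)\|$. A bounded $k$-homogeneous polynomial $P:X\to Y$ is a map $P(x)=L(x,\dots,x)$ with $L:X\times\cdots\times X\to Y$ a continuous $k$-multilinear map; $\mathcal{P}({}^kX:Y)$ is the space of these, viewed as a subspace of $C_b(B_X:Y)$ (so $\|P\|=\sup_{x\in B_X}\|P(x)\|$), and $\mathcal{P}({}^kX)=\mathcal{P}({}^kX:\mathbb{K})$. Let $\Pi(X)=\{(x,x^* )\in B_X\times B_{X^*}: x^*(x)=1=\|x\|=\|x^*\|\}$. The numerical radius of $f\in C_b(B_X:X)$ is $v(f)=\sup\{|x^*f(x)|:(x,x^* )\in\Pi(X)\}$, and the $k$-polynomial numerical index is $n^{(k)}(X)=\inf\{v(P):P\in\mathcal{P}({}^kX:X),\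 \|P\|=1\}$. A nonzero $f\in C_b(B_X:Y)$ strongly attains its norm at $x_0\in B_X$ if whenever $(x_n)$ is a sequence in $B_X$ with $\lim_n\|f(x_n)\|=\|f\|$, it has a subsequence converging in norm to $\alpha x_0$ for some $\alpha\in\mathbb{K}$ with $|\alpha|=1$. For a subspace $H$ of $C_b(B_X:Y)$, $\tilde\rho H$ is the set of all $x_0$ such that some $f\in H$ strongly attains its norm at $x_0$. $\mathrm{ext}(K)$ is the set of extreme points of a convex set $K$. A point $x^*\in B_{X^*}$ is a weak-$*$ exposed point of $B_{X^*}$ if there is $x\in B_X$ such that $x^*(x)=1$ and such that $y^*(x)=1$ with $y^*\in B_{X^*}$ implies $y^*=x^*$; $w^*\mathrm{exp}(B_{X^*})$ is the set of all such points. A point $x$ of a nonempty convex set $K\subset X$ is strongly exposed if there is a nonzero $x^*\in B_{X^*}$ with $\mathrm{Re}\,x^*(x)=\sup_{y\in K}\mathrm{Re}\,x^*(y)$ such that whenever $(x_n)\subset K$ and $\mathrm{Re}\,x^*(x_n)\to\mathrm{Re}\,x^*(x)$, one has $\|x_n-x\|\to0$. $X$ has the Radon-Nikodým property if every nonempty bounded closed convex subset of $X$ is the closed convex hull of its strongly exposed points. *)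

theory Defs
  imports "HOL-Analysis.Analysis"
begin

text \<open>
  Scalar fields that are isometrically isomorphic to the reals or to the complex numbers
  (see \<open>range_to_complex\<close> below), so that real and complex Banach spaces can be treated
  by one statement. The instances \<open>real\<close> and \<open>complex\<close> are the intended ones.
\<close>

class real_or_complex = real_normed_field +
  fixes to_complex :: "'a \<Rightarrow> complex"
  assumes to_complex_add: "to_complex (a + b) = to_complex a + to_complex b"
    and to_complex_mult: "to_complex (a * b) = to_complex a * to_complex b"
    and to_complex_scaleR: "to_complex (r *\<^sub>R a) = r *\<^sub>R to_complex a"
    and norm_to_complex: "norm (to_complex a) = norm a"

instantiation real :: real_or_complex
begin
definition to_complex_real :: "real \<Rightarrow> complex" where "to_complex_real r = of_real r"
instance
proof
  fix a b r :: real
  show "to_complex (a + b) = to_complex a + to_complex b"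
    by (simp only: to_complex_real_def of_real_add)
  show "to_complex (a * b) = to_complex a * to_complex b"
    by (simp only: to_complex_real_def of_real_mult)
  show "to_complex (r *\<^sub>R a) = r *\<^sub>R to_complex a"
    by (simp only: to_complex_real_def real_scaleR_def of_real_mult scaleR_conv_of_real)
  show "norm (to_complex a) = norm a"
    by (simp only: to_complex_real_def norm_of_real real_norm_def)
qed
end

instantiation complex :: real_or_complex
begin
definition to_complex_complex :: "complex \<Rightarrow> complex" where "to_complex_complex z = z"
instance by standard (simp_all only: to_complex_complex_def)
end

lemma to_complex_one [simp]: "to_complex (1::'k::real_or_complex) = 1"
proof -
  have "to_complex (1::'k) * to_complex (1::'k) = to_complex (1::'k)"
    by (metis mult_1 to_complex_mult)
  moreover have "to_complex (1::'k) \<noteq> 0"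
    by (metis norm_one norm_to_complex norm_zero zero_neq_one)
  ultimately show ?thesis by simp
qed

lemma to_complex_of_real: "to_complex (of_real r :: 'k::real_or_complex) = of_real r"
proof -
  have "to_complex (r *\<^sub>R (1::'k)) = r *\<^sub>R 1"
    by (simp only: to_complex_scaleR to_complex_one)
  then show ?thesis by (simp only: of_real_def)
qed

lemma range_to_complex:
  "range (to_complex :: 'k::real_or_complex \<Rightarrow> complex) = \<real> \<or>
   range (to_complex :: 'k \<Rightarrow> complex) = UNIV"
proof (cases "range (to_complex :: 'k \<Rightarrow> complex) \<subseteq> \<real>")
  case True
  moreover have "\<real> \<subseteq> range (to_complex :: 'k \<Rightarrow> complex)"
  proof
    fix z :: complex assume "z \<in> \<real>"
    then obtain r where "z = of_real r" by (rule Reals_cases)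
    then have "z = to_complex (of_real r :: 'k)" by (simp only: to_complex_of_real)
    then show "z \<in> range (to_complex :: 'k \<Rightarrow> complex)" by (rule range_eqI)
  qed
  ultimately show ?thesis by blast
next
  case False
  then obtain a :: 'k where "to_complex a \<notin> \<real>"
    by blast
  then have a: "Im (to_complex a) \<noteq> 0"
    by (simp add: complex_is_Real_iff)
  have "z \<in> range (to_complex :: 'k \<Rightarrow> complex)" for z
  proof -
    define t where "t = Im z / Im (to_complex a)"
    define s where "s = Re z - t * Re (to_complex a)"
    have "t * Im (to_complex a) = Im z"
      using a by (simp add: t_def)
    then have "to_complex (of_real s + of_real t * a) = z"
      by (simp add: to_complex_add to_complex_mult to_complex_of_real complex_eq_iff s_def
          del: of_real_diff of_real_mult)
    then show ?thesis by (intro range_eqI[OF sym])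
  qed
  then show ?thesis by blast
qed

text \<open>
  A normed space over such a field: a type with its real normed structure, together with a
  compatible multiplication by scalars. With \<open>'a::banach\<close> this is a Banach space over \<open>'k\<close>.
\<close>

locale normed_space_over = vector_space scaleX
  for scaleX :: "'k::real_or_complex \<Rightarrow> 'a::real_normed_vector \<Rightarrow> 'a" +
  assumes scale_of_real: "scaleX (of_real r) x = r *\<^sub>R x"
    and norm_scale: "norm (scaleX c x) = norm c * norm x"

lemma normed_space_over_real:
  "normed_space_over (scaleR :: real \<Rightarrow> 'a::real_normed_vector \<Rightarrow> 'a)"
  by standard (simp_all add: algebra_simps)

lemma normed_space_over_scalars:
  "normed_space_over ((*) :: 'k::real_or_complex \<Rightarrow> 'k \<Rightarrow> 'k)"
  by standard (simp_all add: algebra_simps scaleR_conv_of_real norm_mult)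

subsection \<open>Duality\<close>

definition dual_ball :: "('k::real_or_complex \<Rightarrow> 'a::real_normed_vector \<Rightarrow> 'a) \<Rightarrow> ('a \<Rightarrow>\<^sub>L 'k) set"
  where "dual_ball scaleX =
    {xs. Vector_Spaces.linear scaleX (*) (blinfun_apply xs) \<and> norm xs \<le> 1}"

definition ext_points :: "'v::real_vector set \<Rightarrow> 'v set"
  where "ext_points K = {x. x extreme_point_of K}"

definition weak_star_exposed ::
  "('k::real_or_complex \<Rightarrow> 'a::real_normed_vector \<Rightarrow> 'a) \<Rightarrow> ('a \<Rightarrow>\<^sub>L 'k) set"
  where "weak_star_exposed scaleX =
    {xs \<in> dual_ball scaleX. \<exists>x\<in>cball 0 1. blinfun_apply xs x = 1 \<and>
        (\<forall>ys\<in>dual_ball scaleX. blinfun_apply ys x = 1 \<longrightarrow> ys = xs)}"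

definition strongly_exposed_points ::
  "('k::real_or_complex \<Rightarrow> 'a::real_normed_vector \<Rightarrow> 'a) \<Rightarrow> 'a set \<Rightarrow> 'a set"
  where "strongly_exposed_points scaleX K =
    {x \<in> K. \<exists>xs\<in>dual_ball scaleX. xs \<noteq> 0 \<and>
        (let re = (\<lambda>y. Re (to_complex (blinfun_apply xs y))) in
          bdd_above (re ` K) \<and> re x = (SUP y\<in>K. re y) \<and>
          (\<forall>s::nat \<Rightarrow> 'a. (\<forall>n. s n \<in> K) \<longrightarrow> (\<lambda>n. re (s n)) \<longlonglongrightarrow> re x \<longrightarrow>
             (\<lambda>n. norm (s n - x)) \<longlonglongrightarrow> 0))}"

definition radon_nikodym ::
  "('k::real_or_complex \<Rightarrow> 'a::real_normed_vector \<Rightarrow> 'a) \<Rightarrow> bool"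
  where "radon_nikodym scaleX \<longleftrightarrow>
    (\<forall>K::'a set. K \<noteq> {} \<longrightarrow> bounded K \<longrightarrow> closed K \<longrightarrow> convex K \<longrightarrow>
       K = closure (convex hull (strongly_exposed_points scaleX K)))"

subsection \<open>Functions on the unit ball\<close>

text \<open>
  Elements of \<open>C_b(B_X : Y)\<close> are represented by functions on the whole space; all notions
  below depend only on their values on the closed unit ball.
\<close>

definition Cb :: "('a::real_normed_vector \<Rightarrow> 'b::real_normed_vector) set"
  where "Cb = {f. continuous_on (cball 0 1) f \<and> bounded (f ` cball 0 1)}"

definition ball_norm :: "('a::real_normed_vector \<Rightarrow> 'b::real_normed_vector) \<Rightarrow> real"
  where "ball_norm f = (SUP x\<in>cball 0 1. norm (f x))"

definition strongly_attains_at ::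
  "('k::real_or_complex \<Rightarrow> 'a::real_normed_vector \<Rightarrow> 'a) \<Rightarrow> ('a \<Rightarrow> 'b::real_normed_vector) \<Rightarrow> 'a \<Rightarrow> bool"
  where "strongly_attains_at scaleX f x0 \<longleftrightarrow>
    f \<in> Cb \<and> (\<exists>x\<in>cball 0 1. f x \<noteq> 0) \<and> x0 \<in> cball 0 1 \<and>
    (\<forall>s::nat \<Rightarrow> 'a. (\<forall>n. s n \<in> cball 0 1) \<longrightarrow> (\<lambda>n. norm (f (s n))) \<longlonglongrightarrow> ball_norm f \<longrightarrow>
       (\<exists>r \<alpha>. strict_mono r \<and> norm \<alpha> = 1 \<and> (s \<circ> r) \<longlonglongrightarrow> scaleX \<alpha> x0))"

definition rho_tilde ::
  "('k::real_or_complex \<Rightarrow> 'a::real_normed_vector \<Rightarrow> 'a) \<Rightarrow> ('a \<Rightarrow> 'b::real_normed_vector) set \<Rightarrow> 'a set"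
  where "rho_tilde scaleX H = {x0. \<exists>f\<in>H. strongly_attains_at scaleX f x0}"

subsection \<open>Homogeneous polynomials and the polynomial numerical index\<close>

text \<open>
  The power \<open>X^k\<close> is the set \<open>{..<k} \<rightarrow>\<^sub>E UNIV\<close> with the topology inherited from the product
  topology on \<open>nat \<Rightarrow> 'a\<close>; since the coordinates outside \<open>{..<k}\<close> are frozen to
  \<open>undefined\<close>, this is the product topology of \<open>k\<close> copies of \<open>X\<close>.
\<close>

definition continuous_multilinear ::
  "('k::real_or_complex \<Rightarrow> 'a::real_normed_vector \<Rightarrow> 'a) \<Rightarrow> ('k \<Rightarrow> 'b::real_normed_vector \<Rightarrow> 'b) \<Rightarrow>
   nat \<Rightarrow> ((nat \<Rightarrow> 'a) \<Rightarrow> 'b) \<Rightarrow> bool"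
  where "continuous_multilinear scaleX scaleY k L \<longleftrightarrow>
    continuous_on ({..<k} \<rightarrow>\<^sub>E UNIV) L \<and>
    (\<forall>x \<in> {..<k} \<rightarrow>\<^sub>E UNIV. \<forall>i<k. Vector_Spaces.linear scaleX scaleY (\<lambda>y. L (x(i := y))))"

definition hom_polys ::
  "('k::real_or_complex \<Rightarrow> 'a::real_normed_vector \<Rightarrow> 'a) \<Rightarrow> ('k \<Rightarrow> 'b::real_normed_vector \<Rightarrow> 'b) \<Rightarrow>
   nat \<Rightarrow> ('a \<Rightarrow> 'b) set"
  where "hom_polys scaleX scaleY k =
    {P. \<exists>L. continuous_multilinear scaleX scaleY k L \<and> (\<forall>x. P x = L (\<lambda>i\<in>{..<k}. x))}"

definition state_pairs ::
  "('k::real_or_complex \<Rightarrow> 'a::real_normed_vector \<Rightarrow> 'a) \<Rightarrow> ('a \<times> ('a \<Rightarrow>\<^sub>L 'k)) set"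
  where "state_pairs scaleX =
    {(x, xs). x \<in> cball 0 1 \<and> xs \<in> dual_ball scaleX \<and>
       blinfun_apply xs x = 1 \<and> norm x = 1 \<and> norm xs = 1}"

definition numerical_radius ::
  "('k::real_or_complex \<Rightarrow> 'a::real_normed_vector \<Rightarrow> 'a) \<Rightarrow> ('a \<Rightarrow> 'a) \<Rightarrow> real"
  where "numerical_radius scaleX f =
    (SUP (x, xs)\<in>state_pairs scaleX. norm (blinfun_apply xs (f x)))"

definition poly_num_index ::
  "nat \<Rightarrow> ('k::real_or_complex \<Rightarrow> 'a::real_normed_vector \<Rightarrow> 'a) \<Rightarrow> real"
  where "poly_num_index k scaleX =
    (INF P\<in>{P \<in> hom_polys scaleX scaleX k. ball_norm P = 1}. numerical_radius scaleX P)"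

end

theory Submission
  imports Defs
begin

text \<open>
  Suppose the index is 1 and let \<open>f\<close> strongly attain its norm at \<open>x0\<close>. Testing the numerical
  radius on the polynomials \<open>f \<otimes> z\<close> yields, for every \<open>z\<close>, functionals that almost norm \<open>z\<close>
  and have modulus almost 1 at \<open>x0\<close>; by Milman's theorem every extreme functional then has
  modulus 1 at \<open>x0\<close>. Conversely, a variational principle of Stegall's type shows that the
  strongly attaining polynomials from \<open>X\<close> to \<open>X\<close> are dense. If \<open>Q\<close> strongly attains its norm
  at \<open>x0\<close>, then so does a scalar polynomial \<open>y* \<circ> Q\<close>, hence an extreme functional norming
  \<open>Q x0\<close> is, up to rotation, a state at \<open>x0\<close> and \<open>v(Q) = \<parallel>Q\<parallel>\<close>. In the separable case
  Mazur's theorem on smooth points makes the weak-* exposed functionals norming.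
\<close>

subsection \<open>Hahn-Banach and Krein-Milman\<close>

text \<open>A weak-* compact convex set of real functionals is determined by its support functional,
  so such sets appear here as sublinear functionals: intersections of chains become pointwise
  infima, and Zorn's lemma on these infima takes the place of weak-* compactness. Scalar-linear
  functionals enter through their real parts, which determine them without loss of norm; extreme
  points of the dual ball then correspond to extreme minorants of \<open>norm\<close>.

  The obstacle in the converse is that a variational principle perturbs by a linear functional,
  whereas the perturbed map must stay homogeneous of degree \<open>k\<close>. Multiplying by the
  power \<open>k - 1\<close> of a fixed functional restores the degree, but the principle then
  controls only weighted points, and one has to show that the weights stay away from 0. Perturbing
  along a single vector suffices: taken parallel to the value at the limit point and suitably
  rotated, it turns the triangle inequality into an equality there.\<close>

definition sublinear :: "('a::real_vector \<Rightarrow> real) \<Rightarrow> bool"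
  where "sublinear p \<longleftrightarrow>
    (\<forall>x y. p (x + y) \<le> p x + p y) \<and> (\<forall>c\<ge>0. \<forall>x. p (c *\<^sub>R x) = c * p x)"

lemma sublinear_add: "sublinear p \<Longrightarrow> p (x + y) \<le> p x + p y"
  and sublinear_scale: "sublinear p \<Longrightarrow> c \<ge> 0 \<Longrightarrow> p (c *\<^sub>R x) = c * p x"
  by (simp_all add: sublinear_def)

lemma sublinear_zero: "sublinear p \<Longrightarrow> p 0 = 0"
  using sublinear_scale[of p 0 0] by simp

lemma sublinear_minus: "sublinear p \<Longrightarrow> - p (- x) \<le> p x"
  using sublinear_add[of p x "- x"] sublinear_zero[of p] by simp

text \<open>One inequality for positive scalars is enough: applied with \<open>1 / c\<close> at the
  point \<open>c *\<^sub>R x\<close> it gives the reverse one.\<close>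

lemma sublinearI:
  assumes add: "\<And>x y. p (x + y) \<le> p x + p y"
    and zero: "p 0 = 0"
    and scale: "\<And>c x. c > 0 \<Longrightarrow> p (c *\<^sub>R x) \<le> c * p x"
  shows "sublinear p"
  unfolding sublinear_def
proof (intro conjI allI impI add)
  fix c :: real and x assume "c \<ge> 0"
  show "p (c *\<^sub>R x) = c * p x"
  proof (cases "c = 0")
    case False
    with \<open>c \<ge> 0\<close> have c: "c > 0" by simp
    have "p ((1 / c) *\<^sub>R c *\<^sub>R x) \<le> (1 / c) * p (c *\<^sub>R x)"
      using c by (intro scale) simp
    then have "c * p x \<le> p (c *\<^sub>R x)"
      using c by (simp add: field_simps)
    with scale[OF c, of x] show ?thesis by simp
  qed (simp add: zero)
qed

lemma sublinear_norm: "sublinear (norm :: 'a::real_normed_vector \<Rightarrow> real)"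
  by (simp add: sublinear_def norm_triangle_ineq)

lemma sublinear_max:
  assumes "sublinear p" "sublinear q"
  shows "sublinear (\<lambda>x. max (p x) (q x))"
proof (rule sublinearI)
  show "max (p (x + y)) (q (x + y)) \<le> max (p x) (q x) + max (p y) (q y)" for x y
    using sublinear_add[OF assms(1), of x y] sublinear_add[OF assms(2), of x y] by linarith
  show "max (p (c *\<^sub>R x)) (q (c *\<^sub>R x)) \<le> c * max (p x) (q x)" if "c > 0" for c x
    using that by (simp add: sublinear_scale[OF assms(1)] sublinear_scale[OF assms(2)])
qed (simp add: assms sublinear_zero)

text \<open>
  The largest sublinear functional below \<open>p\<close> whose linear minorants \<open>f\<close> satisfy
  \<open>\<beta> v \<le> f v\<close> on \<open>C\<close>. Norming functionals, separation of points from convex sets and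
  extension from subspaces all come from suitable choices of \<open>C\<close> and \<open>\<beta>\<close>.
\<close>

definition envelope ::
  "('a::real_vector \<Rightarrow> real) \<Rightarrow> 'a set \<Rightarrow> ('a \<Rightarrow> real) \<Rightarrow> 'a \<Rightarrow> real"
  where "envelope p C \<beta> z = (INF (s, v)\<in>{0..} \<times> C. p (z + s *\<^sub>R v) - s * \<beta> v)"

context
  fixes p :: "'a::real_vector \<Rightarrow> real" and C :: "'a set" and \<beta> :: "'a \<Rightarrow> real"
  assumes p: "sublinear p" and C: "C \<noteq> {}" and \<beta>: "concave_on C \<beta>"
    and le: "\<And>v. v \<in> C \<Longrightarrow> \<beta> v \<le> p v"
begin

text \<open>This bound, uniform in \<open>s\<close> and \<open>v\<close>, keeps the infimum in
  \<open>envelope\<close> finite.\<close>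

lemma envelope_term_ge:
  assumes "s \<ge> 0" "v \<in> C"
  shows "- p (- z) \<le> p (z + s *\<^sub>R v) - s * \<beta> v"
proof -
  have "s * \<beta> v \<le> p (s *\<^sub>R v)"
    using assms le by (simp add: sublinear_scale[OF p] mult_left_mono)
  also have "\<dots> \<le> p (z + s *\<^sub>R v) + p (- z)"
    using sublinear_add[OF p, of "z + s *\<^sub>R v" "- z"] by simp
  finally show ?thesis by simp
qed

lemma envelope_le_term:
  assumes "s \<ge> 0" "v \<in> C"
  shows "envelope p C \<beta> z \<le> p (z + s *\<^sub>R v) - s * \<beta> v"
proof -
  have "bdd_below ((\<lambda>(s, v). p (z + s *\<^sub>R v) - s * \<beta> v) ` ({0..} \<times> C))"
    by (rule bdd_belowI2[of _ "- p (- z)"]) (use envelope_term_ge in auto)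
  from cINF_lower[OF this, of "(s, v)"] show ?thesis
    using assms by (simp add: envelope_def)
qed

lemma envelope_greatest:
  assumes "\<And>s v. s \<ge> 0 \<Longrightarrow> v \<in> C \<Longrightarrow> m \<le> p (z + s *\<^sub>R v) - s * \<beta> v"
  shows "m \<le> envelope p C \<beta> z"
  unfolding envelope_def by (rule cINF_greatest) (use assms C in auto)

lemma envelope_le: "envelope p C \<beta> z \<le> p z"
  using envelope_le_term[of 0] C by auto

lemma envelope_minus: "v \<in> C \<Longrightarrow> envelope p C \<beta> (- v) \<le> - \<beta> v"
  using envelope_le_term[of 1 v "- v"] by (simp add: sublinear_zero[OF p])

text \<open>Together with \<open>envelope_minus\<close> this identifies the linear minorants of the
  envelope: they are the minorants of \<open>p\<close> that dominate \<beta> on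
  \<open>C\<close>.\<close>

lemma linear_le_envelope:
  assumes f: "linear f" "\<And>x. f x \<le> p x" "\<And>v. v \<in> C \<Longrightarrow> \<beta> v \<le> f v"
  shows "f z \<le> envelope p C \<beta> z"
proof (rule envelope_greatest)
  fix s :: real and v assume "s \<ge> 0" "v \<in> C"
  then have "s * \<beta> v \<le> s * f v" by (simp add: f mult_left_mono)
  then show "f z \<le> p (z + s *\<^sub>R v) - s * \<beta> v"
    using f(2)[of "z + s *\<^sub>R v"] by (simp add: linear_add[OF f(1)] linear_scale[OF f(1)])
qed

text \<open>Subadditivity is where concavity enters. Two terms with data \<open>(s, v)\<close> and
  \<open>(t, u)\<close> merge into one with weight \<open>s + t\<close> at the corresponding convex
  combination \<open>w\<close> of \<open>v\<close> and \<open>u\<close>, and \<beta> at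
  \<open>w\<close> is at least the same combination of the two values.\<close>

lemma sublinear_envelope: "sublinear (envelope p C \<beta>)"
proof (rule sublinearI)
  fix x y
  have key: "envelope p C \<beta> (x + y) \<le>
      (p (x + s *\<^sub>R v) - s * \<beta> v) + (p (y + t *\<^sub>R u) - t * \<beta> u)"
    if "s \<ge> 0" "v \<in> C" "t \<ge> 0" "u \<in> C" for s t v u
  proof (cases "s + t = 0")
    case True
    then have "s = 0" "t = 0" using that by auto
    then show ?thesis
      using envelope_le[of "x + y"] sublinear_add[OF p, of x y] by simp
  next
    case False
    then have st: "s + t > 0" using that by linarith
    define w where "w = (s / (s + t)) *\<^sub>R v + (t / (s + t)) *\<^sub>R u"
    have one: "s / (s + t) + t / (s + t) = 1"
      using st by (simp flip: add_divide_distrib)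
    have w: "w \<in> C"
      unfolding w_def using \<beta> that st one
      by (intro convexD) (simp_all add: concave_on_iff)
    have "\<beta> w \<ge> (s / (s + t)) * \<beta> v + (t / (s + t)) * \<beta> u"
      unfolding w_def using \<beta> that(2,4) that(1,3)[THEN divide_nonneg_pos[OF _ st]] one
      unfolding concave_on_iff by blast
    then have "(s + t) * \<beta> w \<ge> (s + t) * ((s / (s + t)) * \<beta> v + (t / (s + t)) * \<beta> u)"
      using st by (intro mult_left_mono) auto
    also have "(s + t) * ((s / (s + t)) * \<beta> v + (t / (s + t)) * \<beta> u) = s * \<beta> v + t * \<beta> u"
      using st by (simp add: distrib_left)
    finally have b: "(s + t) * \<beta> w \<ge> s * \<beta> v + t * \<beta> u" .
    have "(s + t) *\<^sub>R w = s *\<^sub>R v + t *\<^sub>R u"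
      using st by (simp add: w_def scaleR_add_right)
    then have "x + y + (s + t) *\<^sub>R w = (x + s *\<^sub>R v) + (y + t *\<^sub>R u)" by simp
    then have "p (x + y + (s + t) *\<^sub>R w) \<le> p (x + s *\<^sub>R v) + p (y + t *\<^sub>R u)"
      using sublinear_add[OF p] by metis
    with envelope_le_term[of "s + t" w "x + y"] w st b show ?thesis by simp
  qed
  have "envelope p C \<beta> (x + y) - (p (y + t *\<^sub>R u) - t * \<beta> u) \<le> envelope p C \<beta> x"
    if "t \<ge> 0" "u \<in> C" for t u
    by (rule envelope_greatest) (use key that in \<open>simp add: algebra_simps\<close>)
  then have "envelope p C \<beta> (x + y) - envelope p C \<beta> x \<le> envelope p C \<beta> y"
    by (intro envelope_greatest) (simp add: algebra_simps)
  then show "envelope p C \<beta> (x + y) \<le> envelope p C \<beta> x + envelope p C \<beta> y" by simp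
next
  show "envelope p C \<beta> 0 = 0"
    using envelope_le[of 0] envelope_greatest[of 0 0] envelope_term_ge[of _ _ 0]
    by (simp add: sublinear_zero[OF p])
next
  fix c :: real and x assume c: "c > 0"
  have "envelope p C \<beta> (c *\<^sub>R x) / c \<le> envelope p C \<beta> x"
  proof (rule envelope_greatest)
    fix s :: real and v assume "s \<ge> 0" "v \<in> C"
    then have "envelope p C \<beta> (c *\<^sub>R x) \<le> p (c *\<^sub>R x + (c * s) *\<^sub>R v) - (c * s) * \<beta> v"
      using c by (intro envelope_le_term) auto
    also have "c *\<^sub>R x + (c * s) *\<^sub>R v = c *\<^sub>R (x + s *\<^sub>R v)"
      by (simp add: scaleR_add_right)
    also have "p (c *\<^sub>R (x + s *\<^sub>R v)) = c * p (x + s *\<^sub>R v)"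
      using c by (simp add: sublinear_scale[OF p])
    finally show "envelope p C \<beta> (c *\<^sub>R x) / c \<le> p (x + s *\<^sub>R v) - s * \<beta> v"
      using c by (simp add: field_simps)
  qed
  with c show "envelope p C \<beta> (c *\<^sub>R x) \<le> c * envelope p C \<beta> x"
    by (simp add: field_simps)
qed

end

text \<open>
  A sublinear functional is facial if its linear minorants form a face of the linear
  minorants of \<open>p\<close>. A minimal facial functional is linear, which gives the Hahn-Banach and
  the Krein-Milman theorem by a single use of Zorn's lemma.
\<close>

definition facial :: "('a::real_vector \<Rightarrow> real) \<Rightarrow> ('a \<Rightarrow> real) \<Rightarrow> bool"
  where "facial p q \<longleftrightarrow> sublinear q \<and> q \<le> p \<and>
    (\<forall>g h. linear g \<longrightarrow> linear h \<longrightarrow> g \<le> p \<longrightarrow> h \<le> p \<longrightarrow> (\<forall>x. g x + h x \<le> 2 * q x) \<longrightarrow>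
      g \<le> q \<and> h \<le> q)"

text \<open>An extreme point of the set of linear minorants of \<open>p\<close>, tested on midpoints
  only. For \<open>p = norm\<close> these turn out to be the real parts of the extreme points of the
  dual ball.\<close>

definition extreme_minorant :: "('a::real_vector \<Rightarrow> real) \<Rightarrow> ('a \<Rightarrow> real) \<Rightarrow> bool"
  where "extreme_minorant p f \<longleftrightarrow> linear f \<and> f \<le> p \<and>
    (\<forall>g h. linear g \<longrightarrow> linear h \<longrightarrow> g \<le> p \<longrightarrow> h \<le> p \<longrightarrow> (\<forall>x. g x + h x = 2 * f x) \<longrightarrow>
      g = f)"

lemma facialD:
  assumes "facial p q" "linear g" "linear h" "g \<le> p" "h \<le> p" "\<And>x. g x + h x \<le> 2 * q x"
  shows "g \<le> q" "h \<le> q"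
  using assms by (simp_all add: facial_def)

lemma facial_refl: "sublinear p \<Longrightarrow> facial p p"
  by (simp add: facial_def)

text \<open>The minorants of this envelope are the minorants \<open>f\<close> of \<open>q\<close>
  with \<open>f y = q y\<close>, the face of \<open>q\<close> on which evaluation at
  \<open>y\<close> is maximal. If \<open>g + h\<close> lies below twice the envelope, then at
  \<open>- y\<close> this forces \<open>g y + h y\<close> up to \<open>2 * q y\<close>, while
  neither summand exceeds \<open>q y\<close>.\<close>

lemma facial_envelope_point:
  assumes "facial p q"
  shows "facial p (envelope q {y} (\<lambda>_. q y))" (is "facial p ?e")
proof -
  have q: "sublinear q" and qp: "q \<le> p" using assms by (simp_all add: facial_def)
  have conc: "concave_on {y} (\<lambda>_. q y)" by (simp add: concave_on_iff flip: distrib_right)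
  note env = sublinear_envelope[OF q _ conc] envelope_le[OF q _ conc]
    envelope_minus[OF q _ conc] linear_le_envelope[OF q _ conc]
  have e_le: "?e x \<le> q x" for x by (rule env(2)) auto
  show ?thesis
    unfolding facial_def
  proof (intro conjI allI impI)
    show "sublinear ?e" by (rule env(1)) auto
    show "?e \<le> p"
    proof (rule le_funI)
      show "?e x \<le> p x" for x using e_le[of x] le_funD[OF qp, of x] by linarith
    qed
    fix g h assume g: "linear g" "g \<le> p" and h: "linear h" "h \<le> p"
      and gh: "\<forall>x. g x + h x \<le> 2 * ?e x"
    have sum: "g x + h x \<le> 2 * q x" for x
      using gh[rule_format, of x] e_le[of x] by linarith
    have le: "g \<le> q" "h \<le> q"
      by (rule facialD[OF assms g(1) h(1) g(2) h(2) sum])+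
    have "?e (- y) \<le> - q y" by (rule env(3)) auto
    then have "g (- y) + h (- y) \<le> 2 * (- q y)" using gh[rule_format, of "- y"] by linarith
    then have "g y + h y \<ge> 2 * q y"
      using g h by (simp add: linear_neg)
    moreover have "g y \<le> q y" "h y \<le> q y" using le by (auto simp: le_fun_def)
    ultimately have "q y \<le> g y" "q y \<le> h y" by linarith+
    then show "g \<le> ?e" "h \<le> ?e"
      using le g h by (auto simp: le_fun_def intro!: env(4))
  qed
qed

text \<open>Minimality makes \<open>q\<close> equal to its envelope at every point \<open>y\<close>,
  so \<open>q (- y) \<le> - q y\<close>; an odd sublinear functional is linear. Extremality is then
  the face property read for \<open>g + h = 2 * q\<close>.\<close>

lemma facial_minimal_linear:
  assumes "facial p q" and min: "\<And>q'. facial p q' \<Longrightarrow> q' \<le> q \<Longrightarrow> q' = q"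
  shows "extreme_minorant p q"
proof -
  have q: "sublinear q" and qp: "q \<le> p" using assms by (simp_all add: facial_def)
  have conc: "concave_on {y} (\<lambda>_. q y)" for y
    by (simp add: concave_on_iff flip: distrib_right)
  have neg: "q (- y) = - q y" for y
  proof -
    have "envelope q {y} (\<lambda>_. q y) \<le> q"
      using envelope_le[OF q _ conc] by (auto simp: le_fun_def)
    then have "envelope q {y} (\<lambda>_. q y) = q"
      by (intro min facial_envelope_point assms)
    moreover have "envelope q {y} (\<lambda>_. q y) (- y) \<le> - q y"
      by (rule envelope_minus[OF q _ conc]) auto
    ultimately have "q (- y) \<le> - q y" by simp
    with sublinear_minus[OF q, of y] show ?thesis by simp
  qed
  have lin: "linear q"
  proof (rule linearI)
    fix x y
    have "q (- (x + y)) \<le> q (- x) + q (- y)"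
      using sublinear_add[OF q, of "- x" "- y"] by (simp add: algebra_simps)
    then show "q (x + y) = q x + q y"
      using sublinear_add[OF q, of x y] by (simp only: neg)
  next
    fix c :: real and x
    show "q (c *\<^sub>R x) = c *\<^sub>R q x"
    proof (cases "c \<ge> 0")
      case False
      then have "q ((- c) *\<^sub>R x) = (- c) * q x" by (intro sublinear_scale q) simp
      then show ?thesis by (simp add: neg)
    qed (simp add: sublinear_scale[OF q])
  qed
  show ?thesis
    unfolding extreme_minorant_def
  proof (intro conjI allI impI lin qp)
    fix g h assume gh: "linear g" "linear h" "g \<le> p" "h \<le> p" "\<forall>x. g x + h x = 2 * q x"
    then have "g \<le> q" "h \<le> q" using assms(1) by (auto simp: facial_def)
    then have le: "g x \<le> q x" "h x \<le> q x" for x by (auto simp: le_fun_def)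
    show "g = q"
    proof
      fix x show "g x = q x"
        using gh(5)[rule_format, of x] le[of x] by linarith
    qed
  qed
qed

text \<open>An infimum of sublinear functionals is in general not subadditive. On a chain it is,
  because the smaller of two members can serve both summands.\<close>

lemma facial_chain_Inf:
  assumes fac: "\<And>q. q \<in> \<C> \<Longrightarrow> facial p q" and ne: "\<C> \<noteq> {}"
    and chain: "\<And>a b. a \<in> \<C> \<Longrightarrow> b \<in> \<C> \<Longrightarrow> a \<le> b \<or> b \<le> a"
  shows "facial p (\<lambda>x. INF q\<in>\<C>. q x)" (is "facial p ?u")
proof -
  have sub: "sublinear q" and qp: "q x \<le> p x" if "q \<in> \<C>" for q x
    using fac[OF that] by (simp_all add: facial_def le_fun_def)
  have bdd: "bdd_below ((\<lambda>q. q x) ` \<C>)" for x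
  proof (rule bdd_belowI2[of _ "- p (- x)"])
    fix q assume "q \<in> \<C>"
    then show "- p (- x) \<le> q x"
      using qp[of q "- x"] sublinear_minus[OF sub, of q x] by linarith
  qed
  have le: "?u x \<le> q x" if "q \<in> \<C>" for q x
    by (rule cINF_lower[OF bdd that])
  show ?thesis
    unfolding facial_def
  proof (intro conjI allI impI)
    show "sublinear ?u"
    proof (rule sublinearI)
      fix x y
      have *: "?u (x + y) \<le> a x + b y" if ab: "a \<in> \<C>" "b \<in> \<C>" for a b
      proof -
        obtain c where c: "c \<in> \<C>" "c \<le> a" "c \<le> b"
          using chain[OF ab] ab by blast
        have "?u (x + y) \<le> c x + c y"
          using le[OF c(1), of "x + y"] sublinear_add[OF sub[OF c(1)], of x y] by linarith
        also have "\<dots> \<le> a x + b y" using c by (auto simp: le_fun_def intro: add_mono)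
        finally show ?thesis .
      qed
      have "?u (x + y) - b y \<le> ?u x" if "b \<in> \<C>" for b
        using ne * that by (intro cINF_greatest) (auto simp: algebra_simps)
      then have "?u (x + y) - ?u x \<le> ?u y"
        using ne by (intro cINF_greatest) (auto simp: algebra_simps)
      then show "?u (x + y) \<le> ?u x + ?u y" by simp
    next
      have "?u 0 = (INF q\<in>\<C>. 0)" by (intro INF_cong) (auto simp: sub sublinear_zero)
      then show "?u 0 = 0" using ne by simp
    next
      fix c :: real and x assume c: "c > 0"
      have "?u (c *\<^sub>R x) / c \<le> ?u x"
      proof (rule cINF_greatest[OF ne])
        fix q assume q: "q \<in> \<C>"
        show "?u (c *\<^sub>R x) / c \<le> q x"
          using le[OF q, of "c *\<^sub>R x"] c by (simp add: sublinear_scale[OF sub[OF q]] field_simps)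
      qed
      then show "?u (c *\<^sub>R x) \<le> c * ?u x" using c by (simp add: field_simps)
    qed
    show "?u \<le> p"
    proof (rule le_funI)
      fix x
      obtain q where "q \<in> \<C>" using ne by blast
      then show "?u x \<le> p x" using le[of q x] qp[of q x] by linarith
    qed
    fix g h assume gh: "linear g" "linear h" "g \<le> p" "h \<le> p" "\<forall>x. g x + h x \<le> 2 * ?u x"
    have "g \<le> q \<and> h \<le> q" if "q \<in> \<C>" for q
    proof -
      have sum: "g x + h x \<le> 2 * q x" for x
        using gh(5)[rule_format, of x] le[OF that, of x] by linarith
      show ?thesis using facialD[OF fac[OF that] gh(1-4) sum] by simp
    qed
    then show "g \<le> ?u" "h \<le> ?u" using ne by (auto simp: le_fun_def intro!: cINF_greatest)
  qed
qed

text \<open>Every face contains an extreme functional. The order is reversed so that Zorn's lemma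
  yields a minimal facial functional below \<open>q\<close>.\<close>

theorem extreme_minorant_exists_facial:
  assumes "facial p q"
  shows "\<exists>f. extreme_minorant p f \<and> f \<le> q"
proof -
  let ?A = "{r. facial p r \<and> r \<le> q}"
  have "\<exists>m\<in>?A. \<forall>a\<in>?A. a \<le> m \<longrightarrow> a = m"
  proof (rule predicate_Zorn)
    show "partial_order_on ?A (relation_of (\<lambda>a b. b \<le> a) ?A)"
      by (rule partial_order_on_relation_ofI) auto
    fix \<C> assume "\<C> \<in> Chains (relation_of (\<lambda>a b. b \<le> a) ?A)"
    then have sub: "\<C> \<subseteq> ?A" and chain: "\<And>a b. a \<in> \<C> \<Longrightarrow> b \<in> \<C> \<Longrightarrow> a \<le> b \<or> b \<le> a"
      by (auto simp: Chains_def relation_of_def)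
    show "\<exists>u\<in>?A. \<forall>a\<in>\<C>. u \<le> a"
    proof (cases "\<C> = {}")
      case True
      then show ?thesis using assms by auto
    next
      case False
      let ?u = "\<lambda>x. INF q\<in>\<C>. q x"
      have u: "facial p ?u" by (rule facial_chain_Inf) (use sub chain False in auto)
      have "?u \<le> a" if "a \<in> \<C>" for a
        unfolding le_fun_def
      proof
        fix x
        have "- p (- x) \<le> r x" if "r \<in> \<C>" for r
        proof -
          have "sublinear r" "r (- x) \<le> p (- x)"
            using that sub by (auto simp: facial_def le_fun_def)
          with sublinear_minus[of r x] show ?thesis by linarith
        qed
        then show "?u x \<le> a x"
          using that by (intro cINF_lower bdd_belowI2[of _ "- p (- x)"])
      qed
      moreover have "?u \<le> q" using calculation False sub by (blast intro: order_trans)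
      ultimately show ?thesis using u by blast
    qed
  qed
  then obtain m where "facial p m" "m \<le> q" "\<And>a. facial p a \<Longrightarrow> a \<le> q \<Longrightarrow> a \<le> m \<Longrightarrow> a = m"
    by blast
  then show ?thesis using facial_minimal_linear[of p m] by (meson order_trans)
qed

theorem Mazur_Orlicz:
  assumes "sublinear p" "C \<noteq> {}" "concave_on C \<beta>" "\<And>v. v \<in> C \<Longrightarrow> \<beta> v \<le> p v"
  shows "\<exists>f. linear f \<and> (\<forall>x. f x \<le> p x) \<and> (\<forall>v\<in>C. \<beta> v \<le> f v)"
proof -
  obtain f where f: "linear f" "f \<le> envelope p C \<beta>"
    using extreme_minorant_exists_facial[OF facial_refl[OF sublinear_envelope[OF assms]]]
    by (auto simp: extreme_minorant_def)
  have "f x \<le> p x" for x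
    using le_funD[OF f(2), of x] envelope_le[OF assms, of x] by linarith
  moreover have "\<beta> v \<le> f v" if "v \<in> C" for v
    using le_funD[OF f(2), of "- v"] envelope_minus[OF assms that] linear_neg[OF f(1), of v]
    by linarith
  ultimately show ?thesis using f(1) by blast
qed

section \<open>Functionals dominated by the norm, and separation\<close>

lemma linear_le_norm_abs:
  assumes "linear f" "\<And>x. f x \<le> norm x"
  shows "\<bar>f x\<bar> \<le> norm x"
  using assms(2)[of x] assms(2)[of "- x"] by (simp add: linear_neg[OF assms(1)] abs_le_iff)

lemma linear_le_norm_blinfun:
  fixes f :: "'a::real_normed_vector \<Rightarrow> real"
  assumes "linear f" "\<And>x. f x \<le> norm x"
  obtains g :: "'a \<Rightarrow>\<^sub>L real" where "norm g \<le> 1" "blinfun_apply g = f"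
proof -
  have "bounded_linear f"
    using assms(1) linear_le_norm_abs[OF assms]
    by (auto simp: bounded_linear_def bounded_linear_axioms_def intro!: exI[of _ 1])
  then have "blinfun_apply (Blinfun f) = f" by (rule bounded_linear_Blinfun_apply)
  moreover from this have "norm (Blinfun f) \<le> 1"
    using linear_le_norm_abs[OF assms] by (intro norm_blinfun_bound) auto
  ultimately show ?thesis by (rule that[rotated])
qed

lemma blinfun_le_norm:
  fixes g :: "'a::real_normed_vector \<Rightarrow>\<^sub>L real"
  assumes "norm g \<le> 1"
  shows "blinfun_apply g x \<le> norm x" "\<bar>blinfun_apply g x\<bar> \<le> norm x"
proof -
  have "\<bar>blinfun_apply g x\<bar> \<le> norm g * norm x" using norm_blinfun[of g x] by simp
  also have "\<dots> \<le> norm x" using assms by (simp add: mult_left_le_one_le)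
  finally show "\<bar>blinfun_apply g x\<bar> \<le> norm x" .
  then show "blinfun_apply g x \<le> norm x" by simp
qed

text \<open>On the convex set of differences \<open>x - y\<close> with \<open>y\<close> in
  \<open>C\<close> the constant \<open>e\<close> is a concave minorant of the norm. The Mazur-Orlicz
  theorem therefore gives the full gap \<open>e\<close> with a functional of norm at most 1.\<close>

lemma separate_point_convex:
  fixes C :: "'a::real_normed_vector set"
  assumes "convex C" "C \<noteq> {}" "\<And>y. y \<in> C \<Longrightarrow> e \<le> dist x y"
  obtains g :: "'a \<Rightarrow>\<^sub>L real" where "norm g \<le> 1" "\<And>y. y \<in> C \<Longrightarrow> g y + e \<le> g x"
proof -
  let ?D = "(\<lambda>y. x - y) ` C"
  have "convex ?D"
    using assms(1) convex_affinity[of C x "- 1"] by simp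
  then have conc: "concave_on ?D (\<lambda>_. e)"
    by (simp add: concave_on_iff flip: distrib_right)
  have "\<exists>f. linear f \<and> (\<forall>z. f z \<le> norm z) \<and> (\<forall>v\<in>?D. e \<le> f v)"
    by (rule Mazur_Orlicz[OF sublinear_norm _ conc]) (use assms in \<open>auto simp: dist_norm\<close>)
  then obtain f where f: "linear f" "\<And>z. f z \<le> norm z" "\<And>v. v \<in> ?D \<Longrightarrow> e \<le> f v" by blast
  obtain g :: "'a \<Rightarrow>\<^sub>L real" where g: "norm g \<le> 1" "blinfun_apply g = f"
    by (rule linear_le_norm_blinfun[OF f(1,2)])
  have "g y + e \<le> g x" if "y \<in> C" for y
    using f(3)[of "x - y"] that by (simp add: g(2) linear_diff[OF f(1)])
  with g(1) show ?thesis by (rule that)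
qed

lemma extreme_norming:
  fixes y :: "'a::real_normed_vector"
  obtains f where "extreme_minorant norm f" "f y = norm y"
proof -
  have conc: "concave_on {y} (\<lambda>_. norm y)" by (simp add: concave_on_iff flip: distrib_right)
  obtain f where f: "extreme_minorant norm f" "f \<le> envelope norm {y} (\<lambda>_. norm y)"
    using extreme_minorant_exists_facial[OF facial_envelope_point[OF facial_refl[OF sublinear_norm]]]
    by blast
  have "envelope norm {y} (\<lambda>_. norm y) (- y) \<le> - norm y"
    by (rule envelope_minus[OF sublinear_norm _ conc]) auto
  then have "f (- y) \<le> - norm y" using le_funD[OF f(2)] order_trans by blast
  moreover have "f y \<le> norm y" "linear f"
    using f(1) by (auto simp: extreme_minorant_def le_fun_def)
  ultimately have "f y = norm y" by (simp add: linear_neg)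
  with f(1) show ?thesis by (rule that)
qed

subsection \<open>Extreme functionals and norming families\<close>

lemma extreme_minorant_linear: "extreme_minorant p f \<Longrightarrow> linear f"
  and extreme_minorant_le: "extreme_minorant p f \<Longrightarrow> f x \<le> p x"
  by (simp_all add: extreme_minorant_def le_fun_def)

lemma extreme_minorantD:
  assumes "extreme_minorant p f" "linear g" "linear h" "\<And>x. g x \<le> p x" "\<And>x. h x \<le> p x"
    "\<And>x. g x + h x = 2 * f x"
  shows "g = f"
  using assms by (simp add: extreme_minorant_def le_fun_def)

text \<open>An extreme functional has norm 1. If it stayed below
  \<open>(1 - \<delta>) * norm w\<close>, there would be room for both
  \<open>f + \<delta> * g\<close> and \<open>f - \<delta> * g\<close>, and \<open>f\<close> would be
  a proper midpoint; choosing \<open>g\<close> to norm \<open>y\<close> makes the two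
  different.\<close>

lemma extreme_minorant_almost_norming:
  fixes f :: "'a::real_normed_vector \<Rightarrow> real"
  assumes f: "extreme_minorant norm f" and y: "(y::'a) \<noteq> 0" and \<delta>: "\<delta> > 0"
  shows "\<exists>w. norm w = 1 \<and> f w > 1 - \<delta>"
proof (rule ccontr)
  assume "\<not> ?thesis"
  then have *: "f w \<le> 1 - \<delta>" if "norm w = 1" for w using that by (meson not_le)
  note lin = extreme_minorant_linear[OF f]
  have le: "f w + \<delta> * norm w \<le> norm w" for w
  proof (cases "w = 0")
    case False
    then have "f ((1 / norm w) *\<^sub>R w) \<le> 1 - \<delta>" by (intro *) simp
    then show ?thesis using False by (simp add: linear_scale[OF lin] field_simps)
  qed (simp add: linear_0[OF lin])
  obtain g where g: "extreme_minorant norm g" "g y = norm y" by (rule extreme_norming)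
  note glin = extreme_minorant_linear[OF g(1)]
  have abs: "\<bar>g x\<bar> \<le> norm x" for x
    by (rule linear_le_norm_abs[OF glin extreme_minorant_le[OF g(1)]])
  have "\<bar>\<delta> * g x\<bar> \<le> \<delta> * norm x" for x
    using \<delta> abs[of x] by (simp add: abs_mult)
  then have bd: "f x + \<delta> * g x \<le> norm x" "f x - \<delta> * g x \<le> norm x" for x
    using le[of x] by (smt (verit))+
  have "(\<lambda>x. f x + \<delta> * g x) = f"
  proof (rule extreme_minorantD[OF f, where h = "\<lambda>x. f x - \<delta> * g x"])
    show "linear (\<lambda>x. f x + \<delta> * g x)" "linear (\<lambda>x. f x - \<delta> * g x)"
      by (intro linearI; simp add: linear_add[OF lin] linear_add[OF glin]
          linear_scale[OF lin] linear_scale[OF glin] algebra_simps)+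
  qed (use bd in auto)
  from fun_cong[OF this, of y] show False using \<delta> y g(2) by simp
qed

text \<open>The bound by the maximum says that the pair \<open>(G, H)\<close> lies in the dual ball
  of the max-normed square, so the norms of \<open>G\<close> and \<open>H\<close> add up to at most
  1. Thus \<open>f\<close> is a convex combination of the normalized parts, and extremality makes
  both parts multiples of \<open>f\<close>.\<close>

lemma extreme_minorant_split:
  fixes f G H :: "'a::real_normed_vector \<Rightarrow> real"
  assumes f: "extreme_minorant norm f" and G: "linear G" and H: "linear H"
    and GH: "\<And>u v. G u + H v \<le> max (norm u) (norm v)" and sum: "\<And>x. G x + H x = f x"
  obtains t where "0 \<le> t" "t \<le> 1" "\<And>x. G x = t * f x" "\<And>x. H x = (1 - t) * f x"
proof -
  define t where "t = onorm G"
  have G_le: "\<bar>G u\<bar> \<le> (1 - H v) * norm u" if "norm v \<le> 1" for u v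
  proof -
    have *: "G u \<le> (1 - H v) * norm u" for u
    proof (cases "u = 0")
      case False
      then have "G ((1 / norm u) *\<^sub>R u) + H v \<le> 1"
        using GH[of "(1 / norm u) *\<^sub>R u" v] that by simp
      then show ?thesis using False by (simp add: linear_scale[OF G] field_simps)
    qed (simp add: linear_0[OF G])
    from *[of u] *[of "- u"] show ?thesis by (simp add: linear_neg[OF G] abs_le_iff)
  qed
  have H_le1: "H v \<le> 1" if "norm v \<le> 1" for v
    using GH[of 0 v] that by (simp add: linear_0[OF G])
  have t_le: "t \<le> 1 - H v" if "norm v \<le> 1" for v
    unfolding t_def using G_le[OF that] H_le1[OF that] by (intro onorm_bound) auto
  have bl: "bounded_linear G"
    using G G_le[of 0] by (auto simp: bounded_linear_def bounded_linear_axioms_def linear_0[OF H]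
        intro!: exI[of _ 1])
  have t0: "0 \<le> t" unfolding t_def by (rule onorm_pos_le[OF bl])
  have t1: "t \<le> 1" using t_le[of 0] by (simp add: linear_0[OF H])
  have Gt: "G x \<le> t * norm x" for x
    using onorm[OF bl, of x] unfolding t_def by simp
  have Ht: "H x \<le> (1 - t) * norm x" for x
  proof (cases "x = 0")
    case False
    then have "H ((1 / norm x) *\<^sub>R x) \<le> 1 - t"
      using t_le[of "(1 / norm x) *\<^sub>R x"] by simp
    then show ?thesis using False by (simp add: linear_scale[OF H] field_simps)
  qed (simp add: linear_0[OF H])
  \<comment> \<open>The two functionals are \<open>f + D\<close> and \<open>f - D\<close> with
    \<open>D = G - t * f\<close>, expanded so that no division by \<open>t\<close> or
    \<open>1 - t\<close> occurs. Their bounds are \<open>(2 - t) * t + (1 - t)^2 = 1\<close> and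
    \<open>t^2 + (1 + t) * (1 - t) = 1\<close>, and extremality forces \<open>D = 0\<close>.\<close>
  have "(\<lambda>x. (2 - t) * G x + (1 - t) * H x) = f"
  proof (rule extreme_minorantD[OF f, where h = "\<lambda>x. t * G x + (1 + t) * H x"])
    show "linear (\<lambda>x. (2 - t) * G x + (1 - t) * H x)" "linear (\<lambda>x. t * G x + (1 + t) * H x)"
      by (intro linearI; simp add: linear_add[OF G] linear_add[OF H]
          linear_scale[OF G] linear_scale[OF H] algebra_simps)+
    fix x
    have "(2 - t) * G x \<le> (2 - t) * (t * norm x)" "(1 - t) * H x \<le> (1 - t) * ((1 - t) * norm x)"
      using t1 Gt Ht by (auto intro!: mult_left_mono)
    then show "(2 - t) * G x + (1 - t) * H x \<le> norm x" by (simp add: algebra_simps)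
    have "t * G x \<le> t * (t * norm x)" "(1 + t) * H x \<le> (1 + t) * ((1 - t) * norm x)"
      using t0 Gt Ht by (auto intro!: mult_left_mono)
    then show "t * G x + (1 + t) * H x \<le> norm x" by (simp add: algebra_simps)
    show "(2 - t) * G x + (1 - t) * H x + (t * G x + (1 + t) * H x) = 2 * f x"
      by (simp add: sum[symmetric] algebra_simps)
  qed
  then have "(2 - t) * G x + (1 - t) * H x = f x" for x by (rule fun_cong)
  then have "(2 - t) * G x + (1 - t) * (f x - G x) = f x" for x
    using sum[of x] by (simp add: eq_diff_eq[symmetric] add.commute)
  then have Gx: "G x = t * f x" for x by (simp add: algebra_simps)
  moreover have "H x = (1 - t) * f x" for x
    using Gx[of x] sum[of x] by (simp add: algebra_simps)
  ultimately show ?thesis using t0 t1 that by blast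
qed

text \<open>Since \<open>f a\<close> may fail to be positive, a large multiple of an almost norming
  vector \<open>w\<close> is added first. This raises \<open>p\<close> by at most \<open>r\<close>
  and \<open>f\<close> by more than \<open>r - r * \<eta>\<close>, where \<open>r * \<eta>\<close>
  is within the available gap; \<open>f w > 1 / 2\<close> and the choice of \<open>r\<close> make
  the new value of \<open>f\<close> positive.\<close>

lemma extreme_minorant_normalize:
  fixes f p :: "'a::real_normed_vector \<Rightarrow> real"
  assumes f: "extreme_minorant norm f" and y: "(y::'a) \<noteq> 0"
    and p: "sublinear p" "\<And>x. p x \<le> norm x" and a: "p a < f a"
  obtains b where "f b = 1" "p b < 1"
proof -
  note lin = extreme_minorant_linear[OF f]
  define r where "r = 2 * (\<bar>f a\<bar> + 1)"
  have r: "r > 0" by (simp add: r_def)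
  define \<eta> where "\<eta> = min (1 / 2) ((f a - p a) / r)"
  have "\<eta> > 0" using a r by (simp add: \<eta>_def)
  then obtain w where w: "norm w = 1" "f w > 1 - \<eta>"
    using extreme_minorant_almost_norming[OF f y] by metis
  have "r * \<eta> \<le> f a - p a"
    using r by (simp add: \<eta>_def min_def field_simps)
  moreover have "r * f w > r - r * \<eta>"
    using mult_strict_left_mono[OF w(2) r] by (simp add: algebra_simps)
  moreover have "p (a + r *\<^sub>R w) \<le> p a + r"
  proof -
    have "r * p w \<le> r * 1" using p(2)[of w] w(1) r by (intro mult_left_mono) auto
    then show ?thesis
      using sublinear_add[OF p(1), of a "r *\<^sub>R w"] sublinear_scale[OF p(1), of r w] r by linarith
  qed
  ultimately have lt: "p (a + r *\<^sub>R w) < f (a + r *\<^sub>R w)"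
    by (simp add: linear_add[OF lin] linear_scale[OF lin])
  have "f w > 1 / 2"
    using w(2) min.cobounded1[of "1 / 2" "(f a - p a) / r"] unfolding \<eta>_def by linarith
  then have "r * f w > r * (1 / 2)" using r by (intro mult_strict_left_mono)
  then have "r * f w > \<bar>f a\<bar> + 1" by (simp add: r_def)
  then have "f a + r * f w > 0" by linarith
  then have pos: "f (a + r *\<^sub>R w) > 0"
    by (simp add: linear_add[OF lin] linear_scale[OF lin])
  define b where "b = (1 / f (a + r *\<^sub>R w)) *\<^sub>R (a + r *\<^sub>R w)"
  have "f b = 1" using pos by (simp add: b_def linear_scale[OF lin])
  moreover have "p b < 1"
    using pos lt sublinear_scale[OF p(1), of "1 / f (a + r *\<^sub>R w)"] by (simp add: b_def)
  ultimately show ?thesis by (rule that)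
qed

text \<open>In terms of sets: an extreme functional in the hull of the union of two compact convex
  sets lies in one of them. Hahn-Banach extends \<open>f\<close> from the diagonal of the square to
  some \<open>F\<close> below the maximum, and the two parts of \<open>F\<close> are
  \<open>t * f\<close> and \<open>(1 - t) * f\<close>. If both alternatives failed, normalized
  vectors \<open>u\<close> and \<open>v\<close> would give \<open>F (u, v) = 1\<close> although the
  bound there is less than 1.\<close>

lemma extreme_minorant_le_max:
  fixes f p q :: "'a::real_normed_vector \<Rightarrow> real"
  assumes f: "extreme_minorant norm f"
    and p: "sublinear p" "\<And>x. p x \<le> norm x" and q: "sublinear q" "\<And>x. q x \<le> norm x"
    and le: "\<And>x. f x \<le> max (p x) (q x)"
  shows "(\<forall>x. f x \<le> p x) \<or> (\<forall>x. f x \<le> q x)"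
proof (cases "\<exists>y::'a. y \<noteq> 0")
  case True
  then obtain y :: 'a where y: "y \<noteq> 0" by blast
  note lin = extreme_minorant_linear[OF f]
  let ?P = "\<lambda>z. max (p (fst z)) (q (snd z))"
  let ?D = "range (\<lambda>x::'a. (x, x))"
  have P: "sublinear ?P"
    by (intro sublinear_max) (use p q in \<open>auto simp: sublinear_def\<close>)
  have D: "convex ?D"
    by (rule convex_linear_image) (auto intro!: linearI simp: convex_UNIV)
  have "concave_on ?D (\<lambda>z. f (fst z))"
    unfolding concave_on_iff using D
    by (auto simp: linear_add[OF lin] linear_scale[OF lin])
  then have "\<exists>F. linear F \<and> (\<forall>z. F z \<le> ?P z) \<and> (\<forall>z\<in>?D. f (fst z) \<le> F z)"
    by (intro Mazur_Orlicz[OF P]) (use le in auto)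
  then obtain F where F: "linear F" "\<And>z. F z \<le> ?P z" "\<And>x. f x \<le> F (x, x)" by auto
  have diag: "F (x, x) = f x" for x
  proof -
    have "f (- x) \<le> F (- x, - x)" by (rule F(3))
    moreover have "F (- x, - x) = - F (x, x)" using linear_neg[OF F(1), of "(x, x)"] by simp
    ultimately show ?thesis using F(3)[of x] by (simp add: linear_neg[OF lin])
  qed
  have split: "F (u, 0) + F (0, v) = F (u, v)" for u v
    using linear_add[OF F(1), of "(u, 0)" "(0, v)"] by simp
  obtain t where t: "0 \<le> t" "t \<le> 1" "\<And>x. F (x, 0) = t * f x" "\<And>x. F (0, x) = (1 - t) * f x"
  proof (rule extreme_minorant_split[OF f, of "\<lambda>u. F (u, 0)" "\<lambda>v. F (0, v)"])
    show "linear (\<lambda>u. F (u, 0))" "linear (\<lambda>v. F (0, v))"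
      using linear_add[OF F(1), of "(_, 0)" "(_, 0)"] linear_add[OF F(1), of "(0, _)" "(0, _)"]
        linear_scale[OF F(1), of _ "(_, 0)"] linear_scale[OF F(1), of _ "(0, _)"]
      by (auto intro!: linearI)
    show "F (u, 0) + F (0, v) \<le> max (norm u) (norm v)" for u v
      using F(2)[of "(u, v)"] p(2)[of u] q(2)[of v] split[of u v] by auto
    show "F (x, 0) + F (0, x) = f x" for x by (simp add: split diag)
  qed (rule that)
  show ?thesis
  proof (rule ccontr)
    assume "\<not> ?thesis"
    then obtain a b where "p a < f a" "q b < f b" by (auto simp: not_le)
    obtain u where u: "f u = 1" "p u < 1"
      by (rule extreme_minorant_normalize[OF f y p \<open>p a < f a\<close>])
    obtain v where v: "f v = 1" "q v < 1"
      by (rule extreme_minorant_normalize[OF f y q \<open>q b < f b\<close>])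
    have "F (u, v) = 1" using split[of u v] by (simp add: t u v)
    with F(2)[of "(u, v)"] u v show False by auto
  qed
next
  case False
  then have "x = 0" for x :: 'a by blast
  then have "f x = 0" "p x = 0" for x
    using linear_0[OF extreme_minorant_linear[OF f]] sublinear_zero[OF p(1)] by metis+
  then show ?thesis by simp
qed

text \<open>\<open>q\<close> acts as an accumulator: the induction merges \<open>p i\<close> into it
  by \<open>max\<close> and afterwards separates the two again by the binary case.\<close>

lemma extreme_minorant_le_Max:
  fixes f :: "'a::real_normed_vector \<Rightarrow> real"
  assumes "finite I" and f: "extreme_minorant norm f"
    and q: "sublinear q" "\<And>x. q x \<le> norm x"
    and p: "\<And>i. i \<in> I \<Longrightarrow> sublinear (p i)" "\<And>i x. i \<in> I \<Longrightarrow> p i x \<le> norm x"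
    and le: "\<And>x. f x \<le> q x \<or> (\<exists>i\<in>I. f x \<le> p i x)"
  shows "(\<forall>x. f x \<le> q x) \<or> (\<exists>i\<in>I. \<forall>x. f x \<le> p i x)"
  using \<open>finite I\<close> q p le
proof (induction I arbitrary: q)
  case empty
  then show ?case by auto
next
  case (insert i I)
  have "(\<forall>x. f x \<le> max (q x) (p i x)) \<or> (\<exists>i\<in>I. \<forall>x. f x \<le> p i x)"
  proof (rule insert.IH)
    show "sublinear (\<lambda>x. max (q x) (p i x))"
      using insert.prems by (intro sublinear_max) auto
    show "max (q x) (p i x) \<le> norm x" for x using insert.prems by simp
    show "f x \<le> max (q x) (p i x) \<or> (\<exists>i\<in>I. f x \<le> p i x)" for x
      using insert.prems(5)[of x] by auto
  qed (use insert.prems in auto)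
  moreover have "(\<forall>x. f x \<le> q x) \<or> (\<forall>x. f x \<le> p i x)"
    if "\<forall>x. f x \<le> max (q x) (p i x)"
    by (rule extreme_minorant_le_max[OF f]) (use insert.prems that in auto)
  ultimately show ?case by blast
qed

text \<open>
  This is Milman's partial converse of the Krein-Milman theorem: the functionals with
  \<open>c \<le> g v\<close> for some \<open>v \<in> V\<close> form a finite union of weak-* compact convex sets, and the
  union is norming.
\<close>

lemma extreme_minorant_mem_norming:
  fixes f :: "'a::real_normed_vector \<Rightarrow> real"
  assumes f: "extreme_minorant norm f" and V: "finite V"
    and norming: "\<And>z \<epsilon>. \<epsilon> > 0 \<Longrightarrow>
      \<exists>g. linear g \<and> (\<forall>x. g x \<le> norm x) \<and> norm z - \<epsilon> \<le> g z \<and> (\<exists>v\<in>V. c \<le> g v)"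
  shows "\<exists>v\<in>V. c \<le> f v"
proof -
  \<comment> \<open>The envelope at \<open>v\<close> is meaningful only if
    \<open>c \<le> norm v\<close>. The other members of \<open>V\<close> cannot witness
    \<open>c \<le> g v\<close> for any \<open>g\<close> below the norm.\<close>
  let ?V = "{v \<in> V. c \<le> norm v}"
  let ?p = "\<lambda>v. envelope norm {v} (\<lambda>_. c)"
  have conc: "concave_on {v} (\<lambda>_. c)" for v :: 'a
    by (simp add: concave_on_iff flip: distrib_right)
  note hyps = sublinear_norm _ conc
  have sub: "sublinear (?p v)" and le: "?p v x \<le> norm x" and minus: "?p v (- v) \<le> - c"
    if "v \<in> ?V" for v x
    using that
    by (auto intro!: sublinear_envelope[OF hyps] envelope_le[OF hyps] envelope_minus[OF hyps])
  have fin: "finite ?V" using V by simp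
  \<comment> \<open>The norming hypothesis at \<open>z = 0\<close> shows that \<open>?V\<close> is
    nonempty; \<open>w\<close> provides the base functional for the finite maximum.\<close>
  obtain w where w: "w \<in> ?V"
    using norming[of 1 0] by (fastforce intro: order_trans)
  have ex: "\<exists>v\<in>?V. f z \<le> ?p v z" for z
  proof (rule ccontr)
    assume "\<not> ?thesis"
    then have lt: "?p v z < norm z" if "v \<in> ?V" for v
      using that extreme_minorant_le[OF f, of z] by force
    define \<epsilon> where "\<epsilon> = Min ((\<lambda>v. norm z - ?p v z) ` ?V)"
    have "\<epsilon> \<in> (\<lambda>v. norm z - ?p v z) ` ?V"
      unfolding \<epsilon>_def using fin w by (intro Min_in) auto
    then have "\<epsilon> > 0" using lt by auto
    then obtain g v where g: "linear g" "\<And>x. g x \<le> norm x" "norm z - \<epsilon> / 2 \<le> g z"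
      and v: "v \<in> V" "c \<le> g v" using norming[of "\<epsilon> / 2" z] by auto
    have vV: "v \<in> ?V" using v g(2)[of v] by auto
    have "g z \<le> ?p v z"
      using v vV by (intro linear_le_envelope[OF hyps]) (auto simp: g)
    moreover have "\<epsilon> \<le> norm z - ?p v z"
      unfolding \<epsilon>_def using fin vV by (intro Min_le) auto
    ultimately show False using g(3) \<open>\<epsilon> > 0\<close> by linarith
  qed
  have "(\<forall>x. f x \<le> ?p w x) \<or> (\<exists>v\<in>?V. \<forall>x. f x \<le> ?p v x)"
    by (rule extreme_minorant_le_Max[OF fin f]) (use sub le w ex in auto)
  then obtain v where v: "v \<in> ?V" "\<And>x. f x \<le> ?p v x" using w by blast
  have "f (- v) \<le> - c" using v(2)[of "- v"] minus[OF v(1)] by linarith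
  then show ?thesis using v(1) by (auto simp: linear_neg[OF extreme_minorant_linear[OF f]])
qed

subsection \<open>Stegall's variational principle\<close>

text \<open>Indices keep the objective apart from the vector on which \<open>g\<close> acts: later
  \<phi> is evaluated at a point \<open>x\<close>, and \<open>g\<close> at a multiple
  \<open>w x\<close> of it. Comparing with all competitors expresses near-optimality without a
  supremum.\<close>

definition near_maximizers ::
  "'i set \<Rightarrow> ('i \<Rightarrow> real) \<Rightarrow> ('i \<Rightarrow> 'a::real_normed_vector) \<Rightarrow> ('a \<Rightarrow>\<^sub>L real) \<Rightarrow> real \<Rightarrow> 'i set"
  where "near_maximizers I \<phi> w g \<alpha> =
    {i \<in> I. \<forall>j\<in>I. \<phi> j + g (w j) \<le> \<phi> i + g (w i) + \<alpha>}"

text \<open>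
  Only this consequence of the Radon-Nikodym property is used, and only through the real part
  of the exposing functional.
\<close>

definition strongly_exposable :: "'a::real_normed_vector set \<Rightarrow> bool"
  where "strongly_exposable K \<longleftrightarrow> (\<exists>p\<in>K. \<exists>g::'a \<Rightarrow>\<^sub>L real. norm g \<le> 1 \<and>
    (\<forall>\<epsilon>>0. \<exists>a>0. \<forall>x\<in>K. blinfun_apply g p - a < blinfun_apply g x \<longrightarrow> dist x p < \<epsilon>))"

lemma convex_neighbourhood:
  fixes C :: "'a::real_normed_vector set"
  assumes "convex C"
  shows "convex {x. \<exists>y\<in>C. dist x y \<le> e}"
proof (rule convexI)
  fix x x' and u v :: real
  assume "x \<in> {x. \<exists>y\<in>C. dist x y \<le> e}" "x' \<in> {x. \<exists>y\<in>C. dist x y \<le> e}"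
    and uv: "0 \<le> u" "0 \<le> v" "u + v = 1"
  then obtain y y' where y: "y \<in> C" "dist x y \<le> e" and y': "y' \<in> C" "dist x' y' \<le> e" by auto
  have "dist (u *\<^sub>R x + v *\<^sub>R x') (u *\<^sub>R y + v *\<^sub>R y') = norm (u *\<^sub>R (x - y) + v *\<^sub>R (x' - y'))"
    by (simp add: dist_norm algebra_simps)
  also have "\<dots> \<le> u * dist x y + v * dist x' y'"
    using norm_triangle_ineq[of "u *\<^sub>R (x - y)" "v *\<^sub>R (x' - y')"] uv by (simp add: dist_norm)
  also have "\<dots> \<le> u * e + v * e" using y y' uv by (intro add_mono mult_left_mono) auto
  also have "\<dots> = e" using uv by (simp flip: distrib_right)
  finally show "u *\<^sub>R x + v *\<^sub>R x' \<in> {x. \<exists>y\<in>C. dist x y \<le> e}"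
    using convexD[OF assms y(1) y'(1) uv] by blast
qed

text \<open>The lower Kuratowski limit. It is closed for arbitrary sets and inherits convexity, so
  it can be strongly exposed.\<close>

definition set_liminf :: "(nat \<Rightarrow> 'a::metric_space set) \<Rightarrow> 'a set"
  where "set_liminf C = {z. \<forall>\<eta>>0. \<exists>N. \<forall>n\<ge>N. \<exists>y\<in>C n. dist z y < \<eta>}"

lemma set_liminfD:
  "z \<in> set_liminf C \<Longrightarrow> \<eta> > 0 \<Longrightarrow> \<exists>N. \<forall>n\<ge>N. \<exists>y\<in>C n. dist z y < \<eta>"
  by (simp add: set_liminf_def)

lemma closed_set_liminf: "closed (set_liminf C)"
  unfolding closure_subset_eq[symmetric]
proof
  fix z assume "z \<in> closure (set_liminf C)"
  then have z: "\<forall>e>0. \<exists>y\<in>set_liminf C. dist y z < e" by (simp add: closure_approachable)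
  show "z \<in> set_liminf C"
    unfolding set_liminf_def
  proof (intro CollectI allI impI)
    fix \<eta> :: real assume "\<eta> > 0"
    then obtain x where x: "x \<in> set_liminf C" "dist x z < \<eta> / 2" using z half_gt_zero by blast
    then obtain N where N: "\<And>n. n \<ge> N \<Longrightarrow> \<exists>y\<in>C n. dist x y < \<eta> / 2"
      using set_liminfD[OF x(1)] \<open>\<eta> > 0\<close> half_gt_zero by blast
    have "\<exists>y\<in>C n. dist z y < \<eta>" if "n \<ge> N" for n
      using N[OF that] x(2) by (meson dist_triangle_half_r)
    then show "\<exists>N. \<forall>n\<ge>N. \<exists>y\<in>C n. dist z y < \<eta>" by blast
  qed
qed

lemma convex_set_liminf:
  fixes C :: "nat \<Rightarrow> 'a::real_normed_vector set"
  assumes "\<And>n. convex (C n)"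
  shows "convex (set_liminf C)"
proof (rule convexI)
  fix x x' and u v :: real
  assume x: "x \<in> set_liminf C" "x' \<in> set_liminf C" and uv: "0 \<le> u" "0 \<le> v" "u + v = 1"
  show "u *\<^sub>R x + v *\<^sub>R x' \<in> set_liminf C"
    unfolding set_liminf_def
  proof (intro CollectI allI impI)
    fix \<eta> :: real assume \<eta>: "\<eta> > 0"
    then have "\<exists>N. \<forall>n\<ge>N. \<exists>y\<in>C n. dist x y < \<eta> / 2" "\<exists>N. \<forall>n\<ge>N. \<exists>y\<in>C n. dist x' y < \<eta> / 2"
      using half_gt_zero[OF \<eta>] by (intro set_liminfD x; simp)+
    then obtain N N' where N: "\<And>n. n \<ge> N \<Longrightarrow> \<exists>y\<in>C n. dist x y < \<eta> / 2"
      "\<And>n. n \<ge> N' \<Longrightarrow> \<exists>y\<in>C n. dist x' y < \<eta> / 2" by blast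
    have "\<exists>y\<in>C n. dist (u *\<^sub>R x + v *\<^sub>R x') y < \<eta>" if "n \<ge> max N N'" for n
    proof -
      let ?S = "{x. \<exists>y\<in>C n. dist x y \<le> \<eta> / 2}"
      have "x \<in> ?S" "x' \<in> ?S" using N[of n] that by (auto intro: less_imp_le)
      then have "u *\<^sub>R x + v *\<^sub>R x' \<in> ?S"
        by (intro convexD[OF convex_neighbourhood] assms uv)
      then obtain y where "y \<in> C n" "dist (u *\<^sub>R x + v *\<^sub>R x') y \<le> \<eta> / 2" by blast
      then show ?thesis using \<eta> by force
    qed
    then show "\<exists>N. \<forall>n\<ge>N. \<exists>y\<in>C n. dist (u *\<^sub>R x + v *\<^sub>R x') y < \<eta>" by blast
  qed
qed

lemma geometric_null_sequence:
  assumes "(\<eta>::real) > 0"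
  shows "\<exists>N. \<forall>n\<ge>N. (1 / 2) ^ n < \<eta>"
proof -
  obtain N where N: "(1 / 2 :: real) ^ N < \<eta>" using real_arch_pow_inv[of \<eta> "1 / 2"] assms by auto
  have "(1 / 2 :: real) ^ n < \<eta>" if "n \<ge> N" for n
    by (rule le_less_trans[OF power_decreasing[OF that] N]) auto
  then show ?thesis by blast
qed

text \<open>A chain of points through the successive sets, starting at \<open>x\<close>, is Cauchy
  by the geometric step bound, and its limit lies in the lower limit. The steps add up to
  \<open>2 * c * (1 / 2) ^ n\<close>.\<close>

lemma set_liminf_approx:
  fixes C :: "nat \<Rightarrow> 'a::complete_space set"
  assumes step: "\<And>n x. x \<in> C n \<Longrightarrow> \<exists>y\<in>C (Suc n). dist x y \<le> c * (1 / 2) ^ n"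
    and c: "c > 0" and x: "x \<in> C n"
  shows "\<exists>z\<in>set_liminf C. dist x z \<le> 2 * c * (1 / 2) ^ n"
proof -
  have "\<exists>y. \<forall>j. (y j \<in> C (n + j) \<and> (j = 0 \<longrightarrow> y j = x)) \<and>
      dist (y j) (y (Suc j)) \<le> c * (1 / 2) ^ (n + j)"
    by (rule dependent_nat_choice) (use x step in force)+
  then obtain y where y: "\<And>j. y j \<in> C (n + j)" "y 0 = x"
    and y_step: "\<And>j. dist (y j) (y (Suc j)) \<le> c * (1 / 2) ^ (n + j)" by metis
  \<comment> \<open>The factor \<open>1 - (1 / 2) ^ m\<close> is the exact partial geometric sum;
    the weaker bound without it would not carry the induction.\<close>
  have y_dist: "dist (y j) (y (j + m)) \<le> 2 * c * (1 / 2) ^ (n + j) * (1 - (1 / 2) ^ m)" for j m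
  proof (induction m)
    case (Suc m)
    have "dist (y j) (y (j + Suc m)) \<le> dist (y j) (y (j + m)) + c * (1 / 2) ^ (n + (j + m))"
      using dist_triangle[of "y j" "y (j + Suc m)" "y (j + m)"] y_step[of "j + m"] by simp
    with Suc show ?case by (simp add: power_add algebra_simps)
  qed simp
  have y_le: "dist (y j) (y m) \<le> 2 * c * (1 / 2) ^ (n + j)" if "j \<le> m" for j m
  proof -
    have "dist (y j) (y m) \<le> 2 * c * (1 / 2) ^ (n + j) * (1 - (1 / 2) ^ (m - j))"
      using y_dist[of j "m - j"] that by simp
    also have "\<dots> \<le> 2 * c * (1 / 2) ^ (n + j) * 1"
      using c by (intro mult_left_mono) auto
    finally show ?thesis by simp
  qed
  have small: "\<exists>N. \<forall>j. n + j \<ge> N \<longrightarrow> 2 * c * (1 / 2) ^ (n + j) < \<eta>" if \<eta>: "\<eta> > 0" for \<eta>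
  proof -
    have "\<eta> / (2 * c) > 0" using \<eta> c by simp
    then obtain N where "\<And>m. m \<ge> N \<Longrightarrow> (1 / 2) ^ m < \<eta> / (2 * c)"
      using geometric_null_sequence by blast
    then show ?thesis using c by (intro exI[of _ N]) (simp add: field_simps)
  qed
  have "Cauchy y"
  proof (rule CauchyI')
    fix \<eta> :: real assume "\<eta> > 0"
    with small obtain N where N: "\<And>j. n + j \<ge> N \<Longrightarrow> 2 * c * (1 / 2) ^ (n + j) < \<eta>" by blast
    have "dist (y j) (y m) < \<eta>" if "j \<ge> N" "j < m" for j m
      using le_less_trans[OF y_le[of j m] N[of j]] that by simp
    then show "\<exists>M. \<forall>m\<ge>M. \<forall>k>m. dist (y m) (y k) < \<eta>" by blast
  qed
  then obtain z where z: "y \<longlonglongrightarrow> z" using Cauchy_convergent by (auto simp: convergent_def)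
  have y_z: "dist (y j) z \<le> 2 * c * (1 / 2) ^ (n + j)" for j
  proof (rule tendsto_upperbound)
    show "(\<lambda>m. dist (y j) (y m)) \<longlonglongrightarrow> dist (y j) z" by (intro tendsto_intros z)
    show "\<forall>\<^sub>F m in sequentially. dist (y j) (y m) \<le> 2 * c * (1 / 2) ^ (n + j)"
      using eventually_ge_at_top[of j] by eventually_elim (rule y_le)
  qed simp
  have "z \<in> set_liminf C"
    unfolding set_liminf_def
  proof (intro CollectI allI impI)
    fix \<eta> :: real assume "\<eta> > 0"
    with small obtain N where N: "\<And>j. n + j \<ge> N \<Longrightarrow> 2 * c * (1 / 2) ^ (n + j) < \<eta>" by blast
    have "\<exists>y\<in>C m. dist z y < \<eta>" if "m \<ge> max n N" for m
      using N[of "m - n"] y_z[of "m - n"] y(1)[of "m - n"] that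
      by (intro bexI[of _ "y (m - n)"]) (auto simp: dist_commute)
    then show "\<exists>N. \<forall>m\<ge>N. \<exists>y\<in>C m. dist z y < \<eta>" by blast
  qed
  then show ?thesis using y_z[of 0] y(2) by auto
qed

section \<open>Near-maximizers under linear perturbations\<close>

context
  fixes I :: "'i set" and \<phi> :: "'i \<Rightarrow> real" and w :: "'i \<Rightarrow> 'a::banach" and B R :: real
  assumes ne: "I \<noteq> {}" and \<phi>_le: "\<And>i. i \<in> I \<Longrightarrow> \<phi> i \<le> B"
    and w_le: "\<And>i. i \<in> I \<Longrightarrow> norm (w i) \<le> R"
begin

lemma near_maximizers_nonempty:
  assumes "\<alpha> > 0"
  shows "near_maximizers I \<phi> w g \<alpha> \<noteq> {}"
proof -
  let ?F = "\<lambda>i. \<phi> i + g (w i)"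
  have "?F i \<le> B + norm g * R" if "i \<in> I" for i
  proof -
    have "g (w i) \<le> norm g * norm (w i)" using norm_blinfun[of g "w i"] by simp
    also have "\<dots> \<le> norm g * R" using w_le[OF that] by (intro mult_left_mono) auto
    finally show ?thesis using \<phi>_le[OF that] by simp
  qed
  then have bdd: "bdd_above (?F ` I)" by (rule bdd_aboveI2)
  obtain i where i: "i \<in> I" "Sup (?F ` I) - \<alpha> < ?F i"
    using less_cSupD[of "?F ` I" "Sup (?F ` I) - \<alpha>"] ne assms by auto
  have "?F j \<le> ?F i + \<alpha>" if "j \<in> I" for j
    using cSUP_upper[OF that bdd] i(2) by linarith
  then have "i \<in> near_maximizers I \<phi> w g \<alpha>" using i(1) by (auto simp: near_maximizers_def)
  then show ?thesis by blast
qed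

text \<open>Adding the two near-optimality inequalities cancels \<phi> and \<open>g\<close>. This is
  approximate monotonicity of the subdifferential of the convex function that sends \<open>g\<close>
  to the supremum of \<open>\<phi> i + g (w i)\<close>.\<close>

lemma near_maximizers_monotone:
  assumes "i \<in> near_maximizers I \<phi> w g \<alpha>" "j \<in> near_maximizers I \<phi> w (g + t *\<^sub>R h) \<alpha>'" "t > 0"
  shows "h (w i) \<le> h (w j) + (\<alpha> + \<alpha>') / t"
proof -
  have "\<phi> j + g (w j) \<le> \<phi> i + g (w i) + \<alpha>"
    and "\<phi> i + (g (w i) + t * h (w i)) \<le> \<phi> j + (g (w j) + t * h (w j)) + \<alpha>'"
    using assms(1,2) by (auto simp: near_maximizers_def plus_blinfun.rep_eq scaleR_blinfun.rep_eq)
  then have "t * h (w i) \<le> t * h (w j) + (\<alpha> + \<alpha>')" by linarith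
  then show ?thesis using assms(3) by (simp add: field_simps)
qed

text \<open>The values \<open>w i\<close> lie within \<open>2 * R\<close> of each other, so changing
  \<open>g\<close> slightly only relaxes the tolerance. This makes the sets in the Baire argument
  open.\<close>

lemma near_maximizers_perturb:
  assumes "norm (g' - g) * (2 * R) \<le> \<alpha>"
  shows "near_maximizers I \<phi> w g' \<alpha> \<subseteq> near_maximizers I \<phi> w g (2 * \<alpha>)"
proof
  fix i assume i: "i \<in> near_maximizers I \<phi> w g' \<alpha>"
  then have iI: "i \<in> I" by (simp add: near_maximizers_def)
  have "\<phi> j + g (w j) \<le> \<phi> i + g (w i) + 2 * \<alpha>" if j: "j \<in> I" for j
  proof -
    have "(g' - g) (w i - w j) \<le> norm (g' - g) * norm (w i - w j)"
      using norm_blinfun[of "g' - g" "w i - w j"] by simp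
    also have "\<dots> \<le> norm (g' - g) * (2 * R)"
      using norm_triangle_ineq4[of "w i" "w j"] w_le[OF iI] w_le[OF j]
      by (intro mult_left_mono) auto
    finally have "(g' - g) (w i - w j) \<le> \<alpha>" using assms by simp
    then have "g' (w i) - g' (w j) - (g (w i) - g (w j)) \<le> \<alpha>"
      by (simp add: minus_blinfun.rep_eq blinfun.diff_right)
    moreover have "\<phi> j + g' (w j) \<le> \<phi> i + g' (w i) + \<alpha>"
      using i j by (auto simp: near_maximizers_def)
    ultimately show ?thesis by linarith
  qed
  with iI show "i \<in> near_maximizers I \<phi> w g (2 * \<alpha>)" by (simp add: near_maximizers_def)
qed

context
  assumes rn: "\<And>K :: 'a set. K \<noteq> {} \<Longrightarrow> bounded K \<Longrightarrow> closed K \<Longrightarrow> convex K \<Longrightarrow> strongly_exposable K"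
begin

text \<open>
  The radii of the balls of functionals grow so fast compared with the decay of the
  tolerances that, by monotonicity, each set of near-maximizers is almost contained in the
  convex hull of the next one. Strongly exposing the limit set and moving once more in the
  exposing direction forces the near-maximizers into a small slice.
\<close>

lemma near_maximizers_small_perturbation:
  assumes \<delta>: "\<delta> > 0" and \<epsilon>: "\<epsilon> > 0"
  shows "\<exists>g. norm (g - g0) < \<delta> \<and> (\<exists>\<alpha>>0. \<forall>i\<in>near_maximizers I \<phi> w g \<alpha>.
    \<forall>j\<in>near_maximizers I \<phi> w g \<alpha>. dist (w i) (w j) \<le> \<epsilon>)"
proof -
  note near = near_maximizers_nonempty
  define r where "r n = \<delta> * (1 - (1 / 2) ^ n)" for n :: nat
  define t where "t n = \<delta> * (1 / 2) ^ n / 2" for n :: nat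
  define \<alpha> where "\<alpha> n = \<delta> * ((1 / 2) ^ n * (1 / 2) ^ n) / 4" for n :: nat
  define A where "A n = {w i |i g. norm (g - g0) \<le> r n \<and> i \<in> near_maximizers I \<phi> w g (\<alpha> n)}" for n
  define C where "C n = convex hull (A n)" for n
  have t: "t n > 0" and \<alpha>: "\<alpha> n > 0" and r: "r n + t n = r (Suc n)" for n
    using \<delta> by (auto simp: r_def t_def \<alpha>_def algebra_simps)
  have r_lt: "r n < \<delta>" and r0: "r n \<ge> 0" for n
    using \<delta> by (auto simp: r_def algebra_simps mult_le_one power_le_one)
  have ratio: "(\<alpha> n + \<alpha> (Suc n)) / t n \<le> (1 / 2) ^ n" for n
  proof -
    have "\<alpha> n + \<alpha> (Suc n) \<le> (1 / 2) ^ n * t n"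
      using \<delta> by (simp add: \<alpha>_def t_def field_simps)
    then show ?thesis using t[of n] by (simp add: field_simps)
  qed
  have AC: "A n \<subseteq> C n" for n unfolding C_def by (rule hull_subset)
  have A_le: "norm x \<le> R" if "x \<in> A n" for x n
    using that w_le by (auto simp: A_def near_maximizers_def)
  have C_le: "norm x \<le> R" if "x \<in> C n" for x n
  proof -
    have "C n \<subseteq> cball 0 R"
      unfolding C_def by (rule hull_minimal) (auto simp: A_le convex_cball)
    with that show ?thesis by auto
  qed
  have move: "norm (g + t n *\<^sub>R h - g0) \<le> r (Suc n)"
    if "norm (g - g0) \<le> r n" "norm h \<le> 1" for g h n
  proof -
    have "norm (g + t n *\<^sub>R h - g0) \<le> norm (g - g0) + norm (t n *\<^sub>R h)"
      using norm_triangle_ineq[of "g - g0" "t n *\<^sub>R h"] by (simp add: algebra_simps)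
    also have "\<dots> \<le> r n + t n * 1"
      using that t[of n] by (intro add_mono) (auto intro: mult_left_mono)
    finally show ?thesis using r by simp
  qed
  \<comment> \<open>If \<open>x\<close> were farther away, a separating \<open>h\<close> would have
    gap \<open>2 * (1 / 2) ^ n\<close> over \<open>C (Suc n)\<close>. Moving \<open>g\<close> by
    \<open>t n\<close> in the direction \<open>h\<close> gives a near-maximizer of the next stage,
    for which monotonicity allows a gap of at most \<open>(1 / 2) ^ n\<close>.\<close>
  have A_step: "\<exists>y\<in>C (Suc n). dist x y \<le> 2 * (1 / 2) ^ n" if x: "x \<in> A n" for x n
  proof (rule ccontr)
    assume "\<not> ?thesis"
    then have far: "2 * (1 / 2) ^ n \<le> dist x y" if "y \<in> C (Suc n)" for y using that by force
    have ball: "norm (g0 - g0) \<le> r (Suc n)" using r0 by simp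
    then have "C (Suc n) \<noteq> {}"
      using near[OF \<alpha>, of g0 "Suc n"] AC[of "Suc n"] unfolding A_def by blast
    moreover have "convex (C (Suc n))" by (simp add: C_def)
    ultimately obtain h :: "'a \<Rightarrow>\<^sub>L real" where h: "norm h \<le> 1"
      "\<And>y. y \<in> C (Suc n) \<Longrightarrow> h y + 2 * (1 / 2) ^ n \<le> h x"
      using separate_point_convex far by metis
    from x obtain i g where i: "x = w i" "norm (g - g0) \<le> r n"
      "i \<in> near_maximizers I \<phi> w g (\<alpha> n)" by (auto simp: A_def)
    obtain j where j: "j \<in> near_maximizers I \<phi> w (g + t n *\<^sub>R h) (\<alpha> (Suc n))"
      using near[OF \<alpha>] by blast
    have "w j \<in> A (Suc n)" using j move[OF i(2) h(1)] unfolding A_def by blast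
    then have "h (w j) + 2 * (1 / 2) ^ n \<le> h x" using AC by (intro h) blast
    moreover have "h (w i) \<le> h (w j) + (\<alpha> n + \<alpha> (Suc n)) / t n"
      by (rule near_maximizers_monotone[OF i(3) j t])
    moreover have "(1 / 2 :: real) ^ n > 0" by simp
    ultimately show False using ratio[of n] unfolding i(1) by linarith
  qed
  have C_step: "\<exists>y\<in>C (Suc n). dist x y \<le> 2 * (1 / 2) ^ n" if "x \<in> C n" for x n
  proof -
    have "C n \<subseteq> {x. \<exists>y\<in>C (Suc n). dist x y \<le> 2 * (1 / 2) ^ n}"
      unfolding C_def[of n]
      by (rule hull_minimal) (use A_step in \<open>auto intro: convex_neighbourhood simp: C_def\<close>)
    with that show ?thesis by blast
  qed
  let ?K = "set_liminf C"
  have approx: "\<exists>z\<in>?K. dist x z \<le> 4 * (1 / 2) ^ n" if "x \<in> C n" for x n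
    using set_liminf_approx[of C 2 x n] C_step that by auto
  have "?K \<noteq> {}"
  proof -
    have "A 0 \<noteq> {}" using near[OF \<alpha>, of g0 0] r0[of 0] unfolding A_def by auto
    then show ?thesis using approx[of _ 0] AC[of 0] by blast
  qed
  moreover have "bounded ?K"
  proof -
    have "norm z \<le> R + 1" if z: "z \<in> ?K" for z
    proof -
      obtain n y where "y \<in> C n" "dist z y < 1"
        using set_liminfD[OF z zero_less_one] by blast
      then show ?thesis using C_le[of y n] norm_triangle_ineq2[of z y] by (simp add: dist_norm)
    qed
    then show ?thesis by (auto simp: bounded_iff)
  qed
  moreover have "closed ?K" by (rule closed_set_liminf)
  moreover have "convex ?K" by (rule convex_set_liminf) (simp add: C_def)
  ultimately have "strongly_exposable ?K" by (rule rn)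
  then obtain p and h :: "'a \<Rightarrow>\<^sub>L real" where p: "p \<in> ?K" and h: "norm h \<le> 1"
    and "\<forall>\<epsilon>>0. \<exists>a>0. \<forall>x\<in>?K. h p - a < h x \<longrightarrow> dist x p < \<epsilon>"
    unfolding strongly_exposable_def by blast
  then obtain a where a: "a > 0" "\<And>x. x \<in> ?K \<Longrightarrow> h p - a < h x \<Longrightarrow> dist x p < \<epsilon> / 4"
    using \<epsilon> by (metis divide_pos_pos zero_less_numeral)
  have h_dist: "h x \<le> h y + dist x y" for x y
    using blinfun_le_norm(1)[OF h, of "x - y"] by (simp add: blinfun.diff_right dist_norm)
  obtain N where N: "\<And>n. n \<ge> N \<Longrightarrow> (1 / 2) ^ n < min (a / 8) (\<epsilon> / 16)"
    using geometric_null_sequence[of "min (a / 8) (\<epsilon> / 16)"] a(1) \<epsilon> by auto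
  obtain N' where N': "\<And>n. n \<ge> N' \<Longrightarrow> \<exists>y\<in>C n. dist p y < a / 4"
    using set_liminfD[OF p, of "a / 4"] a(1) by auto
  define n where "n = max N N'"
  have small: "(1 / 2) ^ n < a / 8" "(1 / 2) ^ n < \<epsilon> / 16"
    using N[of n] by (auto simp: n_def)
  obtain y where y: "y \<in> C n" "dist p y < a / 4" using N'[of n] by (auto simp: n_def)
  \<comment> \<open>If \<open>h\<close> were below \<open>h y\<close> on all of \<open>A n\<close>,
    it would be so on the convex hull, which contains \<open>y\<close>.\<close>
  obtain x where x: "x \<in> A n" "h y \<le> h x"
  proof (rule ccontr)
    assume "\<not> thesis"
    then have "A n \<subseteq> {x. h x < h y}" using that by force
    moreover have "convex {x. h x < h y}"
      using convex_linear_vimage[of h "{..<h y}"]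
      by (simp add: vimage_def blinfun.bounded_linear_right bounded_linear.linear)
    ultimately have "C n \<subseteq> {x. h x < h y}" unfolding C_def by (rule hull_minimal)
    with y(1) show False by auto
  qed
  from x obtain i g where i: "x = w i" "norm (g - g0) \<le> r n"
    "i \<in> near_maximizers I \<phi> w g (\<alpha> n)" by (auto simp: A_def)
  \<comment> \<open>For near-maximizers of \<open>g'\<close> the loss against \<open>h p\<close> is
    at most \<open>a / 4\<close> from \<open>p\<close> to \<open>y\<close>, \<open>a / 8\<close> by
    monotonicity, and \<open>a / 4\<close> from \<open>w j\<close> to the limit set. The total is
    below \<open>a\<close>, so the nearby point \<open>z\<close> lies in the exposed slice.\<close>
  define g' where "g' = g + t n *\<^sub>R h"
  have g': "norm (g' - g0) \<le> r (Suc n)" using move[OF i(2) h] by (simp add: g'_def)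
  have near_p: "dist (w j) p \<le> \<epsilon> / 2" if j: "j \<in> near_maximizers I \<phi> w g' (\<alpha> (Suc n))" for j
  proof -
    have "w j \<in> C (Suc n)" using j g' AC[of "Suc n"] by (auto simp: A_def)
    then obtain z where z: "z \<in> ?K" "dist (w j) z \<le> 4 * (1 / 2) ^ Suc n" using approx by blast
    have z2: "dist (w j) z \<le> 2 * (1 / 2) ^ n" using z(2) by simp
    have "h (w i) \<le> h (w j) + (\<alpha> n + \<alpha> (Suc n)) / t n"
      using near_maximizers_monotone[OF i(3) _ t] j by (simp add: g'_def)
    then have "h p - a < h z"
      using h_dist[of p y] h_dist[of "w j" z] y(2) x(2)[unfolded i(1)] z2 small(1) ratio[of n] a(1)
      by linarith
    then have "dist z p < \<epsilon> / 4" by (rule a(2)[OF z(1)])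
    then show ?thesis using dist_triangle[of "w j" p z] z2 small(2) \<epsilon> by linarith
  qed
  have "dist (w i) (w j) \<le> \<epsilon>"
    if "i \<in> near_maximizers I \<phi> w g' (\<alpha> (Suc n))" "j \<in> near_maximizers I \<phi> w g' (\<alpha> (Suc n))" for i j
    using near_p[OF that(1)] near_p[OF that(2)] dist_triangle2[of "w i" "w j" p] by linarith
  moreover have "norm (g' - g0) < \<delta>" using g' r_lt by (rule le_less_trans)
  ultimately show ?thesis using \<alpha> by blast
qed

text \<open>Functionals that have, for some tolerance, near-maximizers of diameter at most
  \<open>1 / real (Suc n)\<close> form an open dense set. Baire's theorem in the dual provides one
  that works for all \<open>n\<close>.\<close>

theorem Stegall_variational_principle:
  assumes \<delta>: "\<delta> > 0"
  shows "\<exists>g. norm (g - g0) < \<delta> \<and> (\<forall>\<epsilon>>0. \<exists>\<alpha>>0. \<forall>i\<in>near_maximizers I \<phi> w g \<alpha>.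
    \<forall>j\<in>near_maximizers I \<phi> w g \<alpha>. dist (w i) (w j) \<le> \<epsilon>)"
proof -
  define small where "small \<epsilon> \<alpha> g \<longleftrightarrow> (\<forall>i\<in>near_maximizers I \<phi> w g \<alpha>.
    \<forall>j\<in>near_maximizers I \<phi> w g \<alpha>. dist (w i) (w j) \<le> \<epsilon>)" for \<epsilon> \<alpha> g
  define U where "U n = {g. \<exists>\<alpha>>0. small (1 / real (Suc n)) \<alpha> g}" for n
  have R: "R \<ge> 0" using ne w_le norm_ge_zero order_trans by blast
  have U_open: "open (U n)" for n
    unfolding open_dist
  proof
    fix g assume "g \<in> U n"
    then obtain \<alpha> where \<alpha>: "\<alpha> > 0" "small (1 / real (Suc n)) \<alpha> g" by (auto simp: U_def)
    define e where "e = \<alpha> / (4 * (R + 1))"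
    have e: "e > 0" using \<alpha> R by (simp add: e_def)
    have "g' \<in> U n" if "dist g' g < e" for g'
    proof -
      have "norm (g' - g) * (2 * R) \<le> e * (2 * (R + 1))"
        using that R e by (intro mult_mono) (auto simp: dist_norm)
      also have "\<dots> = \<alpha> / 2" using R by (simp add: e_def field_simps)
      finally have "near_maximizers I \<phi> w g' (\<alpha> / 2) \<subseteq> near_maximizers I \<phi> w g \<alpha>"
        using near_maximizers_perturb[of g' g "\<alpha> / 2"] by simp
      then have "small (1 / real (Suc n)) (\<alpha> / 2) g'" using \<alpha>(2) unfolding small_def by blast
      then show ?thesis using \<alpha>(1) unfolding U_def by (intro CollectI exI[of _ "\<alpha> / 2"]) simp
    qed
    then show "\<exists>e>0. \<forall>g'. dist g' g < e \<longrightarrow> g' \<in> U n" using e by blast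
  qed
  have "g \<in> closure (U n)" for g n
    unfolding closure_approachable
  proof (intro allI impI)
    fix e :: real assume "e > 0"
    then obtain g' \<alpha> where "norm (g' - g) < e" "\<alpha> > 0" "small (1 / real (Suc n)) \<alpha> g'"
      using near_maximizers_small_perturbation[of e "1 / real (Suc n)" g]
      unfolding small_def by auto
    then show "\<exists>y\<in>U n. dist y g < e" by (auto simp: U_def dist_norm)
  qed
  then have U_dense: "closure (U n) = UNIV" for n by blast
  have "Met_TC.mtopology closure_of \<Inter> (range U) = UNIV"
    by (rule Met_TC.metric_Baire_category)
      (auto simp: U_open U_dense mcomplete_iff_complete complete_UNIV)
  then have "g0 \<in> closure (\<Inter> (range U))" by simp
  then obtain g where g: "g \<in> \<Inter> (range U)" "dist g g0 < \<delta>"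
    using \<delta> unfolding closure_approachable by blast
  have "\<exists>\<alpha>>0. small \<epsilon> \<alpha> g" if \<epsilon>: "\<epsilon> > 0" for \<epsilon>
  proof -
    obtain n where n: "1 / real (Suc n) < \<epsilon>" using nat_approx_posE[OF \<epsilon>] by blast
    obtain \<alpha> where \<alpha>: "\<alpha> > 0" "small (1 / real (Suc n)) \<alpha> g" using g(1) by (auto simp: U_def)
    then have "small \<epsilon> \<alpha> g" using n unfolding small_def by fastforce
    with \<alpha>(1) show ?thesis by blast
  qed
  then show ?thesis using g(2) unfolding small_def by (auto simp: dist_norm)
qed

end

end

subsection \<open>Scalars and duality\<close>

lemma to_complex_zero [simp]: "to_complex (0 :: 'k::real_or_complex) = 0"
  using norm_to_complex[of "0 :: 'k"] by simp

lemma to_complex_minus: "to_complex (- a) = - to_complex (a :: 'k::real_or_complex)"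
  using to_complex_add[of a "- a"] by (simp add: add_eq_0_iff)

lemma to_complex_diff: "to_complex (a - b) = to_complex a - to_complex (b :: 'k::real_or_complex)"
  using to_complex_add[of a "- b"] by (simp add: to_complex_minus)

lemma to_complex_eq_iff: "to_complex a = to_complex b \<longleftrightarrow> a = (b :: 'k::real_or_complex)"
  using norm_to_complex[of "a - b"] by (auto simp: to_complex_diff)

lemma to_complex_dist: "dist (to_complex a) (to_complex b) = dist a (b :: 'k::real_or_complex)"
  by (simp add: dist_norm norm_to_complex flip: to_complex_diff)

definition real_part :: "'k::real_or_complex \<Rightarrow> real"
  where "real_part a = Re (to_complex a)"

lemma real_part_add: "real_part (a + b) = real_part a + real_part b"
  and real_part_diff: "real_part (a - b) = real_part a - real_part b"
  and real_part_scaleR: "real_part (r *\<^sub>R a) = r * real_part a"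
  and real_part_of_real [simp]: "real_part (of_real r) = r"
  by (simp_all add: real_part_def to_complex_add to_complex_diff to_complex_scaleR
      to_complex_of_real)

lemma real_part_le_norm: "real_part a \<le> norm a"
  and real_part_abs_le_norm: "\<bar>real_part a\<bar> \<le> norm a"
  using complex_Re_le_cmod[of "to_complex a"] abs_Re_le_cmod[of "to_complex a"]
  by (simp_all add: real_part_def norm_to_complex)

lemma real_part_one [simp]: "real_part 1 = 1"
  using real_part_of_real[of 1] by simp

lemma unimodular_rotation: "\<exists>\<beta>. norm \<beta> = 1 \<and> \<beta> * a = of_real (norm (a :: 'k::real_or_complex))"
proof (cases "a = 0")
  case False
  then show ?thesis by (intro exI[of _ "of_real (norm a) / a"]) (simp add: norm_divide)
qed (auto intro: exI[of _ 1])

lemma eq_one_if_real_part_ge: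
  assumes "norm a \<le> 1" "real_part a \<ge> 1"
  shows "a = (1 :: 'k::real_or_complex)"
proof -
  have "cmod (to_complex a) \<le> 1" "Re (to_complex a) \<ge> 1"
    using assms by (simp_all add: norm_to_complex real_part_def)
  then have "Re (to_complex a) = 1" "cmod (to_complex a) = 1"
    using complex_Re_le_cmod[of "to_complex a"] by linarith+
  then have "to_complex a = 1" using cmod_eq_Re complex_eqI
    by (metis cmod_power2 add_cancel_right_right one_complex.simps one_power2 power2_eq_iff_nonneg
        power_zero_numeral zero_eq_power2)
  then show ?thesis using to_complex_eq_iff[of a 1] by simp
qed

text \<open>Compactness is pulled back along the isometry \<open>to_complex\<close>, whose range is
  closed, being the reals or the whole plane. It is what allows scalar rotations to converge along a
  subsequence.\<close>

lemma compact_scalar_sphere: "compact (sphere 0 1 :: 'k::real_or_complex set)"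
proof -
  let ?f = "to_complex :: 'k \<Rightarrow> complex"
  let ?g = "inv ?f"
  have inj: "inj ?f" by (rule injI) (simp add: to_complex_eq_iff)
  have g: "?g (?f a) = a" for a by (rule inv_f_f[OF inj])
  have eq: "?f ` sphere 0 1 = range ?f \<inter> sphere 0 1"
    by (auto simp: norm_to_complex)
  have "closed (range ?f)"
    using range_to_complex[where 'k = 'k] closed_complex_Reals by auto
  then have "compact (?f ` sphere 0 1)"
    unfolding eq by (intro closed_Int_compact) auto
  moreover have "continuous_on (?f ` sphere 0 1) ?g"
  proof (rule lipschitz_on_continuous_on[of 1], unfold lipschitz_on_def, intro conjI ballI)
    fix x y assume "x \<in> ?f ` sphere 0 1" "y \<in> ?f ` sphere 0 1"
    then show "dist (?g x) (?g y) \<le> 1 * dist x y"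
      by (auto simp: g to_complex_dist)
  qed simp
  ultimately have "compact (?g ` ?f ` sphere 0 1)" by (rule compact_continuous_image[rotated])
  then show ?thesis by (simp add: image_image g)
qed

section \<open>Scalar-linear functionals and their real parts\<close>

lemma linear_over_iff:
  assumes "normed_space_over scaleX" "normed_space_over scaleY"
  shows "Vector_Spaces.linear scaleX scaleY f \<longleftrightarrow>
    (\<forall>x y. f (x + y) = f x + f y) \<and> (\<forall>c x. f (scaleX c x) = scaleY c (f x))"
  using assms by (simp add: Vector_Spaces.linear_iff normed_space_over_def)

context normed_space_over
begin

lemma linear_scalars_iff:
  "Vector_Spaces.linear scaleX (*) f \<longleftrightarrow>
    (\<forall>x y. f (x + y) = f x + f y) \<and> (\<forall>c x. f (scaleX c x) = c * f x)"
  by (rule linear_over_iff) (fact normed_space_over_axioms normed_space_over_scalars)+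

lemma dual_ball_scale:
  "xs \<in> dual_ball scaleX \<Longrightarrow> blinfun_apply xs (scaleX c x) = c * blinfun_apply xs x"
  by (simp add: dual_ball_def linear_scalars_iff)

lemma dual_ball_norm_le:
  assumes "xs \<in> dual_ball scaleX"
  shows "norm (blinfun_apply xs x) \<le> norm x"
proof -
  have "norm (blinfun_apply xs x) \<le> norm xs * norm x" by (rule norm_blinfun)
  also have "\<dots> \<le> norm x" using assms by (simp add: dual_ball_def mult_left_le_one_le)
  finally show ?thesis .
qed

lemma dual_ball_rotate:
  assumes "xs \<in> dual_ball scaleX" "norm \<beta> = 1"
  shows "\<exists>ys\<in>dual_ball scaleX. \<forall>x. blinfun_apply ys x = \<beta> * blinfun_apply xs x"
proof -
  define f where "f x = \<beta> * blinfun_apply xs x" for x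
  have "bounded_linear f"
    unfolding f_def
    by (intro bounded_linear_mult_right[THEN bounded_linear_compose] blinfun.bounded_linear_right)
  then have f: "blinfun_apply (Blinfun f) = f" by (rule bounded_linear_Blinfun_apply)
  have "norm (f x) \<le> norm x" for x
    using dual_ball_norm_le[OF assms(1)] assms(2) by (simp add: f_def norm_mult)
  then have "norm (Blinfun f) \<le> 1" by (intro norm_blinfun_bound) (auto simp: f)
  then have "Blinfun f \<in> dual_ball scaleX"
    by (simp add: dual_ball_def linear_scalars_iff f)
      (simp add: f_def dual_ball_scale[OF assms(1)] blinfun.add_right algebra_simps)
  then show ?thesis by (intro bexI[of _ "Blinfun f"]) (auto simp: f, simp add: f_def)
qed

text \<open>In the complex case this is the classical formula
  \<open>g x - \<i>' * g (\<i>' x)\<close>; in the real case \<open>g\<close> itself is already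
  scalar-linear. The norm does not grow, because a rotation of the argument makes the value equal to
  its real part.\<close>

lemma complexify:
  fixes g :: "'a \<Rightarrow>\<^sub>L real"
  obtains xs :: "'a \<Rightarrow>\<^sub>L 'k" where "Vector_Spaces.linear scaleX (*) (blinfun_apply xs)"
    "\<And>x. real_part (blinfun_apply xs x) = g x" "norm xs \<le> norm g"
proof -
  have "\<exists>f. (\<forall>x y. f (x + y) = f x + f y) \<and> (\<forall>c x. f (scaleX c x) = c * f x) \<and>
      (\<forall>x. real_part (f x :: 'k) = g x)"
  proof (cases "range (to_complex :: 'k \<Rightarrow> complex) = UNIV")
    case True
    then obtain \<i>' :: 'k where i: "to_complex \<i>' = \<i>" by (metis UNIV_I image_iff)
    define f where "f x = of_real (g x) - \<i>' * of_real (g (scaleX \<i>' x))" for x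
    have cf: "to_complex (f x) = Complex (g x) (- g (scaleX \<i>' x))" for x
      by (simp add: f_def to_complex_diff to_complex_mult to_complex_of_real i complex_eq_iff)
    have ii: "\<i>' * \<i>' = - 1"
      using to_complex_eq_iff[of "\<i>' * \<i>'" "- 1"] by (simp add: to_complex_mult to_complex_minus i)
    have "f (scaleX c x) = c * f x" for c x
    proof -
      define a b where "a = Re (to_complex c)" and "b = Im (to_complex c)"
      have "to_complex c = to_complex (of_real a + of_real b * \<i>')"
        by (simp add: to_complex_add to_complex_mult to_complex_of_real i a_def b_def complex_eq_iff)
      then have c: "c = of_real a + of_real b * \<i>'" by (simp only: to_complex_eq_iff)
      have cx: "scaleX c x = a *\<^sub>R x + b *\<^sub>R scaleX \<i>' x"
        by (simp add: c scale_left_distrib scale_of_real flip: scale_scale)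
      have icx: "scaleX \<i>' (scaleX c x) = a *\<^sub>R scaleX \<i>' x - b *\<^sub>R x"
      proof -
        have "\<i>' * c = of_real a * \<i>' + of_real (- b)"
        proof -
          have "\<i>' * c = of_real a * \<i>' + of_real b * (\<i>' * \<i>')" by (simp add: c algebra_simps)
          then show ?thesis by (simp add: ii)
        qed
        then have "scaleX \<i>' (scaleX c x) = scaleX (of_real a * \<i>' + of_real (- b)) x" by simp
        then show ?thesis
          by (simp only: scale_left_distrib scale_of_real flip: scale_scale) simp
      qed
      have "g (scaleX \<i>' (scaleX c x)) = a * g (scaleX \<i>' x) - b * g x"
        unfolding icx by (simp add: blinfun.diff_right blinfun.scaleR_right)
      moreover have "g (scaleX c x) = a * g x + b * g (scaleX \<i>' x)"
        unfolding cx by (simp add: blinfun.add_right blinfun.scaleR_right)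
      ultimately have "to_complex (f (scaleX c x)) = to_complex (c * f x)"
        by (simp add: cf to_complex_mult complex_eq_iff a_def b_def)
      then show ?thesis by (simp only: to_complex_eq_iff)
    qed
    moreover have "f (x + y) = f x + f y" for x y
      by (simp add: f_def scale_right_distrib blinfun.add_right algebra_simps)
    moreover have "real_part (f x) = g x" for x by (simp add: real_part_def cf)
    ultimately show ?thesis by blast
  next
    case False
    then have "range (to_complex :: 'k \<Rightarrow> complex) = \<real>" using range_to_complex by blast
    then have "\<exists>r. c = of_real r" for c :: 'k
      by (metis Reals_cases range_eqI to_complex_eq_iff to_complex_of_real)
    then have "of_real (g (scaleX c x)) = c * of_real (g x)" for c x
      by (metis blinfun.scaleR_right of_real_mult real_scaleR_def scale_of_real)
    then show ?thesis
      by (intro exI[of _ "\<lambda>x. of_real (g x)"]) (simp add: blinfun.add_right)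
  qed
  then obtain f :: "'a \<Rightarrow> 'k" where add: "\<And>x y. f (x + y) = f x + f y"
    and scale: "\<And>c x. f (scaleX c x) = c * f x" and re: "\<And>x. real_part (f x) = g x" by blast
  have bound: "norm (f x) \<le> norm g * norm x" for x
  proof -
    obtain \<beta> where \<beta>: "norm \<beta> = 1" "\<beta> * f x = of_real (norm (f x))"
      using unimodular_rotation by blast
    have "norm (f x) = g (scaleX \<beta> x)" by (simp add: scale \<beta> flip: re)
    also have "\<dots> \<le> norm g * norm (scaleX \<beta> x)" using norm_blinfun[of g "scaleX \<beta> x"] by simp
    finally show ?thesis by (simp add: norm_scale \<beta>)
  qed
  have "f (r *\<^sub>R x) = r *\<^sub>R f x" for r x
    using scale[of "of_real r" x] by (simp add: scale_of_real scaleR_conv_of_real)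
  then have "bounded_linear f"
    using add bound by (intro bounded_linear_intro[where K = "norm g"]) (auto simp: mult.commute)
  then have f: "blinfun_apply (Blinfun f) = f" by (rule bounded_linear_Blinfun_apply)
  show ?thesis
  proof (rule that)
    show "Vector_Spaces.linear scaleX (*) (blinfun_apply (Blinfun f))"
      by (simp add: linear_scalars_iff f add scale)
    show "real_part (blinfun_apply (Blinfun f) x) = g x" for x by (simp add: f re)
    show "norm (Blinfun f) \<le> norm g" by (rule norm_blinfun_bound) (auto simp: f bound)
  qed
qed

text \<open>A rotation makes the difference of the values real and nonnegative; moved into the
  argument, it turns this number into a difference of real parts.\<close>

lemma dual_eq_if_real_part_eq:
  fixes xs ys :: "'a \<Rightarrow>\<^sub>L 'k"
  assumes "Vector_Spaces.linear scaleX (*) (blinfun_apply xs)"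
    "Vector_Spaces.linear scaleX (*) (blinfun_apply ys)"
    and re: "\<And>x. real_part (blinfun_apply xs x) = real_part (blinfun_apply ys x)"
  shows "xs = ys"
proof (rule blinfun_eqI)
  fix x
  obtain \<beta> where "\<beta> * (xs x - ys x) = of_real (norm (xs x - ys x))"
    using unimodular_rotation by blast
  moreover have "\<beta> * (xs x - ys x) = xs (scaleX \<beta> x) - ys (scaleX \<beta> x)"
    using assms(1,2) by (simp add: linear_scalars_iff algebra_simps)
  ultimately have "real_part (xs (scaleX \<beta> x) - ys (scaleX \<beta> x)) = norm (xs x - ys x)" by simp
  then show "xs x = ys x" by (simp add: real_part_diff re)
qed

lemma real_part_dual_linear:
  "xs \<in> dual_ball scaleX \<Longrightarrow> linear (\<lambda>x. real_part (blinfun_apply xs x))"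
  by (rule linearI) (simp_all add: blinfun.add_right blinfun.scaleR_right real_part_add real_part_scaleR)

lemma real_part_dual_le:
  "xs \<in> dual_ball scaleX \<Longrightarrow> real_part (blinfun_apply xs x) \<le> norm x"
  using real_part_le_norm dual_ball_norm_le order_trans by blast

lemma dual_ball_of_real_linear:
  assumes "linear f" "\<And>x. f x \<le> norm x"
  obtains xs where "xs \<in> dual_ball scaleX" "\<And>x. real_part (blinfun_apply xs x) = f x"
proof -
  obtain g :: "'a \<Rightarrow>\<^sub>L real" where "norm g \<le> 1" "blinfun_apply g = f"
    by (rule linear_le_norm_blinfun[OF assms])
  moreover obtain xs :: "'a \<Rightarrow>\<^sub>L 'k" where "Vector_Spaces.linear scaleX (*) (blinfun_apply xs)"
    "\<And>x. real_part (blinfun_apply xs x) = g x" "norm xs \<le> norm g"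
    using complexify[of g] by blast
  ultimately show ?thesis using that[of xs] by (simp add: dual_ball_def)
qed

text \<open>A midpoint decomposition of the real part lifts to the dual ball, and the lifted
  midpoint is \<open>xs\<close> because their real parts agree.\<close>

lemma extreme_minorant_of_ext_point:
  assumes "xs \<in> ext_points (dual_ball scaleX)"
  shows "extreme_minorant norm (\<lambda>x. real_part (blinfun_apply xs x))" (is "extreme_minorant norm ?f")
proof -
  have xs: "xs \<in> dual_ball scaleX"
    and xs_ext: "\<And>a b. a \<in> dual_ball scaleX \<Longrightarrow> b \<in> dual_ball scaleX \<Longrightarrow> xs \<notin> open_segment a b"
    using assms by (auto simp: ext_points_def extreme_point_of_def)
  show ?thesis
    unfolding extreme_minorant_def
  proof (intro conjI allI impI)
    show "linear ?f" by (rule real_part_dual_linear[OF xs])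
    show "?f \<le> norm" by (simp add: le_fun_def real_part_dual_le[OF xs])
    fix g h :: "'a \<Rightarrow> real"
    assume gh: "linear g" "linear h" "g \<le> norm" "h \<le> norm" "\<forall>x. g x + h x = 2 * ?f x"
    obtain ys where ys: "ys \<in> dual_ball scaleX" "\<And>x. real_part (blinfun_apply ys x) = g x"
      using dual_ball_of_real_linear[OF gh(1) le_funD[OF gh(3)]] by blast
    obtain zs where zs: "zs \<in> dual_ball scaleX" "\<And>x. real_part (blinfun_apply zs x) = h x"
      using dual_ball_of_real_linear[OF gh(2) le_funD[OF gh(4)]] by blast
    have "xs = midpoint ys zs"
    proof (rule dual_eq_if_real_part_eq)
      show "Vector_Spaces.linear scaleX (*) (blinfun_apply xs)" using xs by (simp add: dual_ball_def)
      show "Vector_Spaces.linear scaleX (*) (blinfun_apply (midpoint ys zs))"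
        using ys(1) zs(1)
        by (simp add: dual_ball_def linear_scalars_iff midpoint_def scaleR_blinfun.rep_eq
            plus_blinfun.rep_eq algebra_simps)
      show "?f x = real_part (blinfun_apply (midpoint ys zs) x)" for x
        using gh(5)[rule_format, of x]
        by (simp add: midpoint_def scaleR_blinfun.rep_eq plus_blinfun.rep_eq real_part_add
            real_part_scaleR ys(2) zs(2))
    qed
    then have "ys = zs" using xs_ext[OF ys(1) zs(1)] by force
    then have "h = g" using ys(2) zs(2) by (intro ext) auto
    then show "g = ?f" using gh(5) by (intro ext) simp
  qed
qed

lemma ext_point_of_extreme_minorant:
  assumes f: "extreme_minorant norm f"
  obtains xs where "xs \<in> ext_points (dual_ball scaleX)" "\<And>x. real_part (blinfun_apply xs x) = f x"
proof -
  obtain xs where xs: "xs \<in> dual_ball scaleX" "\<And>x. real_part (blinfun_apply xs x) = f x"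
    using dual_ball_of_real_linear[OF extreme_minorant_linear[OF f] extreme_minorant_le[OF f]]
    by blast
  \<comment> \<open>Extreme minorants are tested on midpoints only. For weight
    \<open>u \<le> 1 / 2\<close> the point \<open>xs\<close> is the midpoint of \<open>a\<close> and
    \<open>(1 - 2 * u) *\<^sub>R a + (2 * u) *\<^sub>R b\<close>; larger weights are treated with
    \<open>a\<close> and \<open>b\<close> exchanged.\<close>
  have half: "a = xs"
    if a: "a \<in> dual_ball scaleX" and b: "b \<in> dual_ball scaleX" and u: "0 \<le> u" "u \<le> 1 / 2"
      and eq: "xs = (1 - u) *\<^sub>R a + u *\<^sub>R b" for a b u
  proof -
    let ?g = "\<lambda>x. real_part (blinfun_apply a x)"
    let ?h = "\<lambda>x. (1 - 2 * u) * ?g x + 2 * u * real_part (blinfun_apply b x)"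
    note lin = real_part_dual_linear[OF a] real_part_dual_linear[OF b]
    have "?g = f"
    proof (rule extreme_minorantD[OF f lin(1), where h = ?h])
      show "linear ?h"
        by (rule linearI) (simp_all add: linear_add[OF lin(1)] linear_add[OF lin(2)]
            linear_scale[OF lin(1)] linear_scale[OF lin(2)] algebra_simps)
      show "?g x \<le> norm x" for x by (rule real_part_dual_le[OF a])
      show "?h x \<le> norm x" for x
      proof -
        have "(1 - 2 * u) * ?g x \<le> (1 - 2 * u) * norm x"
          "2 * u * real_part (blinfun_apply b x) \<le> 2 * u * norm x"
          using u real_part_dual_le[OF a] real_part_dual_le[OF b] by (auto intro!: mult_left_mono)
        then show ?thesis by (simp add: algebra_simps)
      qed
      show "?g x + ?h x = 2 * f x" for x
      proof -
        have "f x = (1 - u) * ?g x + u * real_part (blinfun_apply b x)"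
          by (simp only: xs(2)[symmetric] eq scaleR_blinfun.rep_eq plus_blinfun.rep_eq
              real_part_add real_part_scaleR)
        then show ?thesis by (simp add: algebra_simps)
      qed
    qed
    then have "?g x = real_part (blinfun_apply xs x)" for x using xs(2) by metis
    then show ?thesis
      using a xs(1) by (intro dual_eq_if_real_part_eq) (auto simp: dual_ball_def)
  qed
  have "xs \<notin> open_segment a b" if ab: "a \<in> dual_ball scaleX" "b \<in> dual_ball scaleX" for a b
  proof
    assume "xs \<in> open_segment a b"
    then obtain u where u: "a \<noteq> b" "0 < u" "u < 1" "xs = (1 - u) *\<^sub>R a + u *\<^sub>R b"
      by (auto simp: in_segment)
    have "a = xs \<or> b = xs"
      using half[OF ab, of u] half[OF ab(2,1), of "1 - u"] u
      by (cases "u \<le> 1 / 2") (auto simp: algebra_simps)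
    moreover have "xs - a = u *\<^sub>R (b - a)" "xs - b = (1 - u) *\<^sub>R (a - b)"
      using u(4) by (simp_all add: algebra_simps)
    ultimately show False using u(1-3) by auto
  qed
  then have "xs \<in> ext_points (dual_ball scaleX)"
    using xs(1) by (simp add: ext_points_def extreme_point_of_def)
  then show ?thesis using xs(2) by (rule that)
qed

lemma ext_point_norming:
  obtains xs where "xs \<in> ext_points (dual_ball scaleX)" "blinfun_apply xs y = of_real (norm y)"
proof -
  obtain f where f: "extreme_minorant norm f" "f y = norm y" by (rule extreme_norming)
  obtain xs where xs: "xs \<in> ext_points (dual_ball scaleX)" "\<And>x. real_part (blinfun_apply xs x) = f x"
    using ext_point_of_extreme_minorant[OF f(1)] by blast
  have db: "xs \<in> dual_ball scaleX" using xs(1) by (simp add: ext_points_def extreme_point_of_def)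
  have "blinfun_apply xs y = of_real (norm y)"
  proof (cases "y = 0")
    case False
    then have "blinfun_apply xs ((1 / norm y) *\<^sub>R y) = 1"
      using f(2) xs(2) dual_ball_norm_le[OF db, of "(1 / norm y) *\<^sub>R y"]
      by (intro eq_one_if_real_part_ge) (auto simp: blinfun.scaleR_right real_part_scaleR)
    then have "norm y *\<^sub>R blinfun_apply xs ((1 / norm y) *\<^sub>R y) = norm y *\<^sub>R 1" by simp
    then show ?thesis using False by (simp add: blinfun.scaleR_right of_real_def)
  qed (simp add: blinfun.zero_right)
  with xs(1) show ?thesis by (rule that)
qed

lemma ext_points_subset: "ext_points (dual_ball scaleX) \<subseteq> dual_ball scaleX"
  by (auto simp: ext_points_def extreme_point_of_def)

text \<open>Both ends of a segment through \<open>xs\<close> must have real part 1 at the exposing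
  point, hence value 1, and uniqueness identifies them.\<close>

lemma weak_star_exposed_subset: "weak_star_exposed scaleX \<subseteq> ext_points (dual_ball scaleX)"
proof
  fix xs assume "xs \<in> weak_star_exposed scaleX"
  then obtain x where xs: "xs \<in> dual_ball scaleX" and x0: "x \<in> cball 0 1"
    and x1: "blinfun_apply xs x = 1"
    and uniq: "\<And>ys. ys \<in> dual_ball scaleX \<Longrightarrow> blinfun_apply ys x = 1 \<Longrightarrow> ys = xs"
    unfolding weak_star_exposed_def by blast
  have x: "norm x \<le> 1" "blinfun_apply xs x = 1" using x0 x1 by simp_all
  have "xs \<notin> open_segment a b" if ab: "a \<in> dual_ball scaleX" "b \<in> dual_ball scaleX" for a b
  proof
    assume "xs \<in> open_segment a b"
    then obtain u where u: "a \<noteq> b" "0 < u" "u < 1" "xs = (1 - u) *\<^sub>R a + u *\<^sub>R b"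
      by (auto simp: in_segment)
    let ?a = "real_part (blinfun_apply a x)" and ?b = "real_part (blinfun_apply b x)"
    have le: "norm (blinfun_apply a x) \<le> 1" "norm (blinfun_apply b x) \<le> 1"
      using dual_ball_norm_le ab x(1) order_trans by blast+
    have "real_part (blinfun_apply xs x) = 1" using x(2) by simp
    then have sum: "(1 - u) * ?a + u * ?b = 1"
      unfolding u(4) by (simp add: scaleR_blinfun.rep_eq plus_blinfun.rep_eq real_part_add real_part_scaleR)
    have a1: "?a \<le> 1" and b1: "?b \<le> 1" using le real_part_le_norm order_trans by blast+
    have "(1 - u) * ?a \<le> 1 - u" "u * ?b \<le> u" using a1 b1 u by (simp_all add: mult_left_le)
    then have "(1 - u) * ?a = 1 - u" "u * ?b = u" using sum by linarith+
    then have "?a = 1" "?b = 1" using u by auto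
    then have "blinfun_apply a x = 1" "blinfun_apply b x = 1"
      using le by (auto intro: eq_one_if_real_part_ge)
    then show False using uniq ab u(1) by blast
  qed
  then show "xs \<in> ext_points (dual_ball scaleX)"
    using xs by (simp add: ext_points_def extreme_point_of_def)
qed

end

subsection \<open>Homogeneous polynomials\<close>

lemma ball_norm_upper: "f \<in> Cb \<Longrightarrow> norm x \<le> 1 \<Longrightarrow> norm (f x) \<le> ball_norm f"
  unfolding ball_norm_def
  by (rule cSUP_upper) (auto simp: Cb_def bounded_iff bdd_above_def)

lemma ball_norm_least:
  fixes f :: "'a::real_normed_vector \<Rightarrow> 'b::real_normed_vector"
  assumes "\<And>x. norm x \<le> 1 \<Longrightarrow> norm (f x) \<le> c"
  shows "ball_norm f \<le> c"
proof -
  have "(0 :: 'a) \<in> cball 0 1" by simp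
  then show ?thesis unfolding ball_norm_def by (intro cSUP_least) (use assms in auto)
qed

lemma less_ball_normD:
  fixes f :: "'a::real_normed_vector \<Rightarrow> 'b::real_normed_vector"
  assumes "c < ball_norm f"
  shows "\<exists>x. norm x \<le> 1 \<and> c < norm (f x)"
  using ball_norm_least[of f c] assms by (meson not_le)

lemma (in normed_space_over) bounded_bilinear_scale: "bounded_bilinear scaleX"
proof
  show "\<exists>K. \<forall>a b. norm (scaleX a b) \<le> norm a * norm b * K"
    by (intro exI[of _ 1]) (simp add: norm_scale)
  show "scaleX (r *\<^sub>R a) b = r *\<^sub>R scaleX a b" for r a b
    by (metis scaleR_conv_of_real scale_of_real scale_scale)
  show "scaleX a (r *\<^sub>R b) = r *\<^sub>R scaleX a b" for r a b
    by (metis scale_of_real scale_left_commute)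
qed (simp_all add: scale_left_distrib scale_right_distrib)

context
  fixes scaleX :: "'k::real_or_complex \<Rightarrow> 'a::real_normed_vector \<Rightarrow> 'a"
    and scaleY :: "'k \<Rightarrow> 'b::real_normed_vector \<Rightarrow> 'b"
  assumes X: "normed_space_over scaleX" and Y: "normed_space_over scaleY"
begin

interpretation X: normed_space_over scaleX by (rule X)
interpretation Y: normed_space_over scaleY by (rule Y)

lemma hom_polys_homogeneous:
  assumes "P \<in> hom_polys scaleX scaleY k"
  shows "P (scaleX c x) = scaleY (c ^ k) (P x)"
proof -
  obtain L where L: "continuous_multilinear scaleX scaleY k L"
    and P: "\<And>x. P x = L (\<lambda>i\<in>{..<k}. x)" using assms by (auto simp: hom_polys_def)
  \<comment> \<open>Only the first \<open>j\<close> coordinates are scaled, so passing from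
    \<open>j\<close> to \<open>Suc j\<close> changes coordinate \<open>j\<close> alone and extracts
    one factor \<open>c\<close>.\<close>
  define z where "z j = (\<lambda>i\<in>{..<k}. if i < j then scaleX c x else x)" for j
  have "L (z j) = scaleY (c ^ j) (L (z 0))" if "j \<le> k" for j
    using that
  proof (induction j)
    case (Suc j)
    have "z j \<in> {..<k} \<rightarrow>\<^sub>E UNIV" by (auto simp: z_def)
    then have "Vector_Spaces.linear scaleX scaleY (\<lambda>y. L ((z j)(j := y)))"
      using L Suc.prems by (auto simp: continuous_multilinear_def)
    then have "L ((z j)(j := scaleX c x)) = scaleY c (L ((z j)(j := x)))"
      by (simp add: linear_over_iff[OF X Y])
    moreover have "(z j)(j := scaleX c x) = z (Suc j)" "(z j)(j := x) = z j"
      using Suc.prems by (auto simp: z_def fun_eq_iff)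
    ultimately show ?case using Suc by simp
  qed simp
  from this[of k] have "L (z k) = scaleY (c ^ k) (L (z 0))" by simp
  moreover have "z k = (\<lambda>i\<in>{..<k}. scaleX c x)" "z 0 = (\<lambda>i\<in>{..<k}. x)"
    by (auto simp: z_def fun_eq_iff)
  ultimately show ?thesis by (simp add: P)
qed

lemma hom_polys_scaleR: "P \<in> hom_polys scaleX scaleY k \<Longrightarrow> P (r *\<^sub>R x) = r ^ k *\<^sub>R P x"
  using hom_polys_homogeneous[of P k "of_real r" x]
  by (simp add: X.scale_of_real Y.scale_of_real flip: of_real_power)

lemma hom_polys_zero: "P \<in> hom_polys scaleX scaleY k \<Longrightarrow> k > 0 \<Longrightarrow> P 0 = 0"
  using hom_polys_scaleR[of P k 0 0] zero_power[of k, where 'a = real] by simp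

lemma hom_polys_continuous:
  assumes "P \<in> hom_polys scaleX scaleY k"
  shows "continuous_on S P"
proof -
  obtain L where L: "continuous_on ({..<k} \<rightarrow>\<^sub>E UNIV) L" and P: "\<And>x. P x = L (\<lambda>i\<in>{..<k}. x)"
    using assms by (auto simp: hom_polys_def continuous_multilinear_def)
  have "continuous_on S (\<lambda>x. restrict (\<lambda>i. x) {..<k} i)" for i
    by (cases "i < k") auto
  then have "continuous_on S (\<lambda>x. \<lambda>i\<in>{..<k}. x)"
    by (rule continuous_on_coordinatewise_then_product)
  then have "continuous_on S (\<lambda>x. L (\<lambda>i\<in>{..<k}. x))"
    by (rule continuous_on_compose2[OF L]) (rule image_subsetI, simp add: PiE_iff)
  then show ?thesis by (simp add: P[abs_def])
qed

text \<open>Continuity at 0, where the value is 0, bounds \<open>P\<close> by 1 on a small ball;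
  homogeneity carries the bound to the unit ball.\<close>

lemma hom_polys_Cb:
  assumes P: "P \<in> hom_polys scaleX scaleY k" and k: "k > 0"
  shows "P \<in> Cb"
proof -
  note P0 = hom_polys_zero[OF P k]
  have "isCont P 0"
    using hom_polys_continuous[OF P, of UNIV] by (simp add: continuous_on_eq_continuous_at)
  then obtain d where d: "d > 0" "\<And>x. dist x 0 < d \<Longrightarrow> dist (P x) (P 0) < 1"
    unfolding continuous_at_eps_delta by (metis zero_less_one)
  have "norm (P x) \<le> (2 / d) ^ k" if "norm x \<le> 1" for x
  proof -
    have "norm ((d / 2) *\<^sub>R x) < d"
      using mult_left_mono[OF that, of "d / 2"] d(1) by simp
    then have "norm (P ((d / 2) *\<^sub>R x)) < 1" using d(2)[of "(d / 2) *\<^sub>R x"] by (simp add: P0)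
    then have "(d / 2) ^ k * norm (P x) \<le> 1"
      using d(1) by (simp add: hom_polys_scaleR[OF P])
    then show ?thesis using d(1) by (simp add: power_divide field_simps)
  qed
  then show ?thesis
    using hom_polys_continuous[OF P] by (auto simp: Cb_def bounded_iff intro!: exI[of _ "(2 / d) ^ k"])
qed

lemma hom_polys_add:
  assumes "P \<in> hom_polys scaleX scaleY k" "Q \<in> hom_polys scaleX scaleY k"
  shows "(\<lambda>x. P x + Q x) \<in> hom_polys scaleX scaleY k"
proof -
  obtain L M where L: "continuous_multilinear scaleX scaleY k L" "\<And>x. P x = L (\<lambda>i\<in>{..<k}. x)"
    and M: "continuous_multilinear scaleX scaleY k M" "\<And>x. Q x = M (\<lambda>i\<in>{..<k}. x)"
    using assms by (auto simp: hom_polys_def)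
  have "continuous_multilinear scaleX scaleY k (\<lambda>z. L z + M z)"
    using L(1) M(1) unfolding continuous_multilinear_def
    by (auto intro!: continuous_on_add simp: linear_over_iff[OF X Y] Y.scale_right_distrib)
  then show ?thesis unfolding hom_polys_def using L(2) M(2) by auto
qed

lemma hom_polys_compose_linear:
  assumes P: "P \<in> hom_polys scaleX scaleY k" and Z: "normed_space_over scaleZ"
    and T: "Vector_Spaces.linear scaleY scaleZ T" "continuous_on UNIV T"
  shows "(\<lambda>x. T (P x)) \<in> hom_polys scaleX scaleZ k"
proof -
  obtain L where L: "continuous_multilinear scaleX scaleY k L" "\<And>x. P x = L (\<lambda>i\<in>{..<k}. x)"
    using P by (auto simp: hom_polys_def)
  have "continuous_multilinear scaleX scaleZ k (\<lambda>z. T (L z))"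
    using L(1) T(1) unfolding continuous_multilinear_def
    by (auto intro!: continuous_on_compose2[OF T(2)]
        simp: linear_over_iff[OF X Y] linear_over_iff[OF X Z] linear_over_iff[OF Y Z])
  then show ?thesis unfolding hom_polys_def using L(2) by auto
qed

end

context normed_space_over
begin

lemma hom_polys_prod:
  fixes F :: "nat \<Rightarrow> 'a \<Rightarrow>\<^sub>L 'k"
  assumes F: "\<And>i. Vector_Spaces.linear scaleX (*) (blinfun_apply (F i))"
  shows "(\<lambda>x. \<Prod>i<k. blinfun_apply (F i) x) \<in> hom_polys scaleX (*) k"
proof -
  let ?L = "\<lambda>z. \<Prod>i<k. blinfun_apply (F i) (z i)"
  have "continuous_on UNIV (\<lambda>z. blinfun_apply (F i) (z i))" for i
    by (rule continuous_on_compose2[OF linear_continuous_on[OF blinfun.bounded_linear_right]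
          continuous_on_product_coordinates]) auto
  then have "continuous_on UNIV ?L" by (intro continuous_on_prod)
  then have "continuous_on ({..<k} \<rightarrow>\<^sub>E UNIV) ?L" by (rule continuous_on_subset) simp
  moreover have "Vector_Spaces.linear scaleX (*) (\<lambda>y. ?L (z(i := y)))" if "i < k" for z i
  proof -
    have "?L (z(i := y)) = (\<Prod>j\<in>{..<k} - {i}. blinfun_apply (F j) (z j)) * blinfun_apply (F i) y" for y
      using that by (subst prod.remove[of _ i]) (auto intro!: prod.cong)
    then show ?thesis
      using F by (simp add: linear_scalars_iff algebra_simps)
  qed
  ultimately have "continuous_multilinear scaleX (*) k ?L"
    by (simp add: continuous_multilinear_def)
  moreover have "(\<Prod>i<k. blinfun_apply (F i) x) = ?L (\<lambda>i\<in>{..<k}. x)" for x by simp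
  ultimately show ?thesis unfolding hom_polys_def by blast
qed

lemma hom_polys_power_times:
  assumes "Vector_Spaces.linear scaleX (*) (blinfun_apply f)"
    "Vector_Spaces.linear scaleX (*) (blinfun_apply g)" and k: "k > 0"
  shows "(\<lambda>x. blinfun_apply f x ^ (k - 1) * blinfun_apply g x) \<in> hom_polys scaleX (*) k"
proof -
  have "(\<lambda>x. \<Prod>i<k. blinfun_apply (if i = 0 then g else f) x) \<in> hom_polys scaleX (*) k"
    using assms by (intro hom_polys_prod) auto
  moreover have "(\<Prod>i<k. blinfun_apply (if i = 0 then g else f) x) =
      blinfun_apply f x ^ (k - 1) * blinfun_apply g x" for x
  proof -
    have "(\<Prod>i\<in>{..<k} - {0}. blinfun_apply (if i = 0 then g else f) x) =
        (\<Prod>i\<in>{..<k} - {0}. blinfun_apply f x)" by (rule prod.cong) auto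
    then show ?thesis using k by (subst prod.remove[of _ 0]) (auto simp: mult.commute)
  qed
  ultimately show ?thesis by simp
qed

lemma hom_polys_times_vector:
  assumes "p \<in> hom_polys scaleX (*) k"
  shows "(\<lambda>x. scaleX (c * p x) y) \<in> hom_polys scaleX scaleX k"
proof (rule hom_polys_compose_linear[OF normed_space_over_axioms normed_space_over_scalars assms
      normed_space_over_axioms])
  show "Vector_Spaces.linear (*) scaleX (\<lambda>a. scaleX (c * a) y)"
    by (simp add: linear_over_iff[OF normed_space_over_scalars normed_space_over_axioms]
        algebra_simps scale_left_distrib mult.left_commute)
  show "continuous_on UNIV (\<lambda>a. scaleX (c * a) y)"
    by (intro bounded_bilinear.continuous_on[OF bounded_bilinear_scale] continuous_intros)
qed

lemma hom_polys_dual_compose: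
  assumes "P \<in> hom_polys scaleX scaleX k" "xs \<in> dual_ball scaleX"
  shows "(\<lambda>x. blinfun_apply xs (P x)) \<in> hom_polys scaleX (*) k"
  by (rule hom_polys_compose_linear[OF normed_space_over_axioms normed_space_over_axioms assms(1)
      normed_space_over_scalars])
    (use assms(2) in \<open>auto simp: dual_ball_def intro: linear_continuous_on blinfun.bounded_linear_right\<close>)

lemma real_part_blinfun:
  assumes "xs \<in> dual_ball scaleX"
  obtains g :: "'a \<Rightarrow>\<^sub>L real" where "norm g \<le> 1" "\<And>x. g x = real_part (blinfun_apply xs x)"
  using linear_le_norm_blinfun[OF real_part_dual_linear[OF assms] real_part_dual_le[OF assms]]
  by metis

text \<open>A nonempty set is not the closed hull of the empty set, so a strongly exposed point
  exists. The uniform statement about slices follows from the sequential one by choosing a bad point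
  in each slice of depth \<open>1 / real (Suc n)\<close>.\<close>

lemma radon_nikodym_strongly_exposable:
  assumes rn: "radon_nikodym scaleX" and K: "K \<noteq> {}" "bounded K" "closed K" "convex K"
  shows "strongly_exposable (K :: 'a set)"
proof -
  have "K = closure (convex hull (strongly_exposed_points scaleX K))"
    using assms by (simp add: radon_nikodym_def)
  then have "strongly_exposed_points scaleX K \<noteq> {}" using K(1) by force
  then obtain p where p: "p \<in> strongly_exposed_points scaleX K" by blast
  then obtain xs where pK: "p \<in> K" and xs: "xs \<in> dual_ball scaleX"
    and bdd: "bdd_above ((\<lambda>y. real_part (blinfun_apply xs y)) ` K)"
    and sup: "real_part (blinfun_apply xs p) = (SUP y\<in>K. real_part (blinfun_apply xs y))"
    and seq: "\<And>s. (\<forall>n. s n \<in> K) \<Longrightarrow>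
      (\<lambda>n. real_part (blinfun_apply xs (s n))) \<longlonglongrightarrow> real_part (blinfun_apply xs p) \<Longrightarrow>
      (\<lambda>n. norm (s n - p)) \<longlonglongrightarrow> 0"
    unfolding strongly_exposed_points_def real_part_def by (auto simp: Let_def)
  obtain g :: "'a \<Rightarrow>\<^sub>L real" where g: "norm g \<le> 1" "\<And>x. g x = real_part (blinfun_apply xs x)"
    using real_part_blinfun[OF xs] by blast
  have le: "g x \<le> g p" if "x \<in> K" for x
    using cSUP_upper[OF that bdd] sup by (simp add: g)
  have "\<exists>a>0. \<forall>x\<in>K. g p - a < g x \<longrightarrow> dist x p < \<epsilon>" if "\<epsilon> > 0" for \<epsilon>
  proof (rule ccontr)
    assume neg: "\<not> ?thesis"
    have "\<exists>x\<in>K. g p - 1 / real (Suc n) < g x \<and> \<epsilon> \<le> dist x p" for n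
      using neg by (metis not_le of_nat_0_less_iff zero_less_Suc zero_less_divide_1_iff)
    then obtain s where s: "\<And>n. s n \<in> K" "\<And>n. g p - 1 / real (Suc n) < g (s n)"
      "\<And>n. \<epsilon> \<le> dist (s n) p" by metis
    have "(\<lambda>n. g (s n)) \<longlonglongrightarrow> g p"
    proof (rule tendsto_sandwich)
      have "(\<lambda>n. g p - 1 / real (Suc n)) \<longlonglongrightarrow> g p - 0"
        by (intro tendsto_diff tendsto_const lim_1_over_n[THEN LIMSEQ_Suc])
      then show "(\<lambda>n. g p - 1 / real (Suc n)) \<longlonglongrightarrow> g p" by simp
      show "(\<lambda>n. g p) \<longlonglongrightarrow> g p" by simp
    qed (use s le in \<open>auto intro!: always_eventually less_imp_le\<close>)
    then have "(\<lambda>n. norm (s n - p)) \<longlonglongrightarrow> 0" using s(1) by (intro seq) (auto simp: g)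
    then have "\<epsilon> \<le> 0"
      by (rule tendsto_lowerbound) (use s(3) in \<open>auto simp: dist_norm intro!: always_eventually\<close>)
    with \<open>\<epsilon> > 0\<close> show False by simp
  qed
  then show ?thesis unfolding strongly_exposable_def using pK g(1) by blast
qed

end

subsection \<open>Smooth points of the norm\<close>

text \<open>
  Density of smooth points, by Baire's theorem: the second difference quotients of the norm cannot stay
  above \<open>1 / Suc n\<close> along a segment, since its slopes are bounded by \<open>norm h\<close>.
\<close>

lemma second_differences_telescope:
  fixes a :: "nat \<Rightarrow> real"
  assumes "\<And>j. 1 \<le> j \<Longrightarrow> j \<le> m \<Longrightarrow> a (j + 1) + a (j - 1) - 2 * a j \<ge> e"
  shows "a (m + 1) - a m \<ge> a 1 - a 0 + real m * e"
  using assms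
proof (induction m)
  case (Suc m)
  have "a (m + 1) - a m \<ge> a 1 - a 0 + real m * e" using Suc.prems by (intro Suc.IH) auto
  moreover have "a (Suc m + 1) + a (Suc m - 1) - 2 * a (Suc m) \<ge> e" by (rule Suc.prems) auto
  ultimately show ?case by (simp add: algebra_simps)
qed simp

text \<open>For \<open>z\<close> in this set two functionals norming \<open>z\<close> differ on
  \<open>h\<close> by less than \<open>1 / real (Suc n)\<close>. Asking for a single
  \<open>t\<close> with strict inequality makes the set open.\<close>

definition almost_smooth :: "'a::real_normed_vector \<Rightarrow> nat \<Rightarrow> 'a set"
  where "almost_smooth h n =
    {z. \<exists>t>0. norm (z + t *\<^sub>R h) + norm (z - t *\<^sub>R h) - 2 * norm z < t / real (Suc n)}"

lemma open_almost_smooth: "open (almost_smooth h n)"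
proof -
  have eq: "almost_smooth h n = (\<Union>t\<in>{0<..}.
      {z. norm (z + t *\<^sub>R h) + norm (z - t *\<^sub>R h) - 2 * norm z < t / real (Suc n)})"
    by (auto simp: almost_smooth_def)
  show ?thesis unfolding eq by (intro open_UN ballI open_Collect_less continuous_intros)
qed

lemma dense_almost_smooth: "closure (almost_smooth h n) = UNIV"
proof -
  have "z \<in> closure (almost_smooth h n)" for z :: 'a
    unfolding closure_approachable
  proof (intro allI impI, rule ccontr)
    fix \<delta> :: real assume \<delta>: "\<delta> > 0" and far: "\<not> (\<exists>y\<in>almost_smooth h n. dist y z < \<delta>)"
    \<comment> \<open>The first \<open>m\<close> steps of length parameter \<open>t\<close> along
      \<open>h\<close> stay within \<delta> of \<open>z\<close>. Each adds at least
      \<open>t / real (Suc n)\<close> to the first difference of the norm, which always lies between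
      \<open>- t * norm h\<close> and \<open>t * norm h\<close>; \<open>m\<close> is chosen too
      large for that range.\<close>
    define d where "d = \<delta> / (norm h + 1)"
    have h1: "norm h + 1 > 0" using norm_ge_zero[of h] by linarith
    have d: "d > 0" "d * norm h < \<delta>" using \<delta> h1 by (auto simp: d_def field_simps)
    obtain m where m: "2 * norm h * real (Suc n) < real m" using reals_Archimedean2 by blast
    moreover have "0 \<le> 2 * norm h * real (Suc n)" by simp
    ultimately have m0: "m > 0" by linarith
    define t where "t = d / real m"
    have t: "t > 0" "real m * t = d" using d m0 by (auto simp: t_def)
    define a where "a j = norm (z + (real j * t) *\<^sub>R h)" for j
    have "a (m + 1) - a m \<ge> a 1 - a 0 + real m * (t / real (Suc n))"
    proof (rule second_differences_telescope)
      fix j assume j: "1 \<le> j" "j \<le> m"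
      let ?y = "z + (real j * t) *\<^sub>R h"
      have "real j * t \<le> d" using j t by (auto simp flip: t(2))
      then have "real j * t * norm h \<le> d * norm h" by (intro mult_right_mono) auto
      then have "dist ?y z < \<delta>" using d(2) t(1) by (simp add: dist_norm)
      then have "?y \<notin> almost_smooth h n" using far by blast
      then have "norm (?y + t *\<^sub>R h) + norm (?y - t *\<^sub>R h) - 2 * norm ?y \<ge> t / real (Suc n)"
        using t(1) unfolding almost_smooth_def mem_Collect_eq not_ex not_less de_Morgan_conj
        by (metis not_less)
      moreover have "?y + t *\<^sub>R h = z + (real (j + 1) * t) *\<^sub>R h"
        "?y - t *\<^sub>R h = z + (real (j - 1) * t) *\<^sub>R h"
        using j by (auto simp: algebra_simps of_nat_diff)
      ultimately show "a (j + 1) + a (j - 1) - 2 * a j \<ge> t / real (Suc n)" by (simp add: a_def)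
    qed
    note slope = this
    have step: "\<bar>a (Suc j) - a j\<bar> \<le> t * norm h" for j
      using norm_triangle_ineq3[of "z + (real (Suc j) * t) *\<^sub>R h" "z + (real j * t) *\<^sub>R h"] t(1)
      by (simp add: a_def algebra_simps)
    have "real m * (t / real (Suc n)) \<le> 2 * t * norm h"
      using slope step[of m] step[of 0] by (simp add: abs_le_iff)
    then have "t * real m \<le> t * (2 * norm h * real (Suc n))" by (simp add: field_simps)
    then show False using m t(1) by simp
  qed
  then show ?thesis by blast
qed

text \<open>Baire's theorem is applied to countably many open dense sets, one for each
  \<open>n\<close> and each direction \<open>h\<close> from a countable dense set. Norming
  functionals of a common point agree in these directions, hence everywhere by continuity.\<close>

theorem dense_smooth_points:
  fixes y :: "'a::banach"
  assumes "separable_space (euclidean :: 'a topology)" "\<delta> > 0"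
  obtains z where "dist z y < \<delta>"
    "\<And>f g. linear f \<Longrightarrow> linear g \<Longrightarrow> (\<And>x. f x \<le> norm x) \<Longrightarrow> (\<And>x. g x \<le> norm x) \<Longrightarrow>
      f z = norm z \<Longrightarrow> g z = norm z \<Longrightarrow> f = g"
proof -
  obtain C :: "'a set" where C: "countable C" "closure C = UNIV"
    using assms(1) by (auto simp: separable_space_def)
  let ?G = "(\<lambda>(h, n). almost_smooth h n) ` (C \<times> (UNIV :: nat set))"
  have "Met_TC.mtopology closure_of \<Inter> ?G = UNIV"
    by (rule Met_TC.metric_Baire_category)
      (use C(1) in \<open>auto simp: open_almost_smooth dense_almost_smooth complete_UNIV\<close>)
  then have "y \<in> closure (\<Inter> ?G)" by simp
  then obtain z where z: "z \<in> \<Inter> ?G" "dist z y < \<delta>"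
    using assms(2) unfolding closure_approachable by blast
  have le: "f h \<le> g h" if h: "h \<in> C" and f: "linear f" "\<And>x. f x \<le> norm x" "f z = norm z"
    and g: "linear g" "\<And>x. g x \<le> norm x" "g z = norm z" for f g h
  proof (rule field_le_epsilon)
    fix e :: real assume "e > 0"
    then obtain n where n: "1 / real (Suc n) < e" using nat_approx_posE by blast
    have "z \<in> almost_smooth h n" using z(1) h by auto
    then obtain t where t: "t > 0"
      "norm (z + t *\<^sub>R h) + norm (z - t *\<^sub>R h) - 2 * norm z < t / real (Suc n)"
      by (auto simp: almost_smooth_def)
    \<comment> \<open>Since both functionals equal \<open>norm z\<close> at \<open>z\<close>, adding
      these bounds leaves \<open>t * (f h - g h)\<close> below the second difference.\<close>
    have "f (z + t *\<^sub>R h) \<le> norm (z + t *\<^sub>R h)" "g (z - t *\<^sub>R h) \<le> norm (z - t *\<^sub>R h)"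
      by (rule f(2), rule g(2))
    then have "t * f h - t * g h < t / real (Suc n)"
      using t(2) f(3) g(3)
      by (simp add: linear_add[OF f(1)] linear_scale[OF f(1)] linear_diff[OF g(1)] linear_scale[OF g(1)])
    then have "t * (f h - g h) < t * (1 / real (Suc n))" by (simp add: algebra_simps)
    then have "f h - g h < 1 / real (Suc n)" using t(1) by (simp only: mult_less_cancel_left_pos)
    then show "f h \<le> g h + e" using n by linarith
  qed
  have "f = g" if f: "linear f" "\<And>x. f x \<le> norm x" "f z = norm z"
    and g: "linear g" "\<And>x. g x \<le> norm x" "g z = norm z" for f g :: "'a \<Rightarrow> real"
  proof
    fix x
    obtain F :: "'a \<Rightarrow>\<^sub>L real" where F: "blinfun_apply F = f"
      using linear_le_norm_blinfun[OF f(1,2)] by blast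
    obtain G :: "'a \<Rightarrow>\<^sub>L real" where G: "blinfun_apply G = g"
      using linear_le_norm_blinfun[OF g(1,2)] by blast
    have "closed {x. f x = g x}"
      unfolding F[symmetric] G[symmetric]
      by (intro closed_Collect_eq linear_continuous_on blinfun.bounded_linear_right)
    moreover have "C \<subseteq> {x. f x = g x}"
      using le[OF _ f g] le[OF _ g f] by (auto intro: antisym)
    ultimately have "closure C \<subseteq> {x. f x = g x}" by (intro closure_minimal)
    then show "f x = g x" using C(2) by auto
  qed
  then show ?thesis using z(2) that by blast
qed

subsection \<open>Density of strongly attaining polynomials\<close>

text \<open>By homogeneity, pushing a nonzero point of the ball out to the sphere can only increase
  the norm of the value.\<close>

lemma hom_polys_unit_almost_attains:
  assumes "normed_space_over scaleX" "normed_space_over scaleY"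
    and P: "P \<in> hom_polys scaleX scaleY k" and k: "k > 0" and c: "0 \<le> c" "c < ball_norm P"
  shows "\<exists>x. norm x = 1 \<and> c < norm (P x)"
proof -
  note spaces = assms(1,2)
  obtain x where x: "norm x \<le> 1" "c < norm (P x)" using less_ball_normD[OF c(2)] by blast
  have x0: "x \<noteq> 0" using x(2) c(1) hom_polys_zero[OF spaces P k] by auto
  then have "norm x ^ k \<le> 1" "norm x ^ k > 0" using x(1) by (auto intro: power_le_one)
  then have "norm (P x) \<le> norm (P x) / norm x ^ k"
    using mult_left_mono[of "norm x ^ k" 1 "norm (P x)"] by (simp add: field_simps)
  also have "\<dots> = norm (P ((1 / norm x) *\<^sub>R x))"
    by (simp add: hom_polys_scaleR[OF spaces P] power_divide)
  finally show ?thesis using x(2) x0 by (intro exI[of _ "(1 / norm x) *\<^sub>R x"]) simp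
qed

text \<open>
  A strongly attaining perturbation of a polynomial \<open>Q\<close> has the form
  \<open>Q x + scaleX (c * f x ^ (k - 1) * g x) y\<close>. Here \<open>f\<close> nearly norms a near-maximizer of \<open>Q\<close>, so that
  near-maximizers of the perturbed function stay away from the kernel of \<open>f\<close>, while \<open>g\<close>
  comes from the variational principle applied to \<open>w x = norm (f x) ^ (k - 1) * x\<close>, in which
  the perturbation is linear in \<open>g\<close>.
\<close>

theorem strongly_attaining_perturbation:
  fixes scaleX :: "'k::real_or_complex \<Rightarrow> 'a::banach \<Rightarrow> 'a"
  assumes X: "normed_space_over scaleX" and rn: "radon_nikodym scaleX" and k: "k > 0"
    and Q: "Q \<in> hom_polys scaleX scaleX k" and Q1: "ball_norm Q = 1" and \<epsilon>: "0 < \<epsilon>" "\<epsilon> < 1"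
  shows "\<exists>Q'\<in>hom_polys scaleX scaleX k. \<exists>x0. (\<forall>x. norm x \<le> 1 \<longrightarrow> norm (Q' x - Q x) \<le> 2 * \<epsilon>) \<and>
    norm x0 = 1 \<and> norm (Q' x0) = ball_norm Q' \<and> strongly_attains_at scaleX Q' x0"
proof -
  interpret normed_space_over scaleX by (rule X)
  note Qhom = hom_polys_homogeneous[OF X X Q] and QR = hom_polys_scaleR[OF X X Q]
  have QCb: "Q \<in> Cb" by (rule hom_polys_Cb[OF X X Q k])
  have Q_le: "norm (Q x) \<le> 1" if "norm x \<le> 1" for x using ball_norm_upper[OF QCb that] Q1 by simp
  obtain x1 where x1: "norm x1 = 1" "1 - \<epsilon> / 2 < norm (Q x1)"
    using hom_polys_unit_almost_attains[OF X X Q k, of "1 - \<epsilon> / 2"] Q1 \<epsilon> by auto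
  obtain f where "f \<in> ext_points (dual_ball scaleX)" and f1: "blinfun_apply f x1 = 1"
    using ext_point_norming[of x1] x1(1) by auto
  then have f: "f \<in> dual_ball scaleX" using ext_points_subset by blast
  obtain g0 :: "'a \<Rightarrow>\<^sub>L real" where g0: "norm g0 \<le> 1" "\<And>x. g0 x = real_part (blinfun_apply f x)"
    using real_part_blinfun[OF f] by blast
  define u where "u x = norm (blinfun_apply f x) ^ (k - 1)" for x
  define w where "w x = u x *\<^sub>R x" for x
  have u0: "0 \<le> u x" and u_scale: "u (scaleX c x) = norm c ^ (k - 1) * u x" for x c
    by (simp_all add: u_def dual_ball_scale[OF f] norm_mult power_mult_distrib)
  have u_scaleR: "u (r *\<^sub>R x) = \<bar>r\<bar> ^ (k - 1) * u x" for r x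
    using u_scale[of "of_real r" x] by (simp add: scale_of_real)
  have u1: "u x \<le> 1" if "norm x \<le> 1" for x
    unfolding u_def using dual_ball_norm_le[OF f, of x] that by (intro power_le_one) auto
  have w1: "norm (w x) \<le> 1" if "norm x \<le> 1" for x
    using mult_mono[OF u1[OF that] that] u0[of x] by (simp add: w_def)
  let ?B = "cball (0 :: 'a) 1"
  let ?near = "near_maximizers ?B (\<lambda>x. norm (Q x)) w"
  \<comment> \<open>The perturbation is centered at \<open>\<epsilon> *\<^sub>R g0\<close> and not
    at 0. At \<open>x1\<close> it adds at least \<open>\<epsilon> - \<epsilon> / 4\<close>, while
    \<open>norm (Q x1) > 1 - \<epsilon> / 2\<close>; hence the perturbed supremum exceeds
    \<open>ball_norm Q\<close>.\<close>
  have "\<exists>g. norm (g - \<epsilon> *\<^sub>R g0) < \<epsilon> / 4 \<and>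
      (\<forall>e>0. \<exists>\<alpha>>0. \<forall>x\<in>?near g \<alpha>. \<forall>y\<in>?near g \<alpha>. dist (w x) (w y) \<le> e)"
  proof (rule Stegall_variational_principle)
    show "?B \<noteq> {}" by simp
    show "norm (Q x) \<le> 1" "norm (w x) \<le> 1" if "x \<in> ?B" for x using that Q_le w1 by simp_all
    show "strongly_exposable K" if "K \<noteq> {}" "bounded K" "closed K" "convex K" for K :: "'a set"
      by (rule radon_nikodym_strongly_exposable[OF rn that])
    show "\<epsilon> / 4 > 0" using \<epsilon> by simp
  qed
  then obtain g :: "'a \<Rightarrow>\<^sub>L real" where g: "norm (g - \<epsilon> *\<^sub>R g0) < \<epsilon> / 4"
    and small: "\<And>e. e > 0 \<Longrightarrow> \<exists>\<alpha>>0. \<forall>x\<in>?near g \<alpha>. \<forall>y\<in>?near g \<alpha>. dist (w x) (w y) \<le> e" by blast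
  have g_norm: "norm g \<le> 2 * \<epsilon>"
  proof -
    have "\<epsilon> * norm g0 \<le> \<epsilon>" using g0(1) \<epsilon>(1) by simp
    moreover have "norm g \<le> norm (g - \<epsilon> *\<^sub>R g0) + \<epsilon> * norm g0"
      using norm_triangle_ineq[of "g - \<epsilon> *\<^sub>R g0" "\<epsilon> *\<^sub>R g0"] \<epsilon>(1) by simp
    ultimately show ?thesis using g \<epsilon>(1) by linarith
  qed
  have g_le: "g x \<le> 2 * \<epsilon>" if "norm x \<le> 1" for x
  proof -
    have "g x \<le> norm g * norm x" using norm_blinfun[of g x] by simp
    also have "\<dots> \<le> (2 * \<epsilon>) * 1" using that g_norm \<epsilon> by (intro mult_mono) auto
    finally show ?thesis by simp
  qed
  obtain G :: "'a \<Rightarrow>\<^sub>L 'k" where G: "Vector_Spaces.linear scaleX (*) (blinfun_apply G)"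
    "\<And>x. real_part (blinfun_apply G x) = g x" "norm G \<le> norm g"
    using complexify[of g] by blast
  have G_scale: "blinfun_apply G (scaleX c x) = c * blinfun_apply G x" for c x
    using G(1) by (simp add: linear_scalars_iff)
  have G_le: "norm (blinfun_apply G x) \<le> 2 * \<epsilon>" if "norm x \<le> 1" for x
  proof -
    have "norm (blinfun_apply G x) \<le> norm G * norm x" by (rule norm_blinfun)
    also have "\<dots> \<le> (2 * \<epsilon>) * 1" using that G(3) g_norm \<epsilon> by (intro mult_mono) auto
    finally show ?thesis by simp
  qed
  \<comment> \<open>\<open>F\<close> is the function governed by the variational principle.
    \<open>H\<close> is its maximum over rotations of the argument, and it will dominate the norm of
    the perturbed polynomial.\<close>
  define F where "F x = norm (Q x) + u x * g x" for x
  define H where "H x = norm (Q x) + u x * norm (blinfun_apply G x)" for x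
  have F_w: "F x = norm (Q x) + g (w x)" for x by (simp add: F_def w_def blinfun.scaleR_right)
  have FH: "F x \<le> H x" for x
    unfolding F_def H_def G(2)[symmetric] by (intro add_left_mono mult_left_mono real_part_le_norm u0)
  have F_cont: "continuous_on UNIV F"
    unfolding F_def u_def
    by (intro continuous_intros hom_polys_continuous[OF X X Q]
        linear_continuous_on blinfun.bounded_linear_right)
  have F_scale: "F (r *\<^sub>R x) = r ^ k * F x" if "r \<ge> 0" for r x
  proof -
    have "r ^ k = r ^ (k - 1) * r" using k by (simp add: power_eq_if mult.commute)
    then show ?thesis
      using that by (simp add: F_def QR u_scaleR blinfun.scaleR_right algebra_simps)
  qed
  define M where "M = (SUP x\<in>?B. F x)"
  have bdd: "bdd_above (F ` ?B)"
  proof (rule bdd_aboveI2)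
    fix x assume "x \<in> ?B"
    then have x: "norm x \<le> 1" by simp
    have "u x * g x \<le> u x * (2 * \<epsilon>)" by (rule mult_left_mono[OF g_le[OF x] u0])
    also have "\<dots> \<le> 1 * (2 * \<epsilon>)" using u1[OF x] \<epsilon> by (intro mult_right_mono) auto
    finally show "F x \<le> 1 + 2 * \<epsilon>" using Q_le[OF x] by (simp add: F_def)
  qed
  have F_le: "F x \<le> M" if "norm x \<le> 1" for x
    unfolding M_def by (rule cSUP_upper[OF _ bdd]) (use that in simp)
  have M: "M > 1"
  proof -
    have "\<bar>(g - \<epsilon> *\<^sub>R g0) x1\<bar> \<le> norm (g - \<epsilon> *\<^sub>R g0) * norm x1"
      using norm_blinfun[of "g - \<epsilon> *\<^sub>R g0" x1] by simp
    then have "\<bar>g x1 - \<epsilon>\<bar> \<le> \<epsilon> / 4"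
      using g
      by (simp add: minus_blinfun.rep_eq scaleR_blinfun.rep_eq g0(2) f1 x1(1))
    then have "g x1 \<ge> \<epsilon> - \<epsilon> / 4" by linarith
    moreover have "F x1 = norm (Q x1) + g x1" by (simp add: F_def u_def f1)
    ultimately have "F x1 > 1" using x1(2) \<epsilon> by linarith
    then show ?thesis using F_le[of x1] x1(1) by simp
  qed
  have near_iff: "x \<in> ?near g \<alpha> \<longleftrightarrow> norm x \<le> 1 \<and> M \<le> F x + \<alpha>" for x \<alpha>
  proof -
    have "(\<forall>y\<in>?B. F y \<le> F x + \<alpha>) \<longleftrightarrow> M \<le> F x + \<alpha>"
      unfolding M_def by (subst cSUP_le_iff[OF _ bdd]) auto
    then show ?thesis by (auto simp: near_maximizers_def F_w)
  qed
  have ex_near: "\<exists>x. norm x \<le> 1 \<and> M - 1 / real (Suc n) < F x" for n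
    using less_cSUP_iff[OF _ bdd, of "M - 1 / real (Suc n)"] by (auto simp: M_def)
  then obtain a where a: "\<And>n. norm (a n) \<le> 1" "\<And>n. M - 1 / real (Suc n) < F (a n)" by metis
  have aM: "(\<lambda>n. F (a n)) \<longlonglongrightarrow> M"
  proof (rule tendsto_sandwich)
    have "(\<lambda>n. M - 1 / real (Suc n)) \<longlonglongrightarrow> M - 0"
      by (intro tendsto_diff tendsto_const lim_1_over_n[THEN LIMSEQ_Suc])
    then show "(\<lambda>n. M - 1 / real (Suc n)) \<longlonglongrightarrow> M" by simp
    show "(\<lambda>n. M) \<longlonglongrightarrow> M" by simp
  qed (use a F_le in \<open>auto intro!: always_eventually less_imp_le\<close>)
  have ev_near: "\<forall>\<^sub>F n in sequentially. s n \<in> ?near g \<alpha>"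
    if s: "\<And>n. norm (s n) \<le> 1" "(\<lambda>n. F (s n)) \<longlonglongrightarrow> M" and \<alpha>: "\<alpha> > 0" for s \<alpha>
  proof -
    have "\<forall>\<^sub>F n in sequentially. M - \<alpha> < F (s n)"
      by (rule order_tendstoD(1)[OF s(2)]) (use \<alpha> in simp)
    then show ?thesis by eventually_elim (use s(1) in \<open>simp add: near_iff\<close>)
  qed
  have "Cauchy (\<lambda>n. w (a n))"
  proof (rule metric_CauchyI)
    fix e :: real assume "e > 0"
    then obtain \<alpha> where \<alpha>: "\<alpha> > 0" "\<forall>x\<in>?near g \<alpha>. \<forall>y\<in>?near g \<alpha>. dist (w x) (w y) \<le> e / 2"
      using small[of "e / 2"] by auto
    then obtain N where "\<And>n. n \<ge> N \<Longrightarrow> a n \<in> ?near g \<alpha>"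
      using ev_near[OF a(1) aM \<alpha>(1)] by (auto simp: eventually_sequentially)
    then have "dist (w (a m)) (w (a n)) \<le> e / 2" if "m \<ge> N" "n \<ge> N" for m n
      using \<alpha>(2) that by blast
    then have "dist (w (a m)) (w (a n)) < e" if "m \<ge> N" "n \<ge> N" for m n
      by (rule le_less_trans[of _ "e / 2"]) (use that \<open>e > 0\<close> in auto)
    then show "\<exists>N. \<forall>m\<ge>N. \<forall>n\<ge>N. dist (w (a m)) (w (a n)) < e" by blast
  qed
  then obtain w0 where w0: "(\<lambda>n. w (a n)) \<longlonglongrightarrow> w0"
    using Cauchy_convergent by (auto simp: convergent_def)
  have w_lim: "(\<lambda>n. w (s n)) \<longlonglongrightarrow> w0"
    if s: "\<And>n. norm (s n) \<le> 1" "(\<lambda>n. F (s n)) \<longlonglongrightarrow> M" for s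
  proof (rule metric_LIMSEQ_I)
    fix e :: real assume e: "e > 0"
    then obtain \<alpha> where \<alpha>: "\<alpha> > 0" "\<forall>x\<in>?near g \<alpha>. \<forall>y\<in>?near g \<alpha>. dist (w x) (w y) \<le> e / 2"
      using small[of "e / 2"] by auto
    have le: "dist (w x) w0 \<le> e / 2" if x: "x \<in> ?near g \<alpha>" for x
    proof (rule tendsto_upperbound)
      show "(\<lambda>n. dist (w x) (w (a n))) \<longlonglongrightarrow> dist (w x) w0" by (intro tendsto_intros w0)
      show "\<forall>\<^sub>F n in sequentially. dist (w x) (w (a n)) \<le> e / 2"
        using ev_near[OF a(1) aM \<alpha>(1)] by eventually_elim (use \<alpha>(2) x in blast)
    qed simp
    have "\<forall>\<^sub>F n in sequentially. dist (w (s n)) w0 < e"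
      using ev_near[OF s \<alpha>(1)]
    proof eventually_elim
      case (elim n)
      from le[OF this] show ?case using e by linarith
    qed
    then show "\<exists>N. \<forall>n\<ge>N. dist (w (s n)) w0 < e" by (simp add: eventually_sequentially)
  qed
  \<comment> \<open>Consequently the norms of any maximizing sequence of \<open>F\<close> tend to
    1.\<close>
  have F_le_power: "F x \<le> M * norm x" if x: "norm x \<le> 1" for x
  proof (cases "x = 0")
    case True
    then show ?thesis using F_scale[of 0 x] k by (simp add: zero_power)
  next
    case False
    have "F x = norm x ^ k * F ((1 / norm x) *\<^sub>R x)"
      using F_scale[of "norm x" "(1 / norm x) *\<^sub>R x"] False by simp
    also have "\<dots> \<le> norm x ^ k * M" using False by (intro mult_left_mono F_le) auto
    also have "\<dots> \<le> norm x ^ 1 * M"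
      using x k M by (intro mult_right_mono power_decreasing) auto
    finally show ?thesis by (simp add: mult.commute)
  qed
  define x0 where "x0 = inverse (norm w0) *\<^sub>R w0"
  \<comment> \<open>The variational principle only yields convergence of \<open>w (s n)\<close>. As
    the norms of \<open>s n\<close> tend to 1, the weights \<open>u (s n)\<close> tend to
    \<open>norm w0\<close>; once this is nonzero, dividing by the weights recovers
    \<open>s n\<close>.\<close>
  have lim: "s \<longlonglongrightarrow> x0 \<and> w0 \<noteq> 0"
    if s: "\<And>n. norm (s n) \<le> 1" "(\<lambda>n. F (s n)) \<longlonglongrightarrow> M" for s
  proof -
    have norm_lim: "(\<lambda>n. norm (s n)) \<longlonglongrightarrow> 1"
    proof (rule tendsto_sandwich)
      have "(\<lambda>n. F (s n) / M) \<longlonglongrightarrow> M / M" using M by (intro tendsto_divide s tendsto_const) simp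
      then show "(\<lambda>n. F (s n) / M) \<longlonglongrightarrow> 1" using M by simp
      show "\<forall>\<^sub>F n in sequentially. F (s n) / M \<le> norm (s n)"
        using F_le_power[OF s(1)] M by (intro always_eventually) (simp add: field_simps)
      show "(\<lambda>n. 1) \<longlonglongrightarrow> (1 :: real)" by simp
    qed (use s in \<open>auto intro!: always_eventually\<close>)
    have "(\<lambda>n. u (s n) - norm (w (s n))) \<longlonglongrightarrow> 0"
    proof (rule Lim_null_comparison)
      have "(\<lambda>n. 1 - norm (s n)) \<longlonglongrightarrow> 1 - 1" by (intro tendsto_intros norm_lim)
      then show "(\<lambda>n. 1 - norm (s n)) \<longlonglongrightarrow> 0" by simp
      have "norm (u (s n) - norm (w (s n))) \<le> 1 - norm (s n)" for n
      proof -
        have "u (s n) - norm (w (s n)) = u (s n) * (1 - norm (s n))"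
          using u0 by (simp add: w_def algebra_simps)
        then show ?thesis
          using s(1)[of n] u0[of "s n"] u1[OF s(1), of n]
          by (simp add: abs_mult mult_left_le_one_le)
      qed
      then show "\<forall>\<^sub>F n in sequentially. norm (u (s n) - norm (w (s n))) \<le> 1 - norm (s n)" by simp
    qed
    then have "(\<lambda>n. (u (s n) - norm (w (s n))) + norm (w (s n))) \<longlonglongrightarrow> 0 + norm w0"
      by (intro tendsto_add tendsto_norm w_lim s)
    then have u_lim: "(\<lambda>n. u (s n)) \<longlonglongrightarrow> norm w0" by simp
    \<comment> \<open>This is where \<open>M > 1\<close> excludes vanishing weights: the unperturbed
      part is at most 1, so the excess has to come from the weighted term.\<close>
    have "M - 1 \<le> norm w0 * (2 * \<epsilon>)"
    proof (rule tendsto_le)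
      show "(\<lambda>n. u (s n) * (2 * \<epsilon>)) \<longlonglongrightarrow> norm w0 * (2 * \<epsilon>)" by (intro tendsto_intros u_lim)
      show "(\<lambda>n. F (s n) - 1) \<longlonglongrightarrow> M - 1" by (intro tendsto_intros s)
      show "\<forall>\<^sub>F n in sequentially. F (s n) - 1 \<le> u (s n) * (2 * \<epsilon>)"
      proof (intro always_eventually allI)
        fix n
        have "u (s n) * g (s n) \<le> u (s n) * (2 * \<epsilon>)"
          by (intro mult_left_mono g_le s u0)
        then show "F (s n) - 1 \<le> u (s n) * (2 * \<epsilon>)" using Q_le[OF s(1), of n] by (simp add: F_def)
      qed
    qed simp
    then have w0_ne: "norm w0 \<noteq> 0" using M by auto
    have "(\<lambda>n. inverse (u (s n)) *\<^sub>R w (s n)) \<longlonglongrightarrow> x0"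
      unfolding x0_def by (intro tendsto_scaleR tendsto_inverse u_lim w_lim s w0_ne)
    moreover have "\<forall>\<^sub>F n in sequentially. inverse (u (s n)) *\<^sub>R w (s n) = s n"
      using tendsto_imp_eventually_ne[OF u_lim w0_ne] by eventually_elim (simp add: w_def)
    ultimately have "s \<longlonglongrightarrow> x0" by (rule Lim_transform_eventually)
    with w0_ne show ?thesis by simp
  qed
  have w0_ne: "w0 \<noteq> 0" and a_lim: "a \<longlonglongrightarrow> x0" using lim[OF a(1) aM] by simp_all
  then have x0: "norm x0 = 1" by (simp add: x0_def)
  have "(\<lambda>n. F (a n)) \<longlonglongrightarrow> F x0"
    by (rule continuous_on_tendsto_compose[OF F_cont a_lim]) auto
  then have F_x0: "F x0 = M" using aM LIMSEQ_unique by blast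
  have rotate: "\<exists>\<beta>. norm \<beta> = 1 \<and> F (scaleX \<beta> x) = H x" for x
  proof -
    obtain \<beta> where \<beta>: "norm \<beta> = 1" "\<beta> * blinfun_apply G x = of_real (norm (blinfun_apply G x))"
      using unimodular_rotation by blast
    have "g (scaleX \<beta> x) = norm (blinfun_apply G x)" unfolding G(2)[symmetric] by (simp add: G_scale \<beta>)
    then have "F (scaleX \<beta> x) = H x"
      by (simp add: F_def H_def u_scale Qhom norm_scale norm_power \<beta>(1))
    with \<beta>(1) show ?thesis by blast
  qed
  have H_le: "H x \<le> M" if "norm x \<le> 1" for x
    using rotate[of x] F_le that by (metis mult_1 norm_scale)
  \<comment> \<open>With \<open>y\<close> parallel to \<open>Q x0\<close> (any unit vector if this
    is 0) and \<open>c\<close> rotating \<open>p x0\<close> to a nonnegative real, the two summands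
    of \<open>Q' x0\<close> are aligned and their norms add up to \<open>H x0\<close>.\<close>
  obtain y where y: "norm y = 1" "Q x0 = norm (Q x0) *\<^sub>R y"
  proof (cases "Q x0 = 0")
    case True
    then show ?thesis using that[of x0] x0 by simp
  next
    case False
    then show ?thesis using that[of "(1 / norm (Q x0)) *\<^sub>R Q x0"] by simp
  qed
  define p where "p x = blinfun_apply f x ^ (k - 1) * blinfun_apply G x" for x
  have norm_p: "norm (p x) = u x * norm (blinfun_apply G x)" for x
    by (simp add: p_def u_def norm_mult norm_power)
  obtain c where c: "norm c = 1" "c * p x0 = of_real (norm (p x0))"
    using unimodular_rotation by blast
  define Q' where "Q' x = Q x + scaleX (c * p x) y" for x
  have "p \<in> hom_polys scaleX (*) k"
    unfolding p_def[abs_def] using f G(1) k by (intro hom_polys_power_times) (auto simp: dual_ball_def)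
  then have Q': "Q' \<in> hom_polys scaleX scaleX k"
    unfolding Q'_def[abs_def] by (intro hom_polys_add[OF X X Q] hom_polys_times_vector)
  have diff: "norm (Q' x - Q x) = u x * norm (blinfun_apply G x)" for x
    by (simp add: Q'_def norm_scale norm_mult c(1) y(1) norm_p)
  have Q'_le: "norm (Q' x) \<le> H x" for x
    using norm_triangle_ineq[of "Q x" "Q' x - Q x"] diff[of x] by (simp add: H_def)
  have "Q' x0 = (norm (Q x0) + norm (p x0)) *\<^sub>R y"
    unfolding Q'_def c(2) by (subst y(2)) (simp add: scale_of_real scaleR_add_left)
  then have "norm (Q' x0) = H x0" by (simp add: y(1) norm_p H_def u0)
  then have Q'_x0: "norm (Q' x0) = M" using FH[of x0] F_x0 H_le[of x0] x0 by simp
  have Q'Cb: "Q' \<in> Cb" by (rule hom_polys_Cb[OF X X Q' k])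
  have norm_Q': "ball_norm Q' = M"
  proof (rule antisym)
    show "ball_norm Q' \<le> M" using Q'_le H_le by (intro ball_norm_least) (blast intro: order_trans)
    show "M \<le> ball_norm Q'" using ball_norm_upper[OF Q'Cb, of x0] Q'_x0 x0 by simp
  qed
  have "strongly_attains_at scaleX Q' x0"
    unfolding strongly_attains_at_def
  proof (intro conjI allI impI Q'Cb)
    show "\<exists>x\<in>cball 0 1. Q' x \<noteq> 0" using Q'_x0 M x0 by (intro bexI[of _ x0]) auto
    show "x0 \<in> cball 0 1" using x0 by simp
    fix s :: "nat \<Rightarrow> 'a"
    assume "\<forall>n. s n \<in> cball 0 1" and s_lim: "(\<lambda>n. norm (Q' (s n))) \<longlonglongrightarrow> ball_norm Q'"
    then have s: "norm (s n) \<le> 1" for n by simp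
    \<comment> \<open>Along a maximizing sequence of \<open>Q'\<close> also \<open>H\<close> tends
      to \<open>M\<close>. Rotating each point turns \<open>H\<close> into \<open>F\<close>, so the
      rotated sequence converges to \<open>x0\<close>; a convergent subsequence of the rotations
      then undoes the rotation.\<close>
    have "\<forall>n. \<exists>\<beta>. norm \<beta> = 1 \<and> F (scaleX \<beta> (s n)) = H (s n)" by (intro allI rotate)
    then have "\<exists>\<beta>. \<forall>n. norm (\<beta> n) = 1 \<and> F (scaleX (\<beta> n) (s n)) = H (s n)" by (rule choice)
    then obtain \<beta> where \<beta>: "\<And>n. norm (\<beta> n) = 1" "\<And>n. F (scaleX (\<beta> n) (s n)) = H (s n)" by blast
    have "(\<lambda>n. H (s n)) \<longlonglongrightarrow> M"
    proof (rule tendsto_sandwich)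
      show "(\<lambda>n. norm (Q' (s n))) \<longlonglongrightarrow> M" using s_lim norm_Q' by simp
      show "(\<lambda>n. M) \<longlonglongrightarrow> M" by simp
    qed (use Q'_le H_le[OF s] in \<open>auto intro!: always_eventually\<close>)
    then have \<beta>s: "(\<lambda>n. scaleX (\<beta> n) (s n)) \<longlonglongrightarrow> x0"
      using lim[of "\<lambda>n. scaleX (\<beta> n) (s n)"] s by (simp add: \<beta> norm_scale)
    have "\<forall>n. \<beta> n \<in> sphere 0 1" by (simp add: \<beta>)
    then obtain b r where b: "b \<in> sphere 0 1" "strict_mono r" "(\<beta> \<circ> r) \<longlonglongrightarrow> b"
      using compact_scalar_sphere[where 'k = 'k] unfolding compact_def by metis
    then have b0: "b \<noteq> 0" by auto
    have "(\<lambda>n. scaleX (inverse ((\<beta> \<circ> r) n)) (scaleX (\<beta> (r n)) (s (r n)))) \<longlonglongrightarrow> scaleX (inverse b) x0"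
      by (intro bounded_bilinear.tendsto[OF bounded_bilinear_scale] tendsto_inverse b b0
          LIMSEQ_subseq_LIMSEQ[OF \<beta>s b(2), unfolded o_def])
    moreover have "\<beta> n \<noteq> 0" for n using \<beta>(1)[of n] by auto
    ultimately have "(s \<circ> r) \<longlonglongrightarrow> scaleX (inverse b) x0" by (simp add: o_def)
    moreover have "norm (inverse b) = 1" using b(1) by (simp add: norm_inverse)
    ultimately show "\<exists>r \<alpha>. strict_mono r \<and> norm \<alpha> = 1 \<and> (s \<circ> r) \<longlonglongrightarrow> scaleX \<alpha> x0"
      using b(2) by blast
  qed
  moreover have "norm (Q' x - Q x) \<le> 2 * \<epsilon>" if "norm x \<le> 1" for x
    using mult_mono[OF u1[OF that] G_le[OF that]] by (simp add: diff)
  moreover have "norm (Q' x0) = ball_norm Q'" by (simp add: Q'_x0 norm_Q')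
  ultimately show ?thesis using x0 by (intro bexI[OF _ Q'] exI[of _ x0] conjI allI impI)
qed

subsection \<open>The polynomial numerical index\<close>

lemma strongly_attains_norm:
  fixes f :: "'a::real_normed_vector \<Rightarrow> 'k::real_or_complex"
  assumes X: "normed_space_over scaleX" and f: "f \<in> hom_polys scaleX (*) k" and k: "k > 0"
    and sa: "strongly_attains_at scaleX f x0"
  shows "0 < ball_norm f"
proof -
  from sa obtain x where "norm x \<le> 1" "f x \<noteq> 0" by (auto simp: strongly_attains_at_def)
  then show ?thesis
    using ball_norm_upper[OF hom_polys_Cb[OF X normed_space_over_scalars f k], of x]
    by (meson less_le_trans zero_less_norm_iff)
qed

context normed_space_over
begin

context
  fixes k :: nat
  assumes k: "k > 0" and nontrivial: "\<exists>x::'a. x \<noteq> 0"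
begin

lemma unit_vector: "\<exists>e::'a. norm e = 1"
  using nontrivial norm_sgn by metis

lemma state_pairs_nonempty: "state_pairs scaleX \<noteq> {}"
proof -
  obtain e :: 'a where e: "norm e = 1" using unit_vector by blast
  obtain xs where xs: "xs \<in> ext_points (dual_ball scaleX)" "blinfun_apply xs e = of_real (norm e)"
    using ext_point_norming by blast
  then have db: "xs \<in> dual_ball scaleX" using ext_points_subset by blast
  have "1 \<le> norm xs" using norm_blinfun[of xs e] xs(2) e by simp
  moreover have "norm xs \<le> 1" using db by (simp add: dual_ball_def)
  ultimately have "(e, xs) \<in> state_pairs scaleX" using xs e db by (simp add: state_pairs_def)
  then show ?thesis by blast
qed

lemma numerical_radius_terms_le:
  assumes P: "P \<in> hom_polys scaleX scaleX k" and p: "(x, xs) \<in> state_pairs scaleX"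
  shows "norm (blinfun_apply xs (P x)) \<le> ball_norm P"
proof -
  have xs: "xs \<in> dual_ball scaleX" and x: "norm x = 1" using p by (auto simp: state_pairs_def)
  have "norm (blinfun_apply xs (P x)) \<le> norm (P x)" by (rule dual_ball_norm_le[OF xs])
  also have "\<dots> \<le> ball_norm P"
    using x hom_polys_Cb[OF normed_space_over_axioms normed_space_over_axioms P k]
    by (intro ball_norm_upper) simp_all
  finally show ?thesis .
qed

lemma numerical_radius_upper:
  assumes P: "P \<in> hom_polys scaleX scaleX k" and p: "(x, xs) \<in> state_pairs scaleX"
  shows "norm (blinfun_apply xs (P x)) \<le> numerical_radius scaleX P"
proof -
  have "bdd_above ((\<lambda>(x, xs). norm (blinfun_apply xs (P x))) ` state_pairs scaleX)"
    by (rule bdd_aboveI2[of _ _ "ball_norm P"]) (use numerical_radius_terms_le[OF P] in auto)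
  from cSUP_upper[OF p this] show ?thesis by (simp add: numerical_radius_def)
qed

lemma numerical_radius_le_ball_norm:
  assumes P: "P \<in> hom_polys scaleX scaleX k"
  shows "numerical_radius scaleX P \<le> ball_norm P"
  unfolding numerical_radius_def
  by (rule cSUP_least[OF state_pairs_nonempty]) (use numerical_radius_terms_le[OF P] in auto)

lemma numerical_radius_nonneg:
  assumes P: "P \<in> hom_polys scaleX scaleX k"
  shows "0 \<le> numerical_radius scaleX P"
  using state_pairs_nonempty numerical_radius_upper[OF P] norm_ge_zero order_trans
  by (metis all_not_in_conv surj_pair)

lemma less_numerical_radiusD:
  assumes "c < numerical_radius scaleX P"
  shows "\<exists>x xs. (x, xs) \<in> state_pairs scaleX \<and> c < norm (blinfun_apply xs (P x))"
proof (rule ccontr)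
  assume "\<not> ?thesis"
  then have "numerical_radius scaleX P \<le> c"
    unfolding numerical_radius_def
    by (intro cSUP_least[OF state_pairs_nonempty]) (auto simp: not_less)
  with assms show False by simp
qed

text \<open>The infimum defining the index has to range over a nonempty set; the witness is the
  \<open>k\<close>-th power of a norming functional times a unit vector.\<close>

lemma hom_polys_unit_exists: "\<exists>P\<in>hom_polys scaleX scaleX k. ball_norm P = 1"
proof -
  obtain e :: 'a where e: "norm e = 1" using unit_vector by blast
  obtain xs where xs: "xs \<in> ext_points (dual_ball scaleX)" "blinfun_apply xs e = of_real (norm e)"
    using ext_point_norming by blast
  then have db: "xs \<in> dual_ball scaleX" using ext_points_subset by blast
  define P where "P x = scaleX (1 * (blinfun_apply xs x ^ (k - 1) * blinfun_apply xs x)) e" for x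
  have P: "P \<in> hom_polys scaleX scaleX k"
    unfolding P_def[abs_def]
    by (intro hom_polys_times_vector hom_polys_power_times k) (use db in \<open>auto simp: dual_ball_def\<close>)
  have norm_P: "norm (P x) = norm (blinfun_apply xs x) ^ (k - 1) * norm (blinfun_apply xs x)" for x
    by (simp add: P_def norm_scale e norm_mult norm_power)
  have "ball_norm P = 1"
  proof (rule antisym)
    show "ball_norm P \<le> 1"
    proof (rule ball_norm_least)
      fix x :: 'a assume "norm x \<le> 1"
      then have "norm (blinfun_apply xs x) \<le> 1" using dual_ball_norm_le[OF db, of x] by linarith
      then show "norm (P x) \<le> 1" unfolding norm_P by (simp add: mult_le_one power_le_one)
    qed
    show "1 \<le> ball_norm P"
      using ball_norm_upper[OF hom_polys_Cb[OF normed_space_over_axioms normed_space_over_axioms P k], of e]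
      by (simp add: norm_P xs(2) e)
  qed
  with P show ?thesis by blast
qed

lemma poly_num_index_eq_1_iff:
  "poly_num_index k scaleX = 1 \<longleftrightarrow>
    (\<forall>P\<in>hom_polys scaleX scaleX k. ball_norm P = 1 \<longrightarrow> 1 \<le> numerical_radius scaleX P)"
proof
  assume index: "poly_num_index k scaleX = 1"
  have bdd: "bdd_below (numerical_radius scaleX ` {P \<in> hom_polys scaleX scaleX k. ball_norm P = 1})"
    by (rule bdd_belowI2[of _ 0]) (simp add: numerical_radius_nonneg)
  show "\<forall>P\<in>hom_polys scaleX scaleX k. ball_norm P = 1 \<longrightarrow> 1 \<le> numerical_radius scaleX P"
    using cINF_lower[OF bdd] index by (auto simp: poly_num_index_def)
next
  assume "\<forall>P\<in>hom_polys scaleX scaleX k. ball_norm P = 1 \<longrightarrow> 1 \<le> numerical_radius scaleX P"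
  then have "numerical_radius scaleX P = 1" if "P \<in> hom_polys scaleX scaleX k" "ball_norm P = 1" for P
    using numerical_radius_le_ball_norm[OF that(1)] that by force
  then have "numerical_radius scaleX ` {P \<in> hom_polys scaleX scaleX k. ball_norm P = 1} = {1}"
    using hom_polys_unit_exists by (force simp: image_iff)
  then show "poly_num_index k scaleX = 1" by (simp add: poly_num_index_def)
qed

text \<open>For \<open>Q = (f / N) \<otimes> z'\<close> the value of a state is a product of two
  factors of modulus at most 1, and nearly attaining the radius forces both towards 1. The factor
  with \<open>f\<close> yields a maximizing sequence, hence points near a rotation of
  \<open>x0\<close>, at which their states have value 1; the other factor makes the states almost
  norm \<open>z'\<close>.\<close>

lemma peak_point_almost_norming:
  assumes index: "poly_num_index k scaleX = 1"
    and f: "f \<in> hom_polys scaleX (*) k" and sa: "strongly_attains_at scaleX f x0"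
    and \<epsilon>: "\<epsilon> > 0" and \<eta>: "\<eta> > 0"
  shows "\<exists>ys\<in>dual_ball scaleX. \<exists>\<alpha>. norm \<alpha> = 1 \<and> norm z - \<epsilon> \<le> real_part (blinfun_apply ys z) \<and>
    norm (\<alpha> * blinfun_apply ys x0 - 1) < \<eta>"
proof -
  note X = normed_space_over_axioms
  have fCb: "f \<in> Cb" by (rule hom_polys_Cb[OF X normed_space_over_scalars f k])
  define N where "N = ball_norm f"
  have N: "N > 0" unfolding N_def by (rule strongly_attains_norm[OF X f k sa])
  obtain z' where z': "norm z' = 1" "z = norm z *\<^sub>R z'"
  proof (cases "z = 0")
    case True
    then show ?thesis using that unit_vector by auto
  next
    case False
    then show ?thesis using that[of "(1 / norm z) *\<^sub>R z"] by simp
  qed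
  define Q where "Q x = scaleX (of_real (1 / N) * f x) z'" for x
  have Q: "Q \<in> hom_polys scaleX scaleX k"
    unfolding Q_def[abs_def] by (rule hom_polys_times_vector[OF f])
  have norm_Q: "norm (Q x) = norm (f x) / N" for x
    using N by (simp add: Q_def norm_scale norm_mult norm_divide z'(1) del: of_real_divide)
  have "ball_norm Q = 1"
  proof (rule antisym)
    show "ball_norm Q \<le> 1"
      using ball_norm_upper[OF fCb] N by (intro ball_norm_least) (simp add: norm_Q N_def)
    show "1 \<le> ball_norm Q"
    proof (rule ccontr)
      assume "\<not> 1 \<le> ball_norm Q"
      then have "N * ball_norm Q < ball_norm f" using N by (simp add: N_def)
      then obtain x where x: "norm x \<le> 1" "N * ball_norm Q < norm (f x)"
        using less_ball_normD by blast
      have "norm (Q x) \<le> ball_norm Q" by (rule ball_norm_upper[OF hom_polys_Cb[OF X X Q k] x(1)])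
      then show False using x(2) N by (simp add: norm_Q field_simps)
    qed
  qed
  then have radius: "1 \<le> numerical_radius scaleX Q"
    using index Q by (simp add: poly_num_index_eq_1_iff)
  have "\<exists>x xs. (x, xs) \<in> state_pairs scaleX \<and>
      1 - 1 / real (Suc n) < norm (blinfun_apply xs (Q x))" for n
  proof -
    have "1 - 1 / real (Suc n) < 1" by simp
    then show ?thesis using radius by (intro less_numerical_radiusD) linarith
  qed
  then obtain x xs where p: "\<And>n. (x n, xs n) \<in> state_pairs scaleX"
    and gt: "\<And>n. 1 - 1 / real (Suc n) < norm (blinfun_apply (xs n) (Q (x n)))" by metis
  have x: "norm (x n) = 1" and xs: "xs n \<in> dual_ball scaleX"
    and xsx: "blinfun_apply (xs n) (x n) = 1" for n
    using p[of n] by (auto simp: state_pairs_def)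
  have eq: "norm (blinfun_apply (xs n) (Q (x n))) =
      norm (f (x n)) / N * norm (blinfun_apply (xs n) z')" for n
    using N by (simp add: Q_def dual_ball_scale[OF xs] norm_mult norm_divide del: of_real_divide)
  have f_le: "norm (f (x n)) / N \<le> 1" for n
    using ball_norm_upper[OF fCb, of "x n"] x[of n] N by (simp add: N_def)
  have z_le: "norm (blinfun_apply (xs n) z') \<le> 1" for n
    using dual_ball_norm_le[OF xs, of n z'] z'(1) by simp
  have z_gt: "1 - 1 / real (Suc n) < norm (blinfun_apply (xs n) z')" for n
  proof -
    have "norm (f (x n)) / N * norm (blinfun_apply (xs n) z') \<le> 1 * norm (blinfun_apply (xs n) z')"
      by (intro mult_right_mono f_le) simp
    then show ?thesis using gt[of n] eq[of n] by linarith
  qed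
  have f_gt: "1 - 1 / real (Suc n) < norm (f (x n)) / N" for n
  proof -
    have "norm (f (x n)) / N * norm (blinfun_apply (xs n) z') \<le> norm (f (x n)) / N * 1"
      using N by (intro mult_left_mono z_le) simp
    then show ?thesis using gt[of n] eq[of n] by linarith
  qed
  have "(\<lambda>n. norm (f (x n)) / N) \<longlonglongrightarrow> 1"
  proof (rule tendsto_sandwich)
    have "(\<lambda>n. 1 - 1 / real (Suc n)) \<longlonglongrightarrow> 1 - 0"
      by (intro tendsto_diff tendsto_const lim_1_over_n[THEN LIMSEQ_Suc])
    then show "(\<lambda>n. 1 - 1 / real (Suc n)) \<longlonglongrightarrow> 1" by simp
    show "(\<lambda>n. 1) \<longlonglongrightarrow> (1 :: real)" by simp
  qed (use f_le f_gt in \<open>auto intro!: always_eventually less_imp_le\<close>)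
  then have "(\<lambda>n. norm (f (x n)) / N * N) \<longlonglongrightarrow> 1 * N" by (intro tendsto_mult tendsto_const)
  then have "(\<lambda>n. norm (f (x n))) \<longlonglongrightarrow> ball_norm f" using N by (simp add: N_def)
  moreover have "\<forall>n. x n \<in> cball 0 1" by (simp add: x)
  ultimately obtain r \<alpha> where r: "strict_mono r" and \<alpha>: "norm \<alpha> = 1"
    and lim: "(x \<circ> r) \<longlonglongrightarrow> scaleX \<alpha> x0"
    using sa unfolding strongly_attains_at_def by blast
  have "\<forall>\<^sub>F n in sequentially. dist ((x \<circ> r) n) (scaleX \<alpha> x0) < \<eta>"
    using lim \<eta> by (rule tendstoD)
  \<comment> \<open>An index of at least \<open>m\<close> makes
    \<open>norm z / real (Suc (r n))\<close> at most \<epsilon>, the allowed loss in norming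
    \<open>z\<close>.\<close>
  moreover obtain m where m: "norm z < real m * \<epsilon>" using ex_less_of_nat_mult[OF \<epsilon>] by blast
  ultimately have "\<forall>\<^sub>F n in sequentially. dist ((x \<circ> r) n) (scaleX \<alpha> x0) < \<eta> \<and> m \<le> n"
    using eventually_ge_at_top[of m] by (simp add: eventually_conj)
  then obtain n where n: "dist (x (r n)) (scaleX \<alpha> x0) < \<eta>" "m \<le> n"
    unfolding eventually_sequentially by auto
  have "m \<le> r n" using n(2) seq_suble[OF r, of n] by simp
  let ?xs = "xs (r n)"
  obtain \<beta> where \<beta>: "norm \<beta> = 1" "\<beta> * blinfun_apply ?xs z' = of_real (norm (blinfun_apply ?xs z'))"
    using unimodular_rotation by blast
  obtain ys where ys: "ys \<in> dual_ball scaleX" "\<And>x. blinfun_apply ys x = \<beta> * blinfun_apply ?xs x"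
    using dual_ball_rotate[OF xs \<beta>(1)] by blast
  have "norm z - \<epsilon> \<le> real_part (blinfun_apply ys z)"
  proof -
    have "real m * \<epsilon> \<le> real (Suc (r n)) * \<epsilon>"
      using \<open>m \<le> r n\<close> \<epsilon> by (intro mult_right_mono) auto
    then have "norm z \<le> real (Suc (r n)) * \<epsilon>" using m by linarith
    then have "norm z * (1 / real (Suc (r n))) \<le> \<epsilon>" by (simp add: field_simps)
    moreover have "norm z * (1 - 1 / real (Suc (r n))) \<le> norm z * norm (blinfun_apply ?xs z')"
      using z_gt[of "r n"] by (intro mult_left_mono) auto
    moreover have "real_part (blinfun_apply ys z) = norm z * norm (blinfun_apply ?xs z')"
      by (subst z'(2)) (simp add: blinfun.scaleR_right real_part_scaleR ys(2) \<beta>(2))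
    ultimately show ?thesis by (simp add: right_diff_distrib)
  qed
  moreover have "norm ((\<alpha> / \<beta>) * blinfun_apply ys x0 - 1) < \<eta>"
  proof -
    have "\<beta> \<noteq> 0" using \<beta>(1) by auto
    then have "(\<alpha> / \<beta>) * blinfun_apply ys x0 - 1 = blinfun_apply ?xs (scaleX \<alpha> x0 - x (r n))"
      by (simp add: ys(2) dual_ball_scale[OF xs] blinfun.diff_right xsx)
    also have "norm \<dots> \<le> norm (scaleX \<alpha> x0 - x (r n))" by (rule dual_ball_norm_le[OF xs])
    finally show ?thesis using n(1) by (simp add: dist_norm norm_minus_commute)
  qed
  moreover have "norm (\<alpha> / \<beta>) = 1" by (simp add: norm_divide \<alpha> \<beta>(1))
  ultimately show ?thesis using ys(1) by blast
qed

lemma ext_point_unimodular_at_peak_point: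
  assumes index: "poly_num_index k scaleX = 1"
    and x0: "x0 \<in> rho_tilde scaleX (hom_polys scaleX ((*) :: 'k \<Rightarrow> 'k \<Rightarrow> 'k) k)"
    and xs: "xs \<in> ext_points (dual_ball scaleX)"
  shows "norm (blinfun_apply xs x0) = 1"
proof (rule antisym)
  obtain f :: "'a \<Rightarrow> 'k" where f: "f \<in> hom_polys scaleX (*) k" and sa: "strongly_attains_at scaleX f x0"
    using x0 by (auto simp: rho_tilde_def)
  have x0_le: "norm x0 \<le> 1" using sa by (simp add: strongly_attains_at_def)
  have xs_db: "xs \<in> dual_ball scaleX" using xs ext_points_subset by blast
  show "norm (blinfun_apply xs x0) \<le> 1" using dual_ball_norm_le[OF xs_db, of x0] x0_le by simp
  show "1 \<le> norm (blinfun_apply xs x0)"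
  proof (rule field_le_epsilon)
    fix \<epsilon> :: real assume \<epsilon>: "\<epsilon> > 0"
    \<comment> \<open>The rotation supplied by the previous lemma varies with the vector to be
      normed. A finite net of the scalar sphere replaces it by finitely many test vectors
      \<open>scaleX \<theta> x0\<close>, as Milman's argument demands.\<close>
    obtain \<Theta> :: "'k set" where \<Theta>: "finite \<Theta>" "\<Theta> \<subseteq> sphere 0 1"
      "sphere 0 1 \<subseteq> (\<Union>\<theta>\<in>\<Theta>. ball \<theta> (\<epsilon> / 2))"
      using compactE_image[OF compact_scalar_sphere[where 'k = 'k], of "sphere 0 1" "\<lambda>\<theta>. ball \<theta> (\<epsilon> / 2)"]
        half_gt_zero[OF \<epsilon>] by (metis (no_types, lifting) UN_iff centre_in_ball open_ball subsetI)
    let ?f = "\<lambda>x. real_part (blinfun_apply xs x)"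
    have "\<exists>v\<in>(\<lambda>\<theta>. scaleX \<theta> x0) ` \<Theta>. 1 - \<epsilon> \<le> ?f v"
    proof (rule extreme_minorant_mem_norming[OF extreme_minorant_of_ext_point[OF xs]])
      show "finite ((\<lambda>\<theta>. scaleX \<theta> x0) ` \<Theta>)" using \<Theta> by simp
      fix z :: 'a and \<delta> :: real assume "\<delta> > 0"
      then obtain ys \<alpha> where ys: "ys \<in> dual_ball scaleX" "norm z - \<delta> \<le> real_part (blinfun_apply ys z)"
        and \<alpha>: "norm \<alpha> = 1" "norm (\<alpha> * blinfun_apply ys x0 - 1) < \<epsilon> / 2"
        using peak_point_almost_norming[OF index f sa, of \<delta> "\<epsilon> / 2" z] \<epsilon> by auto
      have "\<alpha> \<in> (\<Union>\<theta>\<in>\<Theta>. ball \<theta> (\<epsilon> / 2))" using \<alpha>(1) \<Theta>(3) by (intro subsetD[OF \<Theta>(3)]) simp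
      then obtain \<theta> where \<theta>: "\<theta> \<in> \<Theta>" "norm (\<theta> - \<alpha>) < \<epsilon> / 2" by (auto simp: dist_norm)
      have "norm (blinfun_apply ys x0) \<le> 1" using dual_ball_norm_le[OF ys(1), of x0] x0_le by simp
      then have "norm ((\<theta> - \<alpha>) * blinfun_apply ys x0) \<le> norm (\<theta> - \<alpha>)"
        by (simp add: norm_mult mult_left_le)
      moreover have "norm (\<theta> * blinfun_apply ys x0 - 1) \<le>
          norm ((\<theta> - \<alpha>) * blinfun_apply ys x0) + norm (\<alpha> * blinfun_apply ys x0 - 1)"
        using norm_triangle_ineq[of "(\<theta> - \<alpha>) * blinfun_apply ys x0" "\<alpha> * blinfun_apply ys x0 - 1"]
        by (simp add: left_diff_distrib)
      ultimately have "norm (\<theta> * blinfun_apply ys x0 - 1) \<le> \<epsilon>"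
        using \<theta>(2) \<alpha>(2) by linarith
      then have "\<bar>real_part (\<theta> * blinfun_apply ys x0) - 1\<bar> \<le> \<epsilon>"
        using real_part_abs_le_norm[of "\<theta> * blinfun_apply ys x0 - 1"]
        by (simp add: real_part_diff)
      then have "1 - \<epsilon> \<le> real_part (blinfun_apply ys (scaleX \<theta> x0))"
        by (simp add: dual_ball_scale[OF ys(1)])
      then show "\<exists>g. linear g \<and> (\<forall>x. g x \<le> norm x) \<and> norm z - \<delta> \<le> g z \<and>
          (\<exists>v\<in>(\<lambda>\<theta>. scaleX \<theta> x0) ` \<Theta>. 1 - \<epsilon> \<le> g v)"
        using real_part_dual_linear[OF ys(1)] real_part_dual_le[OF ys(1)] ys(2) \<theta>(1) by blast
    qed
    then obtain \<theta> where "norm \<theta> = 1" "1 - \<epsilon> \<le> real_part (\<theta> * blinfun_apply xs x0)"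
      using \<Theta>(2) by (auto simp: dual_ball_scale[OF xs_db])
    then show "1 \<le> norm (blinfun_apply xs x0) + \<epsilon>"
      using real_part_le_norm[of "\<theta> * blinfun_apply xs x0"] by (simp add: norm_mult)
  qed
qed

end

end

text \<open>A general norming set \<open>D\<close> serves both the extreme points and, in the
  separable case, the weak-* exposed points.\<close>

lemma poly_num_index_eq_1_if_norming:
  fixes scaleX :: "'k::real_or_complex \<Rightarrow> 'a::banach \<Rightarrow> 'a"
  assumes k: "k > 0" and X: "normed_space_over scaleX" and nontrivial: "\<exists>x::'a. x \<noteq> 0"
    and rn: "radon_nikodym scaleX"
    and D: "D \<subseteq> dual_ball scaleX"
    and norming: "\<And>y \<delta>. \<delta> > 0 \<Longrightarrow> \<exists>xs\<in>D. norm y - \<delta> \<le> norm (blinfun_apply xs y)"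
    and unimodular: "\<And>x xs. x \<in> rho_tilde scaleX (hom_polys scaleX ((*) :: 'k \<Rightarrow> 'k \<Rightarrow> 'k) k) \<Longrightarrow>
      xs \<in> D \<Longrightarrow> norm (blinfun_apply xs x) = 1"
  shows "poly_num_index k scaleX = 1"
proof -
  interpret normed_space_over scaleX by (rule X)
  have "1 \<le> numerical_radius scaleX Q" if Q: "Q \<in> hom_polys scaleX scaleX k" "ball_norm Q = 1" for Q
  proof (rule dense_le)
    fix c :: real assume "c < 1"
    \<comment> \<open>Five errors are spent: two for
      \<open>ball_norm Q' \<ge> 1 - 2 * \<epsilon>\<close>, one for almost norming
      \<open>Q' x0\<close>, and two for returning from \<open>Q'\<close> to \<open>Q\<close>. The
      bound \<open>1 / 3\<close> keeps \<open>ball_norm Q'\<close> positive.\<close>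
    define \<epsilon> where "\<epsilon> = min (1 / 3) ((1 - c) / 5)"
    have "\<epsilon> \<le> (1 - c) / 5" unfolding \<epsilon>_def by (rule min.cobounded2)
    then have \<epsilon>: "0 < \<epsilon>" "\<epsilon> < 1 / 2" "c \<le> 1 - 5 * \<epsilon>"
      using \<open>c < 1\<close> by (simp_all add: \<epsilon>_def)
    obtain Q' x0 where Q': "Q' \<in> hom_polys scaleX scaleX k"
      and close: "\<And>x. norm x \<le> 1 \<Longrightarrow> norm (Q' x - Q x) \<le> 2 * \<epsilon>"
      and x0: "norm x0 = 1" "norm (Q' x0) = ball_norm Q'"
      and sa: "strongly_attains_at scaleX Q' x0"
      using strongly_attaining_perturbation[OF X rn k Q, of \<epsilon>] \<epsilon> by auto
    have Q'Cb: "Q' \<in> Cb" by (rule hom_polys_Cb[OF X X Q' k])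
    have "1 \<le> ball_norm Q' + 2 * \<epsilon>"
    proof -
      have "norm (Q x) \<le> ball_norm Q' + 2 * \<epsilon>" if "norm x \<le> 1" for x
        using close[OF that] ball_norm_upper[OF Q'Cb that] norm_triangle_ineq2[of "Q x" "Q' x"]
        by (simp add: norm_minus_commute)
      then show ?thesis using ball_norm_least[of Q] Q(2) by metis
    qed
    then have pos: "ball_norm Q' > 0" using \<epsilon> by linarith
    obtain ys where "ys \<in> ext_points (dual_ball scaleX)"
      and ys_x0: "blinfun_apply ys (Q' x0) = of_real (norm (Q' x0))"
      using ext_point_norming by blast
    then have ys: "ys \<in> dual_ball scaleX" using ext_points_subset by blast
    \<comment> \<open>\<open>f\<close> is dominated by the norm of \<open>Q'\<close> and has the
      same supremum, so maximizing sequences of \<open>f\<close> are maximizing for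
      \<open>Q'\<close> and strong attainment is inherited.\<close>
    define f where "f x = blinfun_apply ys (Q' x)" for x
    have f: "f \<in> hom_polys scaleX (*) k"
      unfolding f_def[abs_def] by (rule hom_polys_dual_compose[OF Q' ys])
    have fCb: "f \<in> Cb" by (rule hom_polys_Cb[OF X normed_space_over_scalars f k])
    have f_le: "norm (f x) \<le> norm (Q' x)" for x unfolding f_def by (rule dual_ball_norm_le[OF ys])
    have f_x0: "norm (f x0) = ball_norm Q'" using pos by (simp add: f_def ys_x0 x0(2))
    have norm_f: "ball_norm f = ball_norm Q'"
    proof (rule antisym)
      show "ball_norm f \<le> ball_norm Q'"
        using f_le ball_norm_upper[OF Q'Cb] by (intro ball_norm_least) (blast intro: order_trans)
      show "ball_norm Q' \<le> ball_norm f" using ball_norm_upper[OF fCb, of x0] x0(1) f_x0 by simp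
    qed
    have "strongly_attains_at scaleX f x0"
      unfolding strongly_attains_at_def
    proof (intro conjI allI impI fCb)
      show "\<exists>x\<in>cball 0 1. f x \<noteq> 0" using f_x0 pos x0(1) by (intro bexI[of _ x0]) auto
      show "x0 \<in> cball 0 1" using x0(1) by simp
      fix s :: "nat \<Rightarrow> 'a"
      assume s: "\<forall>n. s n \<in> cball 0 1" and lim: "(\<lambda>n. norm (f (s n))) \<longlonglongrightarrow> ball_norm f"
      have "(\<lambda>n. norm (Q' (s n))) \<longlonglongrightarrow> ball_norm Q'"
      proof (rule tendsto_sandwich)
        show "(\<lambda>n. norm (f (s n))) \<longlonglongrightarrow> ball_norm Q'" using lim norm_f by simp
        show "(\<lambda>n. ball_norm Q') \<longlonglongrightarrow> ball_norm Q'" by simp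
      qed (use s f_le ball_norm_upper[OF Q'Cb] in \<open>auto intro!: always_eventually\<close>)
      then show "\<exists>r \<alpha>. strict_mono r \<and> norm \<alpha> = 1 \<and> (s \<circ> r) \<longlonglongrightarrow> scaleX \<alpha> x0"
        using sa s unfolding strongly_attains_at_def by blast
    qed
    then have peak: "x0 \<in> rho_tilde scaleX (hom_polys scaleX ((*) :: 'k \<Rightarrow> 'k \<Rightarrow> 'k) k)"
      using f by (auto simp: rho_tilde_def)
    obtain xs where xs: "xs \<in> D" "norm (Q' x0) - \<epsilon> \<le> norm (blinfun_apply xs (Q' x0))"
      using norming[OF \<epsilon>(1)] by blast
    then have xs_db: "xs \<in> dual_ball scaleX" using D by blast
    have xs1: "norm (blinfun_apply xs x0) = 1" by (rule unimodular[OF peak xs(1)])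
    obtain \<beta> where \<beta>: "norm \<beta> = 1" "\<beta> * blinfun_apply xs x0 = of_real (norm (blinfun_apply xs x0))"
      using unimodular_rotation by blast
    obtain zs where zs: "zs \<in> dual_ball scaleX" "\<And>x. blinfun_apply zs x = \<beta> * blinfun_apply xs x"
      using dual_ball_rotate[OF xs_db \<beta>(1)] by blast
    have zs1: "blinfun_apply zs x0 = 1" by (simp add: zs(2) \<beta>(2) xs1)
    then have "1 \<le> norm zs" using norm_blinfun[of zs x0] x0(1) by simp
    then have pair: "(x0, zs) \<in> state_pairs scaleX"
      using zs zs1 x0(1) by (simp add: state_pairs_def dual_ball_def)
    have "norm (blinfun_apply zs (Q' x0)) - norm (blinfun_apply zs (Q x0)) \<le>
        norm (blinfun_apply zs (Q' x0 - Q x0))"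
      using norm_triangle_ineq2 by (simp add: blinfun.diff_right)
    also have "\<dots> \<le> norm (Q' x0 - Q x0)" by (rule dual_ball_norm_le[OF zs(1)])
    also have "\<dots> \<le> 2 * \<epsilon>" using close[of x0] x0(1) by simp
    finally have "norm (blinfun_apply zs (Q' x0)) - 2 * \<epsilon> \<le> norm (blinfun_apply zs (Q x0))" by simp
    moreover have "norm (blinfun_apply zs (Q' x0)) = norm (blinfun_apply xs (Q' x0))"
      by (simp add: zs(2) norm_mult \<beta>(1))
    moreover have "norm (blinfun_apply zs (Q x0)) \<le> numerical_radius scaleX Q"
      by (rule numerical_radius_upper[OF k nontrivial Q(1) pair])
    ultimately show "c \<le> numerical_radius scaleX Q"
      using \<epsilon>(3) xs(2) x0(2) \<open>1 \<le> ball_norm Q' + 2 * \<epsilon>\<close> by linarith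
  qed
  then show ?thesis by (simp add: poly_num_index_eq_1_iff[OF k nontrivial])
qed

text \<open>At a smooth point \<open>z\<close> the norming functional is exposed by \<open>z\<close>
  divided by its norm; smooth points are dense, so \<open>z\<close> may be taken close to
  \<open>y\<close>.\<close>

lemma weak_star_exposed_norming:
  fixes scaleX :: "'k::real_or_complex \<Rightarrow> 'a::banach \<Rightarrow> 'a"
  assumes X: "normed_space_over scaleX" and nontrivial: "\<exists>x::'a. x \<noteq> 0"
    and sep: "separable_space (euclidean :: 'a topology)" and \<delta>: "\<delta> > 0"
  shows "\<exists>xs\<in>weak_star_exposed scaleX. norm y - \<delta> \<le> norm (blinfun_apply xs y)"
proof -
  interpret normed_space_over scaleX by (rule X)
  have nonzero: "\<exists>xs\<in>weak_star_exposed scaleX. norm y - \<delta> \<le> norm (blinfun_apply xs y)"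
    if y: "y \<noteq> 0" for y :: 'a
  proof -
    \<comment> \<open>Replacing \<open>y\<close> by \<open>z\<close> costs twice the distance, hence
      \<open>\<delta> / 2\<close>; a distance below \<open>norm y\<close> keeps \<open>z\<close>
      nonzero.\<close>
    obtain z where z: "dist z y < min (\<delta> / 2) (norm y)"
      and smooth: "\<And>f g. linear f \<Longrightarrow> linear g \<Longrightarrow> (\<And>x. f x \<le> norm x) \<Longrightarrow> (\<And>x. g x \<le> norm x) \<Longrightarrow>
        f z = norm z \<Longrightarrow> g z = norm z \<Longrightarrow> f = g"
      using dense_smooth_points[OF sep, of "min (\<delta> / 2) (norm y)" y] \<delta> y by auto
    have z0: "z \<noteq> 0" using z by auto
    obtain xs where "xs \<in> ext_points (dual_ball scaleX)" and xs_z: "blinfun_apply xs z = of_real (norm z)"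
      using ext_point_norming by blast
    then have xs: "xs \<in> dual_ball scaleX" using ext_points_subset by blast
    let ?x = "(1 / norm z) *\<^sub>R z"
    have xs_x: "blinfun_apply xs ?x = 1"
      using z0 by (simp add: blinfun.scaleR_right xs_z scaleR_conv_of_real)
    have uniq: "ys = xs" if ys: "ys \<in> dual_ball scaleX" "blinfun_apply ys ?x = 1" for ys
    proof -
      have "blinfun_apply ys z = norm z *\<^sub>R blinfun_apply ys ?x"
        using z0 by (simp add: blinfun.scaleR_right)
      then have ys_z: "blinfun_apply ys z = of_real (norm z)" using ys(2) by (simp add: of_real_def)
      have "(\<lambda>x. real_part (blinfun_apply ys x)) = (\<lambda>x. real_part (blinfun_apply xs x))"
        by (rule smooth) (use ys xs in \<open>simp_all add: real_part_dual_linear real_part_dual_le xs_z ys_z\<close>)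
      then show ?thesis
        using ys(1) xs by (intro dual_eq_if_real_part_eq) (auto simp: dual_ball_def dest: fun_cong)
    qed
    have "?x \<in> cball 0 1" using z0 by simp
    then have "xs \<in> weak_star_exposed scaleX"
      unfolding weak_star_exposed_def using xs xs_x uniq by blast
    moreover have "norm y - \<delta> \<le> norm (blinfun_apply xs y)"
    proof -
      have "norm (blinfun_apply xs z) - norm (blinfun_apply xs y) \<le> norm (blinfun_apply xs (z - y))"
        using norm_triangle_ineq2 by (simp add: blinfun.diff_right)
      also have "\<dots> \<le> norm (z - y)" by (rule dual_ball_norm_le[OF xs])
      finally have "norm z - norm (z - y) \<le> norm (blinfun_apply xs y)" by (simp add: xs_z)
      moreover have "norm y \<le> norm z + norm (z - y)"
        using norm_triangle_ineq2[of y z] by (simp add: norm_minus_commute)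
      ultimately show ?thesis using z by (simp add: dist_norm)
    qed
    ultimately show ?thesis by blast
  qed
  show ?thesis
  \<comment> \<open>At \<open>y = 0\<close> the inequality is trivial, but an exposed functional
    must exist; the nonzero case at another vector supplies one.\<close>
  proof (cases "y = 0")
    case True
    obtain e :: 'a where "e \<noteq> 0" using nontrivial by blast
    then obtain xs where "xs \<in> weak_star_exposed scaleX" using nonzero by blast
    then show ?thesis using True \<delta> by (intro bexI) (auto simp: blinfun.zero_right)
  next
    case False
    then show ?thesis by (rule nonzero)
  qed
qed

theorem theorem2p6:
  fixes k :: nat
    and scaleX :: "'k::real_or_complex \<Rightarrow> 'a::banach \<Rightarrow> 'a"
  assumes "k > 0"
    and "normed_space_over scaleX"
    and "\<exists>x::'a. x \<noteq> 0"
    and "radon_nikodym scaleX"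
  shows "(poly_num_index k scaleX = 1 \<longleftrightarrow>
            (\<forall>x\<in>rho_tilde scaleX (hom_polys scaleX ((*) :: 'k \<Rightarrow> 'k \<Rightarrow> 'k) k).
             \<forall>xs\<in>ext_points (dual_ball scaleX). norm (blinfun_apply xs x) = 1)) \<and>
         (separable_space (euclidean :: 'a topology) \<longrightarrow>
           (poly_num_index k scaleX = 1 \<longleftrightarrow>
            (\<forall>x\<in>rho_tilde scaleX (hom_polys scaleX ((*) :: 'k \<Rightarrow> 'k \<Rightarrow> 'k) k).
             \<forall>xs\<in>weak_star_exposed scaleX. norm (blinfun_apply xs x) = 1)))"
proof -
  interpret normed_space_over scaleX by (rule assms(2))
  note from_norming = poly_num_index_eq_1_if_norming[OF assms]
  have ext: "norm (blinfun_apply xs x) = 1"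
    if "poly_num_index k scaleX = 1" "x \<in> rho_tilde scaleX (hom_polys scaleX ((*) :: 'k \<Rightarrow> 'k \<Rightarrow> 'k) k)"
      "xs \<in> ext_points (dual_ball scaleX)" for x xs
    using ext_point_unimodular_at_peak_point[OF assms(1,3) that] .
  have norming: "\<exists>xs\<in>ext_points (dual_ball scaleX). norm y - \<delta> \<le> norm (blinfun_apply xs y)"
    if "\<delta> > 0" for y \<delta>
  proof -
    obtain xs where "xs \<in> ext_points (dual_ball scaleX)" "blinfun_apply xs y = of_real (norm y)"
      using ext_point_norming by blast
    then show ?thesis using that by (intro bexI[of _ xs]) simp_all
  qed
  show ?thesis
  proof (intro conjI impI iffI ballI)
    show "poly_num_index k scaleX = 1"
      if "\<forall>x\<in>rho_tilde scaleX (hom_polys scaleX ((*) :: 'k \<Rightarrow> 'k \<Rightarrow> 'k) k).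
        \<forall>xs\<in>ext_points (dual_ball scaleX). norm (blinfun_apply xs x) = 1"
      by (rule from_norming[OF ext_points_subset norming]) (use that in auto)
    show "poly_num_index k scaleX = 1"
      if sep: "separable_space (euclidean :: 'a topology)"
        and "\<forall>x\<in>rho_tilde scaleX (hom_polys scaleX ((*) :: 'k \<Rightarrow> 'k \<Rightarrow> 'k) k).
        \<forall>xs\<in>weak_star_exposed scaleX. norm (blinfun_apply xs x) = 1"
      by (rule from_norming[OF order_trans[OF weak_star_exposed_subset ext_points_subset]
            weak_star_exposed_norming[OF assms(2,3) sep]]) (use that in auto)
  qed (use ext weak_star_exposed_subset in blast)+
qed

end
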